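(* Let $p\in\mathbb{N}$ and assume (A1) and (A2). Suppose the operator $\mathcal{I}-\mathcal{K}$ is injective on $L_2(I_{2\pi}^2)$, $g\in H_p(I_{2\pi}^2)$, $0<b<\min\{\frac{C_0^2}{\sqrt2M_0M_1},\frac{R_0}{2}\}$, and $q>0$ satisfies $qb\ge p/2$. Then there exists a constant $c>0$ such that for all sufficiently large $n$ and every $\varphi\in H_p(I_{2\pi}^2)$, $$\|(\mathcal{I}-\widetilde{\mathcal{K}}_n)\mathcal{P}_n\varphi\|\ge c\,\|\mathcal{P}_n\varphi\|,$$ and $$\|\rho-\tilde\rho_n\|\le c\,N^{-p/2}\ln N\,\|\rho\|_{H_p},$$ where $\rho$ is the solution of $(\mathcal{I}-\mathcal{K})\rho=g$ and $\tilde\rho_n\in X_n$ is the solution of $\tilde\rho_n-\widetilde{\mathcal{K}}_n\tilde\rho_n=\mathcal{P}_ng$ (here $\widetilde{\mathcal{K}}_n$ and $\tilde\rho_n$ depend on $q$).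
   Context: $I_{2\pi}=[0,2\pi)$. Let $\Gamma=[\gamma_0,\gamma_1,\gamma_2]^T:\mathbb{R}^2\to\mathbb{R}^3$ have $2\pi$-biperiodic differentiable components, with $\Gamma|_{I_{2\pi}^2}$ parametrizing the smooth boundary of a bounded open region in $\mathbb{R}^3$ that is $C^\infty$-diffeomorphic to a torus. For $\mathbf{a},\mathbf{b}\in\mathbb{C}^3$, $\mathbf{a}\cdot\mathbf{b}=\sum_ja_jb_j$, $\times$ the usual cross product, $\|\mathbf{a}\|_2=(\sum_j|a_j|^2)^{1/2}$; for matrices $\|\cdot\|_2$ is the induced operator norm. Kernel $K(\boldsymbol\theta,\boldsymbol\eta)=-\frac{1}{2\pi}\frac{(\Gamma(\boldsymbol\theta)-\Gamma(\boldsymbol\eta))\cdot(\frac{\partial\Gamma}{\partial\eta_0}\times\frac{\partial\Gamma}{\partial\eta_1})(\boldsymbol\eta)}{\|\Gamma(\boldsymbol\theta)-\Gamma(\boldsymbol\eta)\|_2^3}$; $(\mathcal{K}\varphi)(\boldsymbol\theta)=\int_{I_{2\pi}^2}K(\boldsymbol\theta,\boldsymbol\eta)\varphi(\boldsymbol\eta)d\boldsymbol\eta$ on $L_2(I_{2\pi}^2)$, norm $\|\cdot\|$, inner product $\langle f,g\rangle=\int f\bar g$; $\mathcal{I}$ is the identity. For $\mathbf{k}=[k_0,k_1]\in\mathbb{Z}^2$, $e_{\mathbf{k}}(\boldsymbol\theta)=\frac{1}{2\pi}e^{i(k_0\theta_0+k_1\theta_1)}$, $\|\mathbf{k}\|_1=|k_0|+|k_1|$,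 $\hat\varphi_{\mathbf{k}}=\langle\varphi,e_{\mathbf{k}}\rangle$, $K_{\mathbf{k},\mathbf{l}}=\langle\mathcal{K}e_{\mathbf{l}},e_{\mathbf{k}}\rangle$. For $n\in\mathbb{N}$: $N=(2n+1)^2$, $X_n=\mathrm{span}\{e_{\mathbf{k}}:\mathbf{k}\in\{-n,\dots,n\}^2\}$, $\mathcal{P}_n$ the orthogonal projection onto $X_n$; $\widetilde K_{\mathbf{k},\mathbf{l}}=K_{\mathbf{k},\mathbf{l}}$ if $\|\mathbf{k}-\mathbf{l}\|_1\le q\ln N$ and $0$ otherwise; $\widetilde{\mathcal{K}}_n$ is the integral operator with kernel $\sum_{\mathbf{k},\mathbf{l}\in\{-n,\dots,n\}^2}\widetilde K_{\mathbf{k},\mathbf{l}}e_{\mathbf{k}}(\boldsymbol\theta)\overline{e_{\mathbf{l}}(\boldsymbol\phi)}$. For $p\in\mathbb{N}$, $H_p(I_{2\pi}^2)=\{\varphi\in L_2(I_{2\pi}^2):\|\varphi\|_{H_p}<\infty\}$ with $\|\varphi\|_{H_p}=\big(\sum_{\mathbf{k}\in\mathbb{Z}^2}(1+k_0^2+k_1^2)^p|\hat\varphi_{\mathbf{k}}|^2\big)^{1/2}$. For $\boldsymbol\theta\in\mathbb{R}^2$, $\zeta(\boldsymbol\theta)=\sqrt{\mathrm{dist}(\theta_0,2\pi\mathbb{Z})^2+\mathrm{dist}(\theta_1,2\pi\mathbb{Z})^2}$; $\mathbb{W}(r)=\{z\in\mathbb{C}:|\mathrm{Im}\,z|<r\}$.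 (A1): there is $C_0>0$ with $\|\Gamma(\boldsymbol\theta)-\Gamma(\boldsymbol\eta)\|_2\ge C_0\zeta(\boldsymbol\theta-\boldsymbol\eta)$ for all $\boldsymbol\theta,\boldsymbol\eta\in I_{2\pi}^2$. (A2): there is $R_0>0$ such that each $\gamma_j$ extends analytically to the closure of $\mathbb{W}(R_0)^2\subset\mathbb{C}^2$. With $D\gamma_j$ the complex gradient, $\mathbf{H}_j$ the complex Hessian, $\mathrm{Re}(\mathbf{z})=[\mathrm{Re}\,z_0,\mathrm{Re}\,z_1]$: $M_{0,j}=\sup_{\mathbf{z}\in\mathbb{W}(R_0)^2}\|D\gamma_j(\mathbf{z})+D\gamma_j(\mathrm{Re}(\mathbf{z}))\|_2$, $M_{1,j}=\sup_{\mathbf{z}\in\mathbb{W}(R_0)^2}\|\mathbf{H}_j(\mathbf{z})\|_2$, $M_0=(\sum_jM_{0,j}^2)^{1/2}$, $M_1=(\sum_jM_{1,j}^2)^{1/2}$. *)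

theory Defs
  imports "HOL-Analysis.Analysis"
begin

definition Sq :: "(real \<times> real) set" where
  "Sq = {0..<2*pi} \<times> {0..<2*pi}"

definition twopiZ :: "real set" where
  "twopiZ = range (\<lambda>k::int. 2 * pi * of_int k)"

definition zeta :: "real \<times> real \<Rightarrow> real" where
  "zeta t = sqrt ((infdist (fst t) twopiZ)\<^sup>2 + (infdist (snd t) twopiZ)\<^sup>2)"

text \<open>C-infinity functions on an open subset of R^3: all iterated partial derivatives
  exist and are continuous on S (F l is the iterated partial derivative along the list l
  of coordinate directions).\<close>
definition smooth_on :: "(real^3) set \<Rightarrow> (real^3 \<Rightarrow> real) \<Rightarrow> bool" where
  "smooth_on S f \<longleftrightarrow> (\<exists>F :: 3 list \<Rightarrow> real^3 \<Rightarrow> real.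
      (\<forall>x\<in>S. F [] x = f x) \<and>
      (\<forall>l. continuous_on S (F l)) \<and>
      (\<forall>l i. \<forall>x\<in>S. ((\<lambda>t. F l (x + t *\<^sub>R axis i 1)) has_real_derivative F (i # l) x) (at 0)))"

definition smooth_map_on :: "(real^3) set \<Rightarrow> (real^3 \<Rightarrow> real^3) \<Rightarrow> bool" where
  "smooth_map_on S h \<longleftrightarrow> (\<forall>j. smooth_on S (\<lambda>x. h x $ j))"

definition Cinf_diffeomorphic :: "(real^3) set \<Rightarrow> (real^3) set \<Rightarrow> bool" where
  "Cinf_diffeomorphic A B \<longleftrightarrow> (\<exists>h h'. h ` A = B \<and> h' ` B = A \<and>
      (\<forall>x\<in>A. h' (h x) = x) \<and> (\<forall>y\<in>B. h (h' y) = y) \<and>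
      smooth_map_on A h \<and> smooth_map_on B h')"

definition solid_torus :: "(real^3) set" where
  "solid_torus = {x. (sqrt ((x $ 1)\<^sup>2 + (x $ 2)\<^sup>2) - 2)\<^sup>2 + (x $ 3)\<^sup>2 < 1}"

definition dGamma0 :: "(real \<times> real \<Rightarrow> real^3) \<Rightarrow> real \<times> real \<Rightarrow> real^3" where
  "dGamma0 G e = frechet_derivative G (at e) (1, 0)"

definition dGamma1 :: "(real \<times> real \<Rightarrow> real^3) \<Rightarrow> real \<times> real \<Rightarrow> real^3" where
  "dGamma1 G e = frechet_derivative G (at e) (0, 1)"

definition kernK :: "(real \<times> real \<Rightarrow> real^3) \<Rightarrow> real \<times> real \<Rightarrow> real \<times> real \<Rightarrow> real" where
  "kernK G t e = - (1 / (2*pi)) *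
     (((G t - G e) \<bullet> cross3 (dGamma0 G e) (dGamma1 G e)) / (norm (G t - G e)) ^ 3)"

definition Kop :: "(real \<times> real \<Rightarrow> real^3) \<Rightarrow> (real \<times> real \<Rightarrow> complex) \<Rightarrow> real \<times> real \<Rightarrow> complex" where
  "Kop G \<phi> t = (LINT e:Sq|lborel. complex_of_real (kernK G t e) * \<phi> e)"

definition L2 :: "(real \<times> real \<Rightarrow> complex) set" where
  "L2 = {f. set_borel_measurable lborel Sq f \<and>
            set_integrable lborel Sq (\<lambda>x. (cmod (f x))\<^sup>2)}"

definition L2norm :: "(real \<times> real \<Rightarrow> complex) \<Rightarrow> real" where
  "L2norm f = sqrt (LINT x:Sq|lborel. (cmod (f x))\<^sup>2)"

definition L2inner :: "(real \<times> real \<Rightarrow> complex) \<Rightarrow> (real \<times> real \<Rightarrow> complex) \<Rightarrow> complex" where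
  "L2inner f g = (LINT x:Sq|lborel. f x * cnj (g x))"

definition ebas :: "int \<times> int \<Rightarrow> real \<times> real \<Rightarrow> complex" where
  "ebas k t = (1 / (2 * complex_of_real pi)) *
     exp (\<i> * complex_of_real (of_int (fst k) * fst t + of_int (snd k) * snd t))"

definition fcoef :: "(real \<times> real \<Rightarrow> complex) \<Rightarrow> int \<times> int \<Rightarrow> complex" where
  "fcoef \<phi> k = L2inner \<phi> (ebas k)"

definition norm1 :: "int \<times> int \<Rightarrow> int" where
  "norm1 k = \<bar>fst k\<bar> + \<bar>snd k\<bar>"

definition idx :: "nat \<Rightarrow> (int \<times> int) set" where
  "idx n = {- int n..int n} \<times> {- int n..int n}"

definition bigN :: "nat \<Rightarrow> real" where
  "bigN n = (2 * real n + 1)\<^sup>2"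

definition Xn :: "nat \<Rightarrow> (real \<times> real \<Rightarrow> complex) set" where
  "Xn n = {f. \<exists>c. \<forall>t. f t = (\<Sum>k\<in>idx n. c k * ebas k t)}"

definition Pn :: "nat \<Rightarrow> (real \<times> real \<Rightarrow> complex) \<Rightarrow> real \<times> real \<Rightarrow> complex" where
  "Pn n \<phi> t = (\<Sum>k\<in>idx n. fcoef \<phi> k * ebas k t)"

definition Kmat :: "(real \<times> real \<Rightarrow> real^3) \<Rightarrow> int \<times> int \<Rightarrow> int \<times> int \<Rightarrow> complex" where
  "Kmat G k l = L2inner (Kop G (ebas l)) (ebas k)"

definition Ktmat :: "(real \<times> real \<Rightarrow> real^3) \<Rightarrow> real \<Rightarrow> nat \<Rightarrow> int \<times> int \<Rightarrow> int \<times> int \<Rightarrow> complex" where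
  "Ktmat G q n k l = (if real_of_int (norm1 (k - l)) \<le> q * ln (bigN n) then Kmat G k l else 0)"

definition Ktop :: "(real \<times> real \<Rightarrow> real^3) \<Rightarrow> real \<Rightarrow> nat \<Rightarrow> (real \<times> real \<Rightarrow> complex) \<Rightarrow> real \<times> real \<Rightarrow> complex" where
  "Ktop G q n \<phi> t = (LINT e:Sq|lborel.
      (\<Sum>k\<in>idx n. \<Sum>l\<in>idx n. Ktmat G q n k l * ebas k t * cnj (ebas l e)) * \<phi> e)"

definition Hp :: "nat \<Rightarrow> (real \<times> real \<Rightarrow> complex) set" where
  "Hp p = {f \<in> L2. (\<lambda>k. (1 + (of_int (fst k))\<^sup>2 + (of_int (snd k))\<^sup>2) ^ p * (cmod (fcoef f k))\<^sup>2 :: real)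
                     summable_on UNIV}"

definition Hpnorm :: "nat \<Rightarrow> (real \<times> real \<Rightarrow> complex) \<Rightarrow> real" where
  "Hpnorm p f = sqrt (\<Sum>\<^sub>\<infinity>k. (1 + (of_int (fst k))\<^sup>2 + (of_int (snd k))\<^sup>2) ^ p * (cmod (fcoef f k))\<^sup>2 :: real)"

definition strip :: "real \<Rightarrow> complex set" where
  "strip r = {z. \<bar>Im z\<bar> < r}"

definition cstrip :: "real \<Rightarrow> complex set" where
  "cstrip r = {z. \<bar>Im z\<bar> \<le> r}"

text \<open>Analytic (holomorphic) on an open set of C^2: continuous and holomorphic in each variable
  separately (equivalent to joint holomorphy by Osgood's lemma).\<close>
definition holo2_on :: "(complex \<times> complex) set \<Rightarrow> (complex \<times> complex \<Rightarrow> complex) \<Rightarrow> bool" where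
  "holo2_on U F \<longleftrightarrow> open U \<and> continuous_on U F \<and>
     (\<forall>z\<in>U. (\<lambda>w. F (w, snd z)) field_differentiable at (fst z) \<and>
             (\<lambda>w. F (fst z, w)) field_differentiable at (snd z))"

definition analytic_ext_closure :: "real \<Rightarrow> (real \<times> real \<Rightarrow> real) \<Rightarrow> (complex \<times> complex \<Rightarrow> complex) \<Rightarrow> bool" where
  "analytic_ext_closure R g F \<longleftrightarrow> (\<exists>U. cstrip R \<times> cstrip R \<subseteq> U \<and> holo2_on U F) \<and>
     (\<forall>x y. F (complex_of_real x, complex_of_real y) = complex_of_real (g (x, y)))"

definition pd0 :: "(complex \<times> complex \<Rightarrow> complex) \<Rightarrow> complex \<times> complex \<Rightarrow> complex" where
  "pd0 F z = deriv (\<lambda>w. F (w, snd z)) (fst z)"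

definition pd1 :: "(complex \<times> complex \<Rightarrow> complex) \<Rightarrow> complex \<times> complex \<Rightarrow> complex" where
  "pd1 F z = deriv (\<lambda>w. F (fst z, w)) (snd z)"

definition cnorm2 :: "complex \<Rightarrow> complex \<Rightarrow> real" where
  "cnorm2 a b = sqrt ((cmod a)\<^sup>2 + (cmod b)\<^sup>2)"

definition cmat_norm :: "complex \<Rightarrow> complex \<Rightarrow> complex \<Rightarrow> complex \<Rightarrow> real" where
  "cmat_norm a b c d = Sup ((\<lambda>v. cnorm2 (a * fst v + b * snd v) (c * fst v + d * snd v)) `
                            {v. cnorm2 (fst v) (snd v) = 1})"

definition Re2 :: "complex \<times> complex \<Rightarrow> complex \<times> complex" where
  "Re2 z = (complex_of_real (Re (fst z)), complex_of_real (Re (snd z)))"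

definition M0j :: "real \<Rightarrow> (complex \<times> complex \<Rightarrow> complex) \<Rightarrow> real" where
  "M0j R F = Sup ((\<lambda>z. cnorm2 (pd0 F z + pd0 F (Re2 z)) (pd1 F z + pd1 F (Re2 z)))
                  ` (strip R \<times> strip R))"

definition M1j :: "real \<Rightarrow> (complex \<times> complex \<Rightarrow> complex) \<Rightarrow> real" where
  "M1j R F = Sup ((\<lambda>z. cmat_norm (pd0 (pd0 F) z) (pd1 (pd0 F) z) (pd0 (pd1 F) z) (pd1 (pd1 F) z))
                  ` (strip R \<times> strip R))"

definition M0 :: "real \<Rightarrow> (3 \<Rightarrow> complex \<times> complex \<Rightarrow> complex) \<Rightarrow> real" where
  "M0 R F = sqrt (\<Sum>j\<in>UNIV. (M0j R (F j))\<^sup>2)"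

definition M1 :: "real \<Rightarrow> (3 \<Rightarrow> complex \<times> complex \<Rightarrow> complex) \<Rightarrow> real" where
  "M1 R F = sqrt (\<Sum>j\<in>UNIV. (M1j R (F j))\<^sup>2)"

end

theory Submission
  imports Defs "HOL-Complex_Analysis.Complex_Analysis"
begin

text \<open>
  In the variables \<open>(t, v)\<close> with \<open>e = t - v\<close> the kernel extends analytically in \<open>t\<close> to a product of
  strips \<open>\<bar>Im z\<bar> < B\<close> for every \<open>B < min (C0\<^sup>2 / (sqrt 2 * M0 * M1)) R0\<close>: the squared distance
  \<open>\<Sum>j. (\<gamma>\<^sub>j z - \<gamma>\<^sub>j (z - v))\<^sup>2\<close> differs from its value at \<open>Re z\<close> by at most \<open>sqrt 2 * B * M0 * M1 * \<parallel>v\<parallel>\<^sup>2\<close>,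
  hence stays in the right half plane by (A1), and the numerator is \<open>O(\<parallel>v\<parallel>\<^sup>2)\<close>, so that the continued
  kernel is \<open>O(1/\<parallel>v\<parallel>)\<close>. Shifting contours in \<open>t\<close> gives \<open>\<bar>K\<^bsub>k,l\<^esub>\<bar> \<le> C exp (- \<beta> \<parallel>k - l\<parallel>\<^sub>1)\<close> with \<open>\<beta> > b\<close>, and the
  Riemann-Lebesgue lemma in \<open>v\<close> makes every diagonal of the matrix tend to zero.

  Everything else takes place on square-summable sequences. Outside finitely many columns the
  matrix has small norm, also with respect to the Sobolev weights. This yields regularity
  of solutions, the lower bound for \<open>I - K\<close> from injectivity by a compactness argument, and the
  convergence of the truncated Galerkin sections. Since \<open>\<beta> > b\<close>, the truncation error is
  \<open>O(N powr (- p / 2))\<close> without the logarithm; the factor \<open>ln N\<close> then absorbs the constants, so that the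
  same \<open>c\<close> serves in both estimates.
\<close>

section \<open>Square-integrable functions and the Schur test\<close>

text \<open>The obstacle is the singularity at \<open>t = e\<close>, which rules out analytic
  continuation in the pair \<open>(t, e)\<close>. With the displacement \<open>v\<close> fixed it
  sits in a parameter: \<open>t \<mapsto> K(t, t - v)\<close> is periodic and analytic, and, up to
  normalisation, entry \<open>(l + m, l)\<close> is the \<open>l\<close>-th Fourier coefficient in
  \<open>v\<close> of the \<open>m\<close>-th Fourier coefficient in \<open>t\<close>. Analyticity
  yields decay in \<open>m\<close>; in \<open>v\<close> there is only a bound that is integrable but
  not square integrable in the plane, hence diagonals that vanish without a rate. Smallness outside
  finitely many columns plays the role of compactness of the operator, and it persists in weighted
  norms because exponential decay absorbs polynomial factors. Regularity is used twice: it puts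
  \<open>\<rho>\<close> into \<open>Hp p\<close>, and it makes square-summable fixed vectors of the
  matrix absolutely summable, so that they are Fourier coefficients of a function and the
  injectivity hypothesis applies. Two gaps between exponents matter. The one between
  \<open>b\<close> and \<open>\<beta>\<close> pays for summing the discarded entries over a
  two-dimensional lattice, the one between \<open>\<beta>\<close> and \<open>B\<close> for shifting
  contours inside an open strip.\<close>

lemma ennreal_two_mult_le_squares: "2 * (a * b) \<le> a\<^sup>2 + b\<^sup>2" for a b :: ennreal
proof (cases "a = top \<or> b = top")
  case True
  then show ?thesis by (auto simp: power2_eq_square)
next
  case False
  then obtain x y where "a = ennreal x" "b = ennreal y" "x \<ge> 0" "y \<ge> 0"
    by (metis ennreal_enn2real enn2real_nonneg less_top)
  moreover have "2 * (x * y) \<le> x\<^sup>2 + y\<^sup>2" using sum_squares_bound[of x y] by (simp add: mult.assoc)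
  ultimately show ?thesis
    by (simp add: ennreal_mult[symmetric] ennreal_plus[symmetric] ennreal_power ennreal_leI
        flip: ennreal_numeral del: ennreal_plus)
qed

text \<open>Integrating \<open>2 * a * b <= a^2 + b^2\<close> with \<open>a = u x * v y\<close> and
  \<open>b = u y * v x\<close> over both variables gives the inequality with a factor 2 on each
  side. There is no division by norms, so the values 0 and infinity need no separate
  treatment.\<close>

lemma nn_integral_Cauchy_Schwarz:
  fixes u v :: "'a \<Rightarrow> ennreal"
  assumes [measurable]: "u \<in> borel_measurable M" "v \<in> borel_measurable M"
  shows "(\<integral>\<^sup>+x. u x * v x \<partial>M)\<^sup>2 \<le> (\<integral>\<^sup>+x. (u x)\<^sup>2 \<partial>M) * (\<integral>\<^sup>+x. (v x)\<^sup>2 \<partial>M)"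
proof -
  let ?U = "\<integral>\<^sup>+x. (u x)\<^sup>2 \<partial>M" and ?V = "\<integral>\<^sup>+x. (v x)\<^sup>2 \<partial>M"
  have "2 * (\<integral>\<^sup>+x. u x * v x \<partial>M)\<^sup>2 = (\<integral>\<^sup>+x. (\<integral>\<^sup>+y. 2 * ((u x * v y) * (u y * v x)) \<partial>M) \<partial>M)"
  proof -
    have "(\<integral>\<^sup>+y. 2 * ((u x * v y) * (u y * v x)) \<partial>M) = 2 * (\<integral>\<^sup>+x. u x * v x \<partial>M) * (u x * v x)" for x
    proof -
      have "(\<integral>\<^sup>+y. 2 * ((u x * v y) * (u y * v x)) \<partial>M) = (\<integral>\<^sup>+y. (2 * (u x * v x)) * (u y * v y) \<partial>M)"
        by (intro nn_integral_cong) (simp add: mult_ac)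
      also have "\<dots> = (2 * (u x * v x)) * (\<integral>\<^sup>+x. u x * v x \<partial>M)"
        by (rule nn_integral_cmult) measurable
      finally show ?thesis by (simp add: mult_ac)
    qed
    then have "(\<integral>\<^sup>+x. (\<integral>\<^sup>+y. 2 * ((u x * v y) * (u y * v x)) \<partial>M) \<partial>M)
        = (\<integral>\<^sup>+x. 2 * (\<integral>\<^sup>+x. u x * v x \<partial>M) * (u x * v x) \<partial>M)"
      by simp
    also have "\<dots> = 2 * (\<integral>\<^sup>+x. u x * v x \<partial>M) * (\<integral>\<^sup>+x. u x * v x \<partial>M)"
      by (rule nn_integral_cmult) measurable
    finally show ?thesis by (simp add: power2_eq_square mult_ac)
  qed
  also have "\<dots> \<le> (\<integral>\<^sup>+x. (\<integral>\<^sup>+y. (u x * v y)\<^sup>2 + (u y * v x)\<^sup>2 \<partial>M) \<partial>M)"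
    by (intro nn_integral_mono ennreal_two_mult_le_squares)
  also have "\<dots> = (\<integral>\<^sup>+x. (u x)\<^sup>2 * ?V + ?U * (v x)\<^sup>2 \<partial>M)"
    by (intro nn_integral_cong) (simp add: power_mult_distrib nn_integral_add nn_integral_cmult nn_integral_multc)
  also have "\<dots> = 2 * (?U * ?V)"
    by (simp add: nn_integral_add nn_integral_cmult nn_integral_multc mult_2)
  finally show ?thesis
    by (subst (asm) ennreal_mult_le_mult_iff) auto
qed

text \<open>Formulated for an arbitrary measure because it serves both functions on the square and
  sequences over \<open>countZ2\<close>; Parseval's identity then compares two instances of
  \<open>sqnorm\<close>. Working with squared norms, triangle inequalities cost a factor 2 and no
  roots appear.\<close>

definition sqint :: "'a measure \<Rightarrow> ('a \<Rightarrow> complex) \<Rightarrow> bool" where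
  "sqint M f \<longleftrightarrow> f \<in> borel_measurable M \<and> integrable M (\<lambda>x. (cmod (f x))\<^sup>2)"

definition sqnorm :: "'a measure \<Rightarrow> ('a \<Rightarrow> complex) \<Rightarrow> real" where
  "sqnorm M f = (\<integral>x. (cmod (f x))\<^sup>2 \<partial>M)"

lemma sqnorm_nonneg [simp]: "sqnorm M f \<ge> 0"
  by (simp add: sqnorm_def)

lemma sqint_measurable [measurable_dest]: "sqint M f \<Longrightarrow> f \<in> borel_measurable M"
  by (simp add: sqint_def)

lemma sqint_bound:
  assumes "sqint M f" "g \<in> borel_measurable M" "\<And>x. x \<in> space M \<Longrightarrow> cmod (g x) \<le> c * cmod (f x)"
  shows "sqint M g" "sqnorm M g \<le> c\<^sup>2 * sqnorm M f"
proof -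
  have le: "(cmod (g x))\<^sup>2 \<le> c\<^sup>2 * (cmod (f x))\<^sup>2" if "x \<in> space M" for x
    using power_mono[OF assms(3)[OF that] norm_ge_zero, of 2] by (simp add: power_mult_distrib)
  have i: "integrable M (\<lambda>x. c\<^sup>2 * (cmod (f x))\<^sup>2)" using assms(1) by (simp add: sqint_def)
  have i2: "integrable M (\<lambda>x. (cmod (g x))\<^sup>2)"
    by (rule Bochner_Integration.integrable_bound[OF i]) (use assms(2) le in auto)
  then show "sqint M g" using assms(2) by (simp add: sqint_def)
  show "sqnorm M g \<le> c\<^sup>2 * sqnorm M f"
    using integral_mono[OF i2 i] le by (simp add: sqnorm_def)
qed

lemma sqint_add:
  assumes "sqint M f" "sqint M g"
  shows "sqint M (\<lambda>x. f x + g x)" and "sqnorm M (\<lambda>x. f x + g x) \<le> 2 * sqnorm M f + 2 * sqnorm M g"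
proof -
  have le: "(cmod (f x + g x))\<^sup>2 \<le> 2 * (cmod (f x))\<^sup>2 + 2 * (cmod (g x))\<^sup>2" for x
  proof -
    have "(cmod (f x + g x))\<^sup>2 \<le> (cmod (f x) + cmod (g x))\<^sup>2"
      by (intro power_mono norm_triangle_ineq) auto
    then show ?thesis using sum_squares_bound[of "cmod (f x)" "cmod (g x)"]
      by (simp add: power2_sum)
  qed
  have i: "integrable M (\<lambda>x. 2 * (cmod (f x))\<^sup>2 + 2 * (cmod (g x))\<^sup>2)"
    using assms by (simp add: sqint_def)
  have i2: "integrable M (\<lambda>x. (cmod (f x + g x))\<^sup>2)"
    by (rule Bochner_Integration.integrable_bound[OF i]) (use assms le in \<open>auto simp: sqint_def\<close>)
  then show "sqint M (\<lambda>x. f x + g x)" using assms by (auto simp: sqint_def)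
  show "sqnorm M (\<lambda>x. f x + g x) \<le> 2 * sqnorm M f + 2 * sqnorm M g"
    using integral_mono[OF i2 i le] assms by (simp add: sqnorm_def sqint_def)
qed

lemma sqint_cmult:
  assumes "sqint M f" shows "sqint M (\<lambda>x. c * f x)" and "sqnorm M (\<lambda>x. c * f x) = (cmod c)\<^sup>2 * sqnorm M f"
  using assms by (auto simp: sqint_def sqnorm_def norm_mult power_mult_distrib)

lemma sqint_diff:
  assumes "sqint M f" "sqint M g"
  shows "sqint M (\<lambda>x. f x - g x)" and "sqnorm M (\<lambda>x. f x - g x) \<le> 2 * sqnorm M f + 2 * sqnorm M g"
  using sqint_add[OF assms(1) sqint_cmult(1)[OF assms(2), of "-1"]] sqint_cmult(2)[OF assms(2), of "-1"] by auto

lemma sqint_zero [simp]: "sqint M (\<lambda>x. 0)" and sqnorm_zero [simp]: "sqnorm M (\<lambda>x. 0) = 0"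
  by (simp_all add: sqint_def sqnorm_def)

lemma sqint_sum: "(\<And>i. i \<in> I \<Longrightarrow> sqint M (f i)) \<Longrightarrow> sqint M (\<lambda>x. \<Sum>i\<in>I. f i x)"
  by (induction I rule: infinite_finite_induct) (auto intro: sqint_add)

lemma sqint_cong_AE:
  assumes "sqint M f" "g \<in> borel_measurable M" "AE x in M. f x = g x"
  shows "sqint M g" "sqnorm M g = sqnorm M f"
proof -
  have [measurable]: "f \<in> borel_measurable M" using assms by (simp add: sqint_def)
  note [measurable] = assms(2)
  have "integrable M (\<lambda>x. (cmod (g x))\<^sup>2) \<longleftrightarrow> integrable M (\<lambda>x. (cmod (f x))\<^sup>2)"
    using assms(3) by (intro integrable_cong_AE) auto
  then show "sqint M g" using assms by (simp add: sqint_def)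
  show "sqnorm M g = sqnorm M f" unfolding sqnorm_def
    using assms(3) by (intro integral_cong_AE) auto
qed

lemma sqnorm_eq_0_iff: "sqint M f \<Longrightarrow> sqnorm M f = 0 \<longleftrightarrow> (AE x in M. f x = 0)"
  unfolding sqint_def sqnorm_def by (subst integral_nonneg_eq_0_iff_AE) auto

lemma nn_integral_sq:
  assumes "sqint M f" shows "(\<integral>\<^sup>+x. (ennreal (cmod (f x)))\<^sup>2 \<partial>M) = ennreal (sqnorm M f)"
  using assms by (subst ennreal_power) (auto simp: sqint_def sqnorm_def nn_integral_eq_integral)

lemma sqintI_nn:
  assumes "f \<in> borel_measurable M" "(\<integral>\<^sup>+x. (ennreal (cmod (f x)))\<^sup>2 \<partial>M) \<le> ennreal c" "c \<ge> 0"
  shows "sqint M f" "sqnorm M f \<le> c"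
proof -
  note [measurable] = assms(1)
  have *: "(\<integral>\<^sup>+x. ennreal ((cmod (f x))\<^sup>2) \<partial>M) \<le> ennreal c"
    using assms(2) by (simp add: ennreal_power)
  have "integrable M (\<lambda>x. (cmod (f x))\<^sup>2)"
    using * by (intro integrableI_bounded) (auto intro: le_less_trans)
  then show 1: "sqint M f" using assms(1) by (simp add: sqint_def)
  show "sqnorm M f \<le> c" using nn_integral_sq[OF 1] assms(2,3) by simp
qed

lemma sqint_mult_integrable:
  assumes "sqint M f" "sqint M g"
  shows "integrable M (\<lambda>x. f x * g x)" "(cmod (\<integral>x. f x * g x \<partial>M))\<^sup>2 \<le> sqnorm M f * sqnorm M g"
proof -
  have [measurable]: "f \<in> borel_measurable M" "g \<in> borel_measurable M" using assms by (auto simp: sqint_def)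
  have CS: "(\<integral>\<^sup>+x. ennreal (cmod (f x)) * ennreal (cmod (g x)) \<partial>M)\<^sup>2 \<le> ennreal (sqnorm M f * sqnorm M g)"
    using nn_integral_Cauchy_Schwarz[of "\<lambda>x. ennreal (cmod (f x))" M "\<lambda>x. ennreal (cmod (g x))"]
      nn_integral_sq[OF assms(1)] nn_integral_sq[OF assms(2)] by (simp add: ennreal_mult)
  have eq: "(\<integral>\<^sup>+x. ennreal (cmod (f x)) * ennreal (cmod (g x)) \<partial>M) = (\<integral>\<^sup>+x. ennreal (norm (f x * g x)) \<partial>M)"
    by (simp add: norm_mult ennreal_mult)
  show i: "integrable M (\<lambda>x. f x * g x)"
  proof (rule integrableI_bounded)
    show "(\<integral>\<^sup>+x. ennreal (norm (f x * g x)) \<partial>M) < \<infinity>"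
      using CS unfolding eq by (cases "(\<integral>\<^sup>+x. ennreal (norm (f x * g x)) \<partial>M) = top")
        (auto simp: less_top power2_eq_square ennreal_top_mult top_unique)
  qed auto
  have "ennreal ((\<integral>x. norm (f x * g x) \<partial>M)\<^sup>2) \<le> ennreal (sqnorm M f * sqnorm M g)"
    using CS unfolding eq using nn_integral_eq_integral[OF integrable_norm[OF i]]
    by (simp add: ennreal_power)
  then have "(\<integral>x. norm (f x * g x) \<partial>M)\<^sup>2 \<le> sqnorm M f * sqnorm M g" by simp
  moreover have "(cmod (\<integral>x. f x * g x \<partial>M))\<^sup>2 \<le> (\<integral>x. norm (f x * g x) \<partial>M)\<^sup>2"
    by (intro power_mono) auto
  ultimately show "(cmod (\<integral>x. f x * g x \<partial>M))\<^sup>2 \<le> sqnorm M f * sqnorm M g" by linarith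
qed

text \<open>The Bochner integral of a non-integrable function is 0, so the bound holds for every
  \<open>f\<close>.\<close>

lemma norm_integral_le_nn_integral:
  fixes f :: "'a \<Rightarrow> complex"
  shows "ennreal (cmod (\<integral>x. f x \<partial>M)) \<le> (\<integral>\<^sup>+x. ennreal (cmod (f x)) \<partial>M)"
  by (cases "integrable M f") (auto simp: integral_norm_bound_ennreal not_integrable_integral_eq)

text \<open>Cauchy-Schwarz for the pair \<open>1\<close>, \<open>cmod f\<close> in the measure with
  density \<open>cmod (k t e)\<close> replaces the usual splitting of the kernel into two square
  roots and produces \<open>C1\<close>. Integrating in \<open>t\<close> and exchanging the integrals
  then produces \<open>C2\<close>.\<close>

lemma Schur_test:
  fixes k :: "'a \<Rightarrow> 'b \<Rightarrow> complex"
  assumes "sigma_finite_measure M" "sigma_finite_measure N"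
    and [measurable]: "case_prod k \<in> borel_measurable (M \<Otimes>\<^sub>M N)"
    and C1: "\<And>t. t \<in> space M \<Longrightarrow> (\<integral>\<^sup>+e. ennreal (cmod (k t e)) \<partial>N) \<le> ennreal C1" "C1 \<ge> 0"
    and C2: "\<And>e. e \<in> space N \<Longrightarrow> (\<integral>\<^sup>+t. ennreal (cmod (k t e)) \<partial>M) \<le> ennreal C2" "C2 \<ge> 0"
    and f: "sqint N f"
  shows "sqint M (\<lambda>t. \<integral>e. k t e * f e \<partial>N)" "sqnorm M (\<lambda>t. \<integral>e. k t e * f e \<partial>N) \<le> C1 * C2 * sqnorm N f"
    and "AE t in M. integrable N (\<lambda>e. k t e * f e)"
proof -
  interpret M: sigma_finite_measure M by fact
  interpret N: sigma_finite_measure N by fact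
  interpret pair_sigma_finite M N by unfold_locales
  have [measurable]: "f \<in> borel_measurable N" using f by (simp add: sqint_def)
  have step: "(\<integral>\<^sup>+e. ennreal (cmod (k t e * f e)) \<partial>N)\<^sup>2
       \<le> ennreal C1 * (\<integral>\<^sup>+e. ennreal (cmod (k t e)) * (ennreal (cmod (f e)))\<^sup>2 \<partial>N)"
    if t: "t \<in> space M" for t
  proof -
    note [measurable] = measurable_compose[OF measurable_Pair1'[OF t] assms(3), simplified]
    let ?D = "density N (\<lambda>e. ennreal (cmod (k t e)))"
    have "(\<integral>\<^sup>+e. ennreal (cmod (k t e * f e)) \<partial>N) = (\<integral>\<^sup>+e. 1 * ennreal (cmod (f e)) \<partial>?D)"
      by (subst nn_integral_density) (auto simp: norm_mult ennreal_mult)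
    then have "(\<integral>\<^sup>+e. ennreal (cmod (k t e * f e)) \<partial>N)\<^sup>2
       \<le> (\<integral>\<^sup>+e. 1\<^sup>2 \<partial>?D) * (\<integral>\<^sup>+e. (ennreal (cmod (f e)))\<^sup>2 \<partial>?D)"
      using nn_integral_Cauchy_Schwarz[of "\<lambda>_. 1" ?D "\<lambda>e. ennreal (cmod (f e))"] by simp
    also have "\<dots> \<le> ennreal C1 * (\<integral>\<^sup>+e. ennreal (cmod (k t e)) * (ennreal (cmod (f e)))\<^sup>2 \<partial>N)"
      using C1(1)[OF t] by (intro mult_mono) (auto simp: nn_integral_density simp del: nn_integral_const)
    finally show ?thesis .
  qed
  have tot: "(\<integral>\<^sup>+t. (\<integral>\<^sup>+e. ennreal (cmod (k t e * f e)) \<partial>N)\<^sup>2 \<partial>M) \<le> ennreal (C1 * C2 * sqnorm N f)"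
  proof -
    have "(\<integral>\<^sup>+t. (\<integral>\<^sup>+e. ennreal (cmod (k t e * f e)) \<partial>N)\<^sup>2 \<partial>M)
       \<le> (\<integral>\<^sup>+t. ennreal C1 * (\<integral>\<^sup>+e. ennreal (cmod (k t e)) * (ennreal (cmod (f e)))\<^sup>2 \<partial>N) \<partial>M)"
      by (intro nn_integral_mono step)
    also have "\<dots> = ennreal C1 * (\<integral>\<^sup>+t. (\<integral>\<^sup>+e. ennreal (cmod (k t e)) * (ennreal (cmod (f e)))\<^sup>2 \<partial>N) \<partial>M)"
      by (intro nn_integral_cmult) measurable
    also have "(\<integral>\<^sup>+t. (\<integral>\<^sup>+e. ennreal (cmod (k t e)) * (ennreal (cmod (f e)))\<^sup>2 \<partial>N) \<partial>M)
        = (\<integral>\<^sup>+e. (\<integral>\<^sup>+t. ennreal (cmod (k t e)) * (ennreal (cmod (f e)))\<^sup>2 \<partial>M) \<partial>N)"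
      by (intro Fubini'[symmetric]) measurable
    also have "\<dots> = (\<integral>\<^sup>+e. (\<integral>\<^sup>+t. ennreal (cmod (k t e)) \<partial>M) * (ennreal (cmod (f e)))\<^sup>2 \<partial>N)"
      by (intro nn_integral_cong nn_integral_multc) measurable
    also have "\<dots> \<le> (\<integral>\<^sup>+e. ennreal C2 * (ennreal (cmod (f e)))\<^sup>2 \<partial>N)"
      by (intro nn_integral_mono mult_right_mono C2) auto
    also have "\<dots> = ennreal C2 * ennreal (sqnorm N f)"
      using nn_integral_sq[OF f] by (subst nn_integral_cmult) auto
    finally show ?thesis
      using C1(2) C2(2) by (simp add: ennreal_mult mult_left_mono mult.assoc)
  qed
  have meas: "(\<lambda>t. \<integral>e. k t e * f e \<partial>N) \<in> borel_measurable M" by measurable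
  have "(\<integral>\<^sup>+t. (ennreal (cmod (\<integral>e. k t e * f e \<partial>N)))\<^sup>2 \<partial>M) \<le> ennreal (C1 * C2 * sqnorm N f)"
    by (rule order_trans[OF _ tot], intro nn_integral_mono power_mono norm_integral_le_nn_integral)
      auto
  from sqintI_nn[OF meas this] C1(2) C2(2)
  show "sqint M (\<lambda>t. \<integral>e. k t e * f e \<partial>N)" "sqnorm M (\<lambda>t. \<integral>e. k t e * f e \<partial>N) \<le> C1 * C2 * sqnorm N f" by auto
  have "AE t in M. (\<integral>\<^sup>+e. ennreal (cmod (k t e * f e)) \<partial>N)\<^sup>2 \<noteq> \<infinity>"
    by (rule nn_integral_noteq_infinite) (use tot in \<open>auto simp: top_unique\<close>)
  then show "AE t in M. integrable N (\<lambda>e. k t e * f e)"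
  proof (rule AE_mp[OF _ AE_I2[OF impI]])
    fix t assume t: "t \<in> space M" and fin: "(\<integral>\<^sup>+e. ennreal (cmod (k t e * f e)) \<partial>N)\<^sup>2 \<noteq> \<infinity>"
    note [measurable] = measurable_compose[OF measurable_Pair1'[OF t] assms(3), simplified]
    show "integrable N (\<lambda>e. k t e * f e)"
      using fin by (intro integrableI_bounded) (auto simp: less_top power2_eq_square ennreal_mult_eq_top_iff)
  qed
qed

section \<open>Matrices with exponential off-diagonal decay on the square-summable sequences\<close>

abbreviation countZ2 :: "(int \<times> int) measure" where "countZ2 \<equiv> count_space UNIV"

abbreviation rnorm1 :: "int \<times> int \<Rightarrow> real" where "rnorm1 k \<equiv> real_of_int (norm1 k)"

lemma norm1_nonneg [simp]: "norm1 k \<ge> 0"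
  by (simp add: norm1_def)

lemma finite_idx [simp]: "finite (idx n)"
  by (simp add: idx_def)

lemma idx_mono: "m \<le> n \<Longrightarrow> idx m \<subseteq> idx n"
  by (auto simp: idx_def)

lemma in_idx_norm1: "k \<in> idx (nat (norm1 k))"
  by (cases k) (auto simp: idx_def norm1_def)

lemma finite_subset_idx: "finite L \<Longrightarrow> \<exists>n0. \<forall>n\<ge>n0. L \<subseteq> idx n"
proof -
  assume L: "finite L"
  define n0 where "n0 = Max (insert 0 ((\<lambda>k. nat (norm1 k)) ` L))"
  have "nat (norm1 k) \<le> n0" if "k \<in> L" for k
    unfolding n0_def using L that by (intro Max_ge) auto
  then show ?thesis
    using in_idx_norm1 idx_mono by (meson order_trans subsetD subsetI)
qed

lemma integrable_count_space_int: "integrable (count_space (UNIV::int set)) (\<lambda>k. 1 / (1 + (real_of_int k)\<^sup>2))"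
proof -
  have s: "summable (\<lambda>n. 1 / (1 + (real n)\<^sup>2))"
  proof (rule summable_comparison_test')
    show "summable (\<lambda>n. inverse ((real n)\<^sup>2))" by (rule inverse_power_summable) simp
    show "norm (1 / (1 + (real n)\<^sup>2)) \<le> inverse ((real n)\<^sup>2)" if "n \<ge> 1" for n
    proof -
      have "1 / (1 + (real n)\<^sup>2) \<le> 1 / (real n)\<^sup>2" by (rule frac_le) (use that in auto)
      moreover have "0 \<le> 1 / (1 + (real n)\<^sup>2)" by simp
      ultimately show ?thesis by (simp add: inverse_eq_divide)
    qed
  qed
  have son: "(\<lambda>n::nat. 1 / (1 + (real n)\<^sup>2)) summable_on UNIV"
    using s by (subst summable_on_UNIV_nonneg_real_iff) auto
  have "(\<lambda>k. 1 / (1 + (real_of_int k)\<^sup>2)) summable_on (range int)"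
    by (subst summable_on_reindex) (auto simp: o_def son)
  moreover have "(\<lambda>k. 1 / (1 + (real_of_int k)\<^sup>2)) summable_on (range (\<lambda>n. - int n))"
    by (subst summable_on_reindex) (auto simp: o_def son inj_on_def)
  ultimately have "(\<lambda>k. 1 / (1 + (real_of_int k)\<^sup>2)) summable_on (range int \<union> range (\<lambda>n. - int n))"
    by (rule summable_on_union)
  moreover have "range int \<union> range (\<lambda>n. - int n) = UNIV"
    by (auto simp: image_iff) (metis int_cases2)
  ultimately have "(\<lambda>k. norm (1 / (1 + (real_of_int k)\<^sup>2))) summable_on UNIV" by simp
  then show ?thesis
    using abs_summable_equivalent[of "\<lambda>k. 1 / (1 + (real_of_int k)\<^sup>2)" UNIV]
    by (simp add: Infinite_Set_Sum.abs_summable_on_def)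
qed

text \<open>The weight is a product, so Tonelli reduces the sum to the square of a one-dimensional
  one.\<close>

lemma integrable_inverse_weight:
  "integrable countZ2 (\<lambda>m. 1 / ((1 + (real_of_int (fst m))\<^sup>2) * (1 + (real_of_int (snd m))\<^sup>2)))"
proof (rule integrableI_bounded)
  let ?f = "\<lambda>k. ennreal (1 / (1 + (real_of_int k)\<^sup>2))"
  have fin: "(\<integral>\<^sup>+k. ?f k \<partial>count_space UNIV) < \<infinity>"
    using integrable_count_space_int by (subst nn_integral_eq_integral) auto
  have "(\<integral>\<^sup>+m. ennreal (norm (1 / ((1 + (real_of_int (fst m))\<^sup>2) * (1 + (real_of_int (snd m))\<^sup>2)))) \<partial>countZ2)
     = (\<integral>\<^sup>+m. (case m of (x, y) \<Rightarrow> ?f x * ?f y) \<partial>countZ2)"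
    by (intro nn_integral_cong) (auto simp: ennreal_mult[symmetric] split: prod.splits)
  also have "\<dots> = (\<integral>\<^sup>+x. (\<integral>\<^sup>+y. ?f x * ?f y \<partial>count_space UNIV) \<partial>count_space UNIV)"
    using nn_integral_fst_count_space[of "\<lambda>(x,y). ?f x * ?f y"] by simp
  also have "\<dots> = (\<integral>\<^sup>+k. ?f k \<partial>count_space UNIV) * (\<integral>\<^sup>+k. ?f k \<partial>count_space UNIV)"
    by (simp add: nn_integral_cmult nn_integral_multc)
  also have "\<dots> < \<infinity>" using fin by (simp add: ennreal_mult_less_top)
  finally show "(\<integral>\<^sup>+m. ennreal (norm (1 / ((1 + (real_of_int (fst m))\<^sup>2) * (1 + (real_of_int (snd m))\<^sup>2)))) \<partial>countZ2) < \<infinity>" .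
qed auto

lemma one_plus_power_le_exp:
  fixes \<beta> :: real
  assumes "\<beta> > 0" shows "\<exists>D\<ge>0. \<forall>t\<ge>0. (1 + t) ^ r \<le> D * exp (\<beta> * t)"
proof (cases "r = 0")
  case True
  then show ?thesis using assms by (intro exI[of _ 1]) auto
next
  case False
  \<comment> \<open>Chosen so that the \<open>r\<close>-th power of
    \<open>exp (\<delta> * t)\<close> is \<open>exp (\<beta> * t)\<close>.\<close>
  define \<delta> where "\<delta> = \<beta> / r"
  have \<delta>: "\<delta> > 0" using assms False by (simp add: \<delta>_def)
  have "(1 + t) ^ r \<le> (1 + 1/\<delta>) ^ r * exp (\<beta> * t)" if "t \<ge> 0" for t
  proof -
    have 1: "1 \<le> exp (\<delta> * t)" using \<delta> that by simp
    have "\<delta> * t \<le> exp (\<delta> * t)" using exp_ge_add_one_self[of "\<delta> * t"] by linarith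
    then have "t \<le> (1/\<delta>) * exp (\<delta> * t)" using \<delta> by (simp add: field_simps)
    with 1 have "1 + t \<le> (1 + 1/\<delta>) * exp (\<delta> * t)" unfolding distrib_right by linarith
    then have "(1 + t) ^ r \<le> ((1 + 1/\<delta>) * exp (\<delta> * t)) ^ r" using that by (intro power_mono) auto
    also have "\<dots> = (1 + 1/\<delta>) ^ r * exp (\<beta> * t)"
      using False by (simp add: power_mult_distrib exp_of_nat_mult[symmetric] \<delta>_def)
    finally show ?thesis .
  qed
  then show ?thesis using \<delta> by (intro exI[of _ "(1 + 1/\<delta>) ^ r"]) auto
qed

lemma integrable_exp_norm1:
  assumes "\<beta> > 0" shows "integrable countZ2 (\<lambda>m. exp (- \<beta> * rnorm1 m) * (1 + rnorm1 m) ^ s)"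
proof -
  \<comment> \<open>Four extra powers pay for the summable product weight, each of whose two factors
    is at most \<open>(1 + rnorm1 m)\<^sup>2\<close>.\<close>
  obtain D where D: "D \<ge> 0" "\<And>t. t \<ge> 0 \<Longrightarrow> (1 + t) ^ (s + 4) \<le> D * exp (\<beta> * t)"
    using one_plus_power_le_exp[OF assms] by blast
  show ?thesis
  proof (rule Bochner_Integration.integrable_bound)
    show "integrable countZ2 (\<lambda>m. D * (1 / ((1 + (real_of_int (fst m))\<^sup>2) * (1 + (real_of_int (snd m))\<^sup>2))))"
      by (intro integrable_mult_right integrable_inverse_weight)
    have "exp (- \<beta> * rnorm1 m) * (1 + rnorm1 m) ^ s
       \<le> D * (1 / ((1 + (real_of_int (fst m))\<^sup>2) * (1 + (real_of_int (snd m))\<^sup>2)))" for m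
    proof -
      let ?t = "rnorm1 m"
      let ?W = "(1 + (real_of_int (fst m))\<^sup>2) * (1 + (real_of_int (snd m))\<^sup>2)"
      have a: "1 + x\<^sup>2 \<le> (1 + t)\<^sup>2" if "\<bar>x\<bar> \<le> t" for x t :: real
        using that power_mono[OF that, of 2] by (simp add: power2_sum)
      have "?W \<le> (1 + ?t)\<^sup>2 * (1 + ?t)\<^sup>2"
        by (intro mult_mono a) (auto simp: norm1_def)
      then have "?W \<le> (1 + ?t) ^ 4" by (simp add: power_add[symmetric])
      then have "(1 + ?t) ^ s * ?W \<le> (1 + ?t) ^ s * (1 + ?t) ^ 4"
        by (intro mult_left_mono) auto
      also have "\<dots> \<le> D * exp (\<beta> * ?t)" using D(2)[of ?t] by (simp add: power_add)
      finally have "exp (- \<beta> * ?t) * ((1 + ?t) ^ s * ?W) \<le> exp (- \<beta> * ?t) * (D * exp (\<beta> * ?t))"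
        by (intro mult_left_mono) auto
      also have "\<dots> = D" by (simp add: exp_minus field_simps)
      finally have *: "exp (- \<beta> * ?t) * (1 + ?t) ^ s * ?W \<le> D" by (simp add: mult.assoc)
      have "?W > 0" by (intro mult_pos_pos add_pos_nonneg) auto
      then show ?thesis using * by (simp add: pos_le_divide_eq)
    qed
    then show "AE m in countZ2. norm (exp (- \<beta> * rnorm1 m) * (1 + rnorm1 m) ^ s)
        \<le> norm (D * (1 / ((1 + (real_of_int (fst m))\<^sup>2) * (1 + (real_of_int (snd m))\<^sup>2))))"
      using D(1) by (auto simp: AE_count_space abs_mult)
  qed auto
qed

lemma nn_integral_translate: "(\<integral>\<^sup>+l. f (k - l) \<partial>countZ2) = (\<integral>\<^sup>+m. f m \<partial>countZ2)"
  "(\<integral>\<^sup>+l. f (l - k) \<partial>countZ2) = (\<integral>\<^sup>+m. f m \<partial>countZ2)"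
proof -
  have "bij (\<lambda>l. k - l)" "bij (\<lambda>l. l - k)"
    by (rule bij_betwI[where g = "\<lambda>l. k - l"]; simp) (rule bij_betwI[where g = "\<lambda>l. l + k"]; simp)
  then show "(\<integral>\<^sup>+l. f (k - l) \<partial>countZ2) = (\<integral>\<^sup>+m. f m \<partial>countZ2)"
     "(\<integral>\<^sup>+l. f (l - k) \<partial>countZ2) = (\<integral>\<^sup>+m. f m \<partial>countZ2)"
    by (auto intro!: nn_integral_bij_count_space)
qed

text \<open>An integral over the counting measure, so that dominated convergence, Fubini and the
  Schur test apply to matrices directly. A row that is not summable against \<open>x\<close> yields
  0.\<close>

definition mat_apply :: "(int \<times> int \<Rightarrow> int \<times> int \<Rightarrow> complex) \<Rightarrow> (int \<times> int \<Rightarrow> complex) \<Rightarrow> int \<times> int \<Rightarrow> complex" where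
  "mat_apply A x k = (\<integral>l. A k l * x l \<partial>countZ2)"

text \<open>All row and column sums of a majorant that depends on \<open>k - l\<close> alone equal
  the sum of \<open>a\<close>, so both Schur constants coincide.\<close>

lemma mat_apply_Schur:
  assumes a: "integrable countZ2 a" and B: "\<And>k l. cmod (B k l) \<le> a (k - l)" and x: "sqint countZ2 x"
  shows "sqint countZ2 (mat_apply B x)" "sqnorm countZ2 (mat_apply B x) \<le> (\<integral>m. a m \<partial>countZ2)\<^sup>2 * sqnorm countZ2 x"
    "integrable countZ2 (\<lambda>l. B k l * x l)"
proof -
  have a0: "a m \<ge> 0" for m
    using order_trans[OF norm_ge_zero B[of m 0]] by simp
  have s: "sigma_finite_measure countZ2" by (rule sigma_finite_measure_count_space)
  have m: "case_prod B \<in> borel_measurable (countZ2 \<Otimes>\<^sub>M countZ2)"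
    by (simp add: pair_measure_countable)
  have I: "(\<integral>\<^sup>+m. ennreal (a m) \<partial>countZ2) = ennreal (\<integral>m. a m \<partial>countZ2)"
    using a a0 by (simp add: nn_integral_eq_integral)
  have 1: "(\<integral>\<^sup>+e. ennreal (cmod (B t e)) \<partial>countZ2) \<le> ennreal (\<integral>m. a m \<partial>countZ2)" for t
  proof -
    have "(\<integral>\<^sup>+e. ennreal (cmod (B t e)) \<partial>countZ2) \<le> (\<integral>\<^sup>+e. ennreal (a (t - e)) \<partial>countZ2)"
      by (intro nn_integral_mono ennreal_leI B)
    then show ?thesis using nn_integral_translate(1)[of "\<lambda>m. ennreal (a m)" t] I by simp
  qed
  have 2: "(\<integral>\<^sup>+t. ennreal (cmod (B t e)) \<partial>countZ2) \<le> ennreal (\<integral>m. a m \<partial>countZ2)" for e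
  proof -
    have "(\<integral>\<^sup>+t. ennreal (cmod (B t e)) \<partial>countZ2) \<le> (\<integral>\<^sup>+t. ennreal (a (t - e)) \<partial>countZ2)"
      by (intro nn_integral_mono ennreal_leI B)
    then show ?thesis using nn_integral_translate(2)[of "\<lambda>m. ennreal (a m)" e] I by simp
  qed
  note S = Schur_test[OF s s m 1 _ 2 _ x]
  have i0: "(\<integral>m. a m \<partial>countZ2) \<ge> 0" using a0 by simp
  show "sqint countZ2 (mat_apply B x)" "sqnorm countZ2 (mat_apply B x) \<le> (\<integral>m. a m \<partial>countZ2)\<^sup>2 * sqnorm countZ2 x"
    using S(1,2) i0 by (simp_all add: mat_apply_def[abs_def] power2_eq_square)
  show "integrable countZ2 (\<lambda>l. B k l * x l)"
    using S(3)[OF i0 i0] unfolding AE_count_space by blast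
qed

text \<open>Conjugation by the weight turns \<open>B\<close> into the matrix with entries
  \<open>w k / w l * B k l\<close>. Moderateness bounds the quotient by a power of
  \<open>1 + rnorm1 (k - l)\<close>, which goes into the majorant. The weight is kept general
  because the truncated Sobolev weights are needed as well.\<close>

lemma mat_apply_weighted_Schur:
  fixes w :: "int \<times> int \<Rightarrow> real"
  assumes a: "integrable countZ2 (\<lambda>m. D * a m * (1 + rnorm1 m) ^ s)"
    and B: "\<And>k l. cmod (B k l) \<le> a (k - l)"
    and w: "\<And>k. w k > 0" "\<And>k l. w k \<le> D * (1 + rnorm1 (k - l)) ^ s * w l" and x: "sqint countZ2 (\<lambda>k. of_real (w k) * x k)"
  shows "sqint countZ2 (\<lambda>k. of_real (w k) * mat_apply B x k)"
    "sqnorm countZ2 (\<lambda>k. of_real (w k) * mat_apply B x k) \<le> (\<integral>m. D * a m * (1 + rnorm1 m) ^ s \<partial>countZ2)\<^sup>2 * sqnorm countZ2 (\<lambda>k. of_real (w k) * x k)"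
proof -
  define B' where "B' k l = of_real (w k / w l) * B k l" for k l
  have B': "cmod (B' k l) \<le> D * a (k - l) * (1 + rnorm1 (k - l)) ^ s" for k l
  proof -
    have "cmod (B' k l) = w k / w l * cmod (B k l)"
      using w(1)[of k] w(1)[of l] by (simp add: B'_def norm_mult norm_divide)
    also have "\<dots> \<le> (D * (1 + rnorm1 (k - l)) ^ s) * a (k - l)"
    proof (intro mult_mono B)
      show "w k / w l \<le> D * (1 + rnorm1 (k - l)) ^ s"
        using w(2)[of k l] w(1)[of l] by (simp add: divide_le_eq)
      then show "0 \<le> D * (1 + rnorm1 (k - l)) ^ s"
        using w(1)[of k] w(1)[of l] by (smt (verit) divide_pos_pos)
    qed auto
    finally show ?thesis by (simp add: mult_ac)
  qed
  have eq: "(\<lambda>k. of_real (w k) * mat_apply B x k) = mat_apply B' (\<lambda>k. of_real (w k) * x k)"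
  proof
    fix k
    have "of_real (w k) * mat_apply B x k = (\<integral>l. of_real (w k) * (B k l * x l) \<partial>countZ2)"
      by (simp add: mat_apply_def)
    also have "\<dots> = mat_apply B' (\<lambda>k. of_real (w k) * x k) k"
      unfolding mat_apply_def B'_def using w(1) by (intro Bochner_Integration.integral_cong) (auto simp: field_simps less_le)
    finally show "of_real (w k) * mat_apply B x k = mat_apply B' (\<lambda>k. of_real (w k) * x k) k" .
  qed
  show "sqint countZ2 (\<lambda>k. of_real (w k) * mat_apply B x k)"
    "sqnorm countZ2 (\<lambda>k. of_real (w k) * mat_apply B x k) \<le> (\<integral>m. D * a m * (1 + rnorm1 m) ^ s \<partial>countZ2)\<^sup>2 * sqnorm countZ2 (\<lambda>k. of_real (w k) * x k)"
    unfolding eq using mat_apply_Schur[OF a B' x] by auto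
qed

text \<open>Here \<open>b m l\<close> is the size of the entry at position \<open>l\<close> of
  diagonal \<open>m\<close>. The exponential bound disposes of all but finitely many diagonals; on
  each remaining one only finitely many entries exceed a given threshold, and \<open>L\<close>
  collects their positions. Columns and rows of a matrix are both instances.\<close>

lemma dominated_diagonals_small:
  assumes b: "\<And>m l. b m l \<le> C * exp (- \<beta> * rnorm1 m)" and \<beta>: "\<beta> > 0" and C: "C \<ge> 0"
    and fin: "\<And>m e. e > 0 \<Longrightarrow> finite {l. b m l > (e::real)}" and e: "e > 0"
  obtains L d where "finite L" "\<And>m. 0 \<le> d m" "integrable countZ2 (\<lambda>m. d m * (1 + rnorm1 m) ^ s)"
    "(\<integral>m. d m * (1 + rnorm1 m) ^ s \<partial>countZ2) \<le> e" "\<And>m l. l \<notin> L \<Longrightarrow> b m l \<le> d m"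
proof -
  let ?p = "\<lambda>m. (1 + rnorm1 m) ^ s"
  have p1: "?p m \<ge> 1" for m by (rule one_le_power) simp
  have ne: "1 + rnorm1 m \<noteq> 0" for m using norm1_nonneg[of m] by linarith
  have pp: "?p m > 0" for m using p1[of m] by linarith
  define h where "h m = C * exp (- \<beta> * rnorm1 m) * ?p m" for m
  have h: "integrable countZ2 h"
    using integrable_mult_right[OF integrable_exp_norm1[OF \<beta>, of s], of C] by (simp add: h_def[abs_def] mult.assoc)
  have "(\<lambda>n. \<integral>m. indicator (- idx n) m * h m \<partial>countZ2) \<longlonglongrightarrow> (\<integral>m. 0 \<partial>countZ2)"
  proof (rule integral_dominated_convergence[where w = h])
    show "AE m in countZ2. (\<lambda>n. indicator (- idx n) m * h m) \<longlonglongrightarrow> 0"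
    proof (rule AE_I2)
      fix m
      have "\<forall>\<^sub>F n in sequentially. indicator (- idx n) m * h m = 0"
        using eventually_ge_at_top[of "nat (norm1 m)"]
      proof eventually_elim
        case (elim n)
        then have "m \<in> idx n" using in_idx_norm1[of m] idx_mono by blast
        then show ?case by simp
      qed
      then show "(\<lambda>n. indicator (- idx n) m * h m) \<longlonglongrightarrow> 0" by (simp add: tendsto_eventually)
    qed
    show "AE m in countZ2. norm (indicator (- idx n) m * h m) \<le> h m" for n
      using C by (auto simp: h_def indicator_def)
  qed (use h in auto)
  then have "\<forall>\<^sub>F n in sequentially. (\<integral>m. indicator (- idx n) m * h m \<partial>countZ2) < e/2"
    using e by (intro order_tendstoD(2)[where y = 0]) auto
  then obtain n where n: "(\<integral>m. indicator (- idx n) m * h m \<partial>countZ2) < e/2"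
    by (auto simp: eventually_sequentially)
  \<comment> \<open>Each diagonal in \<open>idx n\<close> receives the share \<open>e'\<close> of
    the weighted sum, so that together they use at most \<open>e / 2\<close>.\<close>
  define e' where "e' = e / (2 * (card (idx n) + 1))"
  have e': "e' > 0" using e by (simp add: e'_def)
  define d where "d m = (if m \<in> idx n then e' / ?p m else C * exp (- \<beta> * rnorm1 m))" for m
  define L where "L = (\<Union>m\<in>idx n. {l. b m l > e' / ?p m})"
  have deq: "d m * ?p m = indicator (idx n) m * e' + indicator (- idx n) m * h m" for m
    using ne[of m] by (auto simp: d_def h_def indicator_def)
  have i1: "integrable countZ2 (\<lambda>m. indicator (idx n) m * e')"
    by (intro integrable_mult_left) (simp add: integrable_indicator_iff of_nat_less_top)
  have i2: "integrable countZ2 (\<lambda>m. indicator (- idx n) m * h m)"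
    by (rule Bochner_Integration.integrable_bound[OF h]) (auto simp: indicator_def)
  show ?thesis
  proof
    show "finite L" unfolding L_def by (intro finite_UN_I fin divide_pos_pos e' pp finite_idx)
    show "0 \<le> d m" for m using p1[of m] e' C by (simp add: d_def)
    show "integrable countZ2 (\<lambda>m. d m * ?p m)" unfolding deq using i1 i2 by simp
    have "(\<integral>m. indicator (idx n) m * e' \<partial>countZ2) = card (idx n) * e'"
      by (simp add: measure_count_space)
    also have "\<dots> \<le> e/2" unfolding e'_def using e by (simp add: field_simps)
    finally show "(\<integral>m. d m * ?p m \<partial>countZ2) \<le> e" unfolding deq using i1 i2 n by simp
    show "b m l \<le> d m" if "l \<notin> L" for m l
      using that b[of m l] by (auto simp: L_def d_def not_less)
  qed
qed

section \<open>Square-summable sequences, coordinate projections and Sobolev weights\<close>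

lemma sqint_CZ_iff: "sqint countZ2 x \<longleftrightarrow> (\<lambda>k. (cmod (x k))\<^sup>2) summable_on UNIV"
  using abs_summable_equivalent[of "\<lambda>k. (cmod (x k))\<^sup>2" UNIV]
  by (simp add: Infinite_Set_Sum.abs_summable_on_def sqint_def)

lemma sqnorm_CZ: "sqint countZ2 x \<Longrightarrow> sqnorm countZ2 x = (\<Sum>\<^sub>\<infinity>k. (cmod (x k))\<^sup>2)"
  using infsetsum_infsum[of "\<lambda>k. (cmod (x k))\<^sup>2" UNIV]
  by (simp add: Infinite_Set_Sum.abs_summable_on_def sqint_def sqnorm_def infsetsum_def)

lemma sum_le_sqnorm_CZ: "sqint countZ2 x \<Longrightarrow> finite F \<Longrightarrow> (\<Sum>k\<in>F. (cmod (x k))\<^sup>2) \<le> sqnorm countZ2 x"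
  using sqint_CZ_iff[of x] by (auto simp: sqnorm_CZ intro!: finite_sum_le_infsum)

text \<open>Uniform bounds on finite partial sums are the form in which norm bounds survive
  coordinatewise limits and the removal of a weight truncation.\<close>

lemma sqint_CZ_bounded_sums:
  assumes "\<And>F. finite F \<Longrightarrow> (\<Sum>k\<in>F. (cmod (x k))\<^sup>2) \<le> c"
  shows "sqint countZ2 x" "sqnorm countZ2 x \<le> c"
proof -
  show 1: "sqint countZ2 x"
    unfolding sqint_CZ_iff
    by (rule nonneg_bdd_above_summable_on) (use assms in \<open>auto intro!: bdd_aboveI2[where M = c]\<close>)
  then show "sqnorm countZ2 x \<le> c"
    using assms sqint_CZ_iff[of x] by (auto simp: sqnorm_CZ intro!: infsum_le_finite_sums)
qed

lemma cmod_le_sqnorm_CZ: "sqint countZ2 x \<Longrightarrow> (cmod (x k))\<^sup>2 \<le> sqnorm countZ2 x"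
  using sum_le_sqnorm_CZ[of x "{k}"] by simp

text \<open>On Fourier coefficients, \<open>restrict0 (idx n)\<close> is the projection
  \<open>Pn n\<close>.\<close>

definition restrict0 :: "'a set \<Rightarrow> ('a \<Rightarrow> complex) \<Rightarrow> 'a \<Rightarrow> complex" where
  "restrict0 L x k = (if k \<in> L then x k else 0)"

lemma sqint_restrict0: "sqint countZ2 x \<Longrightarrow> sqint countZ2 (restrict0 L x)" "sqint countZ2 x \<Longrightarrow> sqnorm countZ2 (restrict0 L x) \<le> sqnorm countZ2 x"
  using sqint_bound[of countZ2 x "restrict0 L x" 1] by (auto simp: restrict0_def)

lemma restrict0_finite:
  assumes L: "finite L"
  shows "sqint countZ2 (restrict0 L x)" "sqnorm countZ2 (restrict0 L x) = (\<Sum>k\<in>L. (cmod (x k))\<^sup>2)"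
proof -
  have le: "(\<Sum>k\<in>F. (cmod (restrict0 L x k))\<^sup>2) \<le> (\<Sum>k\<in>L. (cmod (x k))\<^sup>2)" if "finite F" for F
  proof -
    have "(\<Sum>k\<in>F. (cmod (restrict0 L x k))\<^sup>2) = (\<Sum>k\<in>F \<inter> L. (cmod (x k))\<^sup>2)"
      using that by (intro sum.mono_neutral_cong_right) (auto simp: restrict0_def)
    also have "\<dots> \<le> (\<Sum>k\<in>L. (cmod (x k))\<^sup>2)" using L by (intro sum_mono2) auto
    finally show ?thesis .
  qed
  show 1: "sqint countZ2 (restrict0 L x)" by (rule sqint_CZ_bounded_sums[OF le])
  have "sqnorm countZ2 (restrict0 L x) \<le> (\<Sum>k\<in>L. (cmod (x k))\<^sup>2)" by (rule sqint_CZ_bounded_sums[OF le])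
  moreover have "(\<Sum>k\<in>L. (cmod (x k))\<^sup>2) \<le> sqnorm countZ2 (restrict0 L x)"
    using sum_le_sqnorm_CZ[OF 1 L] by (simp add: restrict0_def)
  ultimately show "sqnorm countZ2 (restrict0 L x) = (\<Sum>k\<in>L. (cmod (x k))\<^sup>2)" by simp
qed

text \<open>The root is taken so that \<open>Hpnorm p\<close> becomes the plain norm of the weighted
  coefficient sequence.\<close>

definition weight :: "nat \<Rightarrow> int \<times> int \<Rightarrow> real" where
  "weight p k = sqrt ((1 + (of_int (fst k))\<^sup>2 + (of_int (snd k))\<^sup>2) ^ p)"

lemma weight_ge_1: "weight p k \<ge> 1"
  unfolding weight_def by (subst real_sqrt_ge_1_iff) (auto intro!: one_le_power)

text \<open>Peetre's inequality: \<open>1 + |k|^2\<close> is at most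
  \<open>2 * (1 + |k - l|)^2 * (1 + |l|^2)\<close>. Its \<open>p\<close>-th power, under the root,
  is the claim.\<close>

lemma weight_moderate: "weight p k \<le> sqrt (2 ^ p) * (1 + rnorm1 (k - l)) ^ p * weight p l"
proof -
  define W where "W k = 1 + (real_of_int (fst k))\<^sup>2 + (real_of_int (snd k))\<^sup>2" for k :: "int \<times> int"
  have ineq: "1 + x\<^sup>2 + y\<^sup>2 \<le> 2 * (1 + n)\<^sup>2 * (1 + u\<^sup>2 + v\<^sup>2)"
    if "n = \<bar>x - u\<bar> + \<bar>y - v\<bar>" for x y u v n :: real
  proof -
    have "(x - u - u)\<^sup>2 \<ge> 0" "(y - v - v)\<^sup>2 \<ge> 0" by auto
    then have "x\<^sup>2 \<le> 2 * (x - u)\<^sup>2 + 2 * u\<^sup>2" "y\<^sup>2 \<le> 2 * (y - v)\<^sup>2 + 2 * v\<^sup>2"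
      by (auto simp: power2_eq_square algebra_simps)
    moreover have "(x - u)\<^sup>2 + (y - v)\<^sup>2 \<le> n\<^sup>2"
      unfolding that power2_sum by (simp add: power2_abs)
    ultimately have "1 + x\<^sup>2 + y\<^sup>2 \<le> 2 * (1 + n\<^sup>2) + 2 * (u\<^sup>2 + v\<^sup>2)" by simp
    also have "\<dots> \<le> 2 * (1 + n\<^sup>2) * (1 + u\<^sup>2 + v\<^sup>2)"
    proof -
      have "0 \<le> n\<^sup>2 * (u\<^sup>2 + v\<^sup>2)" by (intro mult_nonneg_nonneg) auto
      then show ?thesis by (simp add: algebra_simps)
    qed
    also have "\<dots> \<le> 2 * (1 + n)\<^sup>2 * (1 + u\<^sup>2 + v\<^sup>2)"
      using that by (intro mult_right_mono mult_left_mono) (auto simp: power2_sum)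
    finally show ?thesis .
  qed
  have "W k \<le> 2 * (1 + rnorm1 (k - l))\<^sup>2 * W l"
    unfolding W_def by (rule ineq) (simp add: norm1_def)
  then have "W k ^ p \<le> (2 * (1 + rnorm1 (k - l))\<^sup>2 * W l) ^ p"
    by (rule power_mono) (simp add: W_def)
  then have "sqrt (W k ^ p) \<le> sqrt (2 ^ p * ((1 + rnorm1 (k - l)) ^ p)\<^sup>2 * W l ^ p)"
    by (simp add: power_mult_distrib power_mult[symmetric] mult.commute)
  also have "\<dots> = sqrt (2 ^ p) * (1 + rnorm1 (k - l)) ^ p * sqrt (W l ^ p)"
    by (simp add: real_sqrt_mult)
  finally show ?thesis by (simp add: weight_def W_def)
qed

section \<open>Regularity and invertibility of \<open>I - A\<close> for matrices with decay\<close>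

lemma mat_apply_cmult: "mat_apply A (\<lambda>k. c * x k) k = c * mat_apply A x k"
proof -
  have "mat_apply A (\<lambda>k. c * x k) k = (\<integral>l. c * (A k l * x l) \<partial>countZ2)"
    unfolding mat_apply_def by (simp add: mult_ac)
  then show ?thesis by (simp add: mat_apply_def)
qed

text \<open>The assumption \<open>diagonals\<close> says that every diagonal tends to zero. Together
  with \<open>decay\<close> it makes the matrix a norm limit of matrices with finitely many nonzero
  columns, the form of compactness used below.\<close>

locale decay_matrix =
  fixes A :: "int \<times> int \<Rightarrow> int \<times> int \<Rightarrow> complex" and C \<beta> :: real
  assumes C_nonneg: "C \<ge> 0" and beta_pos: "\<beta> > 0"
    and decay: "\<And>k l. cmod (A k l) \<le> C * exp (- \<beta> * rnorm1 (k - l))"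
    and diagonals: "\<And>m e. e > 0 \<Longrightarrow> finite {l. cmod (A (l + m) l) > e}"
begin

lemma majorant_integrable: "integrable countZ2 (\<lambda>m. D * (C * exp (- \<beta> * rnorm1 m)) * (1 + rnorm1 m) ^ s)"
  using integrable_mult_right[OF integrable_exp_norm1[OF beta_pos, of s], of "D * C"] by (simp add: mult_ac)

lemma majorant_integrable0: "integrable countZ2 (\<lambda>m. C * exp (- \<beta> * rnorm1 m))"
  using majorant_integrable[of 1 0] by simp

definition majorant_sum :: real where "majorant_sum = (\<integral>m. C * exp (- \<beta> * rnorm1 m) \<partial>countZ2)"

lemmas mat_apply_sqint = mat_apply_Schur[OF majorant_integrable0 decay, folded majorant_sum_def]

text \<open>The factor \<open>D\<close> and the power \<open>s\<close> let one splitting serve the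
  unweighted norm, with \<open>D = 1\<close> and \<open>s = 0\<close>, and the Sobolev norms, with
  the moderateness constants of the weight.\<close>

lemma columns_outside_finite_small:
  assumes "e > 0" "D > 0"
  obtains L d where "finite L" "\<And>m. 0 \<le> d m" "integrable countZ2 (\<lambda>m. D * d m * (1 + rnorm1 m) ^ s)"
    "(\<integral>m. D * d m * (1 + rnorm1 m) ^ s \<partial>countZ2) \<le> e"
    "\<And>k l. cmod (if l \<in> L then 0 else A k l) \<le> d (k - l)"
proof -
  have b: "cmod (A (l + m) l) \<le> C * exp (- \<beta> * rnorm1 m)" for m l
    using decay[of "l + m" l] by simp
  obtain L d where L: "finite L" "\<And>m. 0 \<le> d m" "integrable countZ2 (\<lambda>m. d m * (1 + rnorm1 m) ^ s)"
    "(\<integral>m. d m * (1 + rnorm1 m) ^ s \<partial>countZ2) \<le> e / D" "\<And>m l. l \<notin> L \<Longrightarrow> cmod (A (l + m) l) \<le> d m"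
    using dominated_diagonals_small[of "\<lambda>m l. cmod (A (l + m) l)" C \<beta> "e / D" s, OF b beta_pos C_nonneg diagonals] assms
    by auto
  show ?thesis
  proof
    show "integrable countZ2 (\<lambda>m. D * d m * (1 + rnorm1 m) ^ s)"
      using integrable_mult_right[OF L(3), of D] by (simp add: mult.assoc)
    show "(\<integral>m. D * d m * (1 + rnorm1 m) ^ s \<partial>countZ2) \<le> e"
      using L(4) assms by (simp add: mult.assoc field_simps)
    show "cmod (if l \<in> L then 0 else A k l) \<le> d (k - l)" for k l
      using L(2)[of "k - l"] L(5)[of l "k - l"] by (auto simp del: fst_diff snd_diff)
  qed (use L in auto)
qed

lemma mat_apply_split_columns:
  assumes x: "sqint countZ2 x"
  shows "mat_apply A x k = mat_apply A (restrict0 L x) k + mat_apply (\<lambda>k l. if l \<in> L then 0 else A k l) x k"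
proof -
  have B: "cmod (if l \<in> L then 0 else A k l) \<le> C * exp (- \<beta> * rnorm1 (k - l))" for k l
    using decay[of k l] C_nonneg by auto
  have "mat_apply A (restrict0 L x) k + mat_apply (\<lambda>k l. if l \<in> L then 0 else A k l) x k
     = (\<integral>l. A k l * restrict0 L x l + (if l \<in> L then 0 else A k l) * x l \<partial>countZ2)"
    unfolding mat_apply_def
    by (intro Bochner_Integration.integral_add[symmetric] mat_apply_sqint(3) sqint_restrict0 x mat_apply_Schur(3)[OF majorant_integrable0 B])
  also have "\<dots> = mat_apply A x k"
    unfolding mat_apply_def by (intro Bochner_Integration.integral_cong) (auto simp: restrict0_def)
  finally show ?thesis by simp
qed

text \<open>Truncating the weight makes all norms finite beforehand; the bound obtained is uniform in the
  truncation because moderateness survives it.\<close>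

lemma regularity:
  assumes x: "sqint countZ2 x" and f: "sqint countZ2 (\<lambda>k. of_real (weight p k) * (x k - mat_apply A x k))"
  shows "sqint countZ2 (\<lambda>k. of_real (weight p k) * x k)"
proof -
  define D where "D = sqrt (2 ^ p :: real)"
  have D1: "D \<ge> 1" by (simp add: D_def)
  obtain L d where L: "finite L" "\<And>m. 0 \<le> d m" "integrable countZ2 (\<lambda>m. D * d m * (1 + rnorm1 m) ^ p)"
    "(\<integral>m. D * d m * (1 + rnorm1 m) ^ p \<partial>countZ2) \<le> 1/2"
    "\<And>k l. cmod (if l \<in> L then 0 else A k l) \<le> d (k - l)"
    using columns_outside_finite_small[of "1/2" D p] D1 by auto
  let ?B = "\<lambda>k l. if l \<in> L then 0 else A k l"
  define g where "g k = (x k - mat_apply A x k) + mat_apply A (restrict0 L x) k" for k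
  have wpos: "weight p k > 0" for k using weight_ge_1[of p k] by linarith
  \<comment> \<open>\<open>restrict0 L x\<close> has finite support and therefore a finite weighted
    norm; the weighted Schur bound shows that \<open>A\<close> preserves this.\<close>
  have "(\<lambda>k. of_real (weight p k) * restrict0 L x k) = restrict0 L (\<lambda>k. of_real (weight p k) * x k)"
    by (auto simp: restrict0_def)
  then have "sqint countZ2 (\<lambda>k. of_real (weight p k) * mat_apply A (restrict0 L x) k)"
    using L(1) by (intro mat_apply_weighted_Schur(1)[OF majorant_integrable[of D p] decay wpos
          weight_moderate[of p, folded D_def]]) (simp add: restrict0_finite)
  from sqint_add(1)[OF f this] have g: "sqint countZ2 (\<lambda>k. of_real (weight p k) * g k)"
    by (simp add: g_def distrib_left)
  \<comment> \<open>A fixed-point equation for \<open>x\<close>: the data \<open>g\<close> lie in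
    the weighted space, and the matrix \<open>?B\<close> has weighted norm at most
    \<open>1/2\<close>.\<close>
  have xg: "x k = g k + mat_apply ?B x k" for k
    using mat_apply_split_columns[OF x, of k L] by (simp add: g_def)
  let ?c = "4 * sqnorm countZ2 (\<lambda>k. of_real (weight p k) * g k)"
  have R: "sqint countZ2 (\<lambda>k. of_real (min (weight p k) R) * x k) \<and> sqnorm countZ2 (\<lambda>k. of_real (min (weight p k) R) * x k) \<le> ?c" if R: "R \<ge> 1" for R
  proof -
    let ?w = "\<lambda>k. min (weight p k) R"
    have w: "?w k > 0" for k using R wpos by simp
    have mod: "?w k \<le> D * (1 + rnorm1 (k - l)) ^ p * ?w l" for k l
    proof -
      have "1 \<le> D * (1 + rnorm1 (k - l)) ^ p"
        using mult_mono[OF D1 one_le_power[of "1 + rnorm1 (k - l)" p]] D1 by simp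
      then have "R \<le> D * (1 + rnorm1 (k - l)) ^ p * R" using R by simp
      then show ?thesis using weight_moderate[of p k l, folded D_def] by (auto simp: min_def)
    qed
    have wx: "sqint countZ2 (\<lambda>k. of_real (?w k) * x k)"
    proof (rule sqint_bound(1)[OF x])
      show "cmod (of_real (?w k) * x k) \<le> R * cmod (x k)" for k
        using w[of k] by (simp only: norm_mult norm_of_real) (intro mult_right_mono, auto)
    qed simp
    have wg: "sqint countZ2 (\<lambda>k. of_real (?w k) * g k)" "sqnorm countZ2 (\<lambda>k. of_real (?w k) * g k) \<le> sqnorm countZ2 (\<lambda>k. of_real (weight p k) * g k)"
    proof -
      have "cmod (of_real (?w k) * g k) \<le> 1 * cmod (of_real (weight p k) * g k)" for k
        using w[of k] wpos[of k] by (simp only: mult_1 norm_mult norm_of_real) (intro mult_right_mono, auto)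
      from sqint_bound[OF g _ this] show "sqint countZ2 (\<lambda>k. of_real (?w k) * g k)"
        "sqnorm countZ2 (\<lambda>k. of_real (?w k) * g k) \<le> sqnorm countZ2 (\<lambda>k. of_real (weight p k) * g k)" by auto
    qed
    note wB = mat_apply_weighted_Schur[OF L(3) L(5) w mod wx]
    \<comment> \<open>The squared norm of the second term will be at most a quarter of the left
      side, so half of the left side can be absorbed; this explains the 4 in \<open>?c\<close>. The
      subtraction is legitimate because \<open>wx\<close> makes the left side a genuine finite
      norm.\<close>
    have "sqnorm countZ2 (\<lambda>k. of_real (?w k) * x k) \<le> 2 * sqnorm countZ2 (\<lambda>k. of_real (?w k) * g k) + 2 * sqnorm countZ2 (\<lambda>k. of_real (?w k) * mat_apply ?B x k)"
    proof -
      have "(\<lambda>k. of_real (?w k) * x k) = (\<lambda>k. of_real (?w k) * g k + of_real (?w k) * mat_apply ?B x k)"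
        unfolding distrib_left[symmetric] xg[symmetric] ..
      then show ?thesis using sqint_add(2)[OF wg(1) wB(1)] by (simp only:)
    qed
    also have "sqnorm countZ2 (\<lambda>k. of_real (?w k) * mat_apply ?B x k) \<le> (1/2)\<^sup>2 * sqnorm countZ2 (\<lambda>k. of_real (?w k) * x k)"
      using L(4) L(2) D1 by (intro order_trans[OF wB(2)] mult_right_mono power_mono integral_nonneg) auto
    finally show ?thesis using wg(2) wx by (simp add: power2_eq_square)
  qed
  show ?thesis
  proof (rule sqint_CZ_bounded_sums(1))
    fix F :: "(int \<times> int) set" assume F: "finite F"
    \<comment> \<open>On a finite set a large enough truncation level leaves the weight
      unchanged.\<close>
    define R where "R = Max (insert 1 (weight p ` F))"
    have R1: "R \<ge> 1" and RF: "\<And>k. k \<in> F \<Longrightarrow> weight p k \<le> R" using F by (auto simp: R_def)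
    have "(\<Sum>k\<in>F. (cmod (of_real (weight p k) * x k))\<^sup>2) = (\<Sum>k\<in>F. (cmod (of_real (min (weight p k) R) * x k))\<^sup>2)"
      using RF by (intro sum.cong) (auto simp: min_def)
    also have "\<dots> \<le> ?c"
      using R[OF R1] by (intro order_trans[OF sum_le_sqnorm_CZ]) (auto simp: F)
    finally show "(\<Sum>k\<in>F. (cmod (of_real (weight p k) * x k))\<^sup>2) \<le> ?c" .
  qed
qed

text \<open>The absorption argument in the unweighted norm. Apart from the residual only finitely
  many coordinates remain on the right, which is how compactness enters
  \<open>bounded_below\<close>.\<close>

lemma a_priori_bound:
  "\<exists>L. finite L \<and> (\<forall>x. sqint countZ2 x \<longrightarrow> sqnorm countZ2 x \<le> 8 * sqnorm countZ2 (\<lambda>k. x k - mat_apply A x k) + 8 * majorant_sum\<^sup>2 * (\<Sum>k\<in>L. (cmod (x k))\<^sup>2))"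
proof -
  obtain L d where L: "finite L" "\<And>m. 0 \<le> d m" "integrable countZ2 d"
    "(\<integral>m. d m \<partial>countZ2) \<le> 1/2" "\<And>k l. cmod (if l \<in> L then 0 else A k l) \<le> d (k - l)"
    using columns_outside_finite_small[of "1/2" 1 0] by auto
  have "sqnorm countZ2 x \<le> 8 * sqnorm countZ2 (\<lambda>k. x k - mat_apply A x k) + 8 * majorant_sum\<^sup>2 * (\<Sum>k\<in>L. (cmod (x k))\<^sup>2)"
    if x: "sqint countZ2 x" for x
  proof -
    let ?B = "\<lambda>k l. if l \<in> L then 0 else A k l"
    let ?f = "\<lambda>k. x k - mat_apply A x k"
    let ?g = "\<lambda>k. ?f k + mat_apply A (restrict0 L x) k"
    have f: "sqint countZ2 ?f" by (intro sqint_diff x mat_apply_sqint)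
    note rL = restrict0_finite[OF L(1), of x]
    note Ar = mat_apply_sqint[OF rL(1)]
    note B = mat_apply_Schur[OF L(3) L(5) x]
    have "x = (\<lambda>k. ?g k + mat_apply ?B x k)"
      using mat_apply_split_columns[OF x, of _ L] by auto
    then have "sqnorm countZ2 x \<le> 2 * sqnorm countZ2 ?g + 2 * sqnorm countZ2 (mat_apply ?B x)"
      using sqint_add(2)[OF sqint_add(1)[OF f Ar(1)] B(1)] by simp
    also have "sqnorm countZ2 ?g \<le> 2 * sqnorm countZ2 ?f + 2 * (majorant_sum\<^sup>2 * (\<Sum>k\<in>L. (cmod (x k))\<^sup>2))"
      using sqint_add(2)[OF f Ar(1)] Ar(2) rL(2) by simp
    also have "sqnorm countZ2 (mat_apply ?B x) \<le> (1/2)\<^sup>2 * sqnorm countZ2 x"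
      using L(4) L(2) by (intro order_trans[OF B(2)] mult_right_mono power_mono integral_nonneg) auto
    finally show ?thesis by (simp add: power2_eq_square)
  qed
  then show ?thesis using L(1) by blast
qed

text \<open>Coordinatewise convergence of bounded sequences is enough, because a single row is
  dominated by a translate of the summable majorant.\<close>

lemma mat_apply_tendsto:
  assumes "\<And>n k. cmod (x n k) \<le> 1" "\<And>k. (\<lambda>n. x n k) \<longlonglongrightarrow> y k"
  shows "(\<lambda>n. mat_apply A (x n) k) \<longlonglongrightarrow> mat_apply A y k"
  unfolding mat_apply_def
proof (rule integral_dominated_convergence[where w = "\<lambda>l. C * exp (- \<beta> * rnorm1 (k - l))"])
  have "(\<integral>\<^sup>+l. ennreal (norm (C * exp (- \<beta> * rnorm1 (k - l)))) \<partial>countZ2) < \<infinity>"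
    unfolding nn_integral_translate(1)[of "\<lambda>m. ennreal (norm (C * exp (- \<beta> * rnorm1 m)))" k]
    using majorant_integrable0 unfolding integrable_iff_bounded by blast
  then show "integrable countZ2 (\<lambda>l. C * exp (- \<beta> * rnorm1 (k - l)))"
    by (intro integrableI_bounded) auto
  show "AE l in countZ2. norm (A k l * x n l) \<le> C * exp (- \<beta> * rnorm1 (k - l))" for n
  proof (rule AE_I2)
    fix l
    have "cmod (A k l) * cmod (x n l) \<le> (C * exp (- \<beta> * rnorm1 (k - l))) * 1"
      using C_nonneg by (intro mult_mono decay assms) auto
    then show "norm (A k l * x n l) \<le> C * exp (- \<beta> * rnorm1 (k - l))"
      by (simp add: norm_mult)
  qed
qed (auto intro!: AE_I2 tendsto_intros assms)

text \<open>Otherwise there are unit vectors \<open>y n\<close> whose residuals tend to 0. A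
  subsequence converges in every coordinate to some \<open>z\<close> with \<open>z = A z\<close>, so
  \<open>z = 0\<close> by injectivity. Norms may drop in such a limit, but
  \<open>a_priori_bound\<close> forces the finitely many coordinates in \<open>L\<close> to keep a
  positive share, a contradiction.\<close>

lemma bounded_below:
  assumes inj: "\<And>x. sqint countZ2 x \<Longrightarrow> \<forall>k. x k = mat_apply A x k \<Longrightarrow> \<forall>k. x k = 0"
  shows "\<exists>c>0. \<forall>x. sqint countZ2 x \<longrightarrow> c * sqnorm countZ2 x \<le> sqnorm countZ2 (\<lambda>k. x k - mat_apply A x k)"
proof (rule ccontr)
  assume contr: "\<not> ?thesis"
  have "\<exists>y. sqint countZ2 y \<and> sqnorm countZ2 y = 1 \<and> sqnorm countZ2 (\<lambda>k. y k - mat_apply A y k) \<le> 1 / (1 + real n)" for n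
  proof -
    obtain x where x: "sqint countZ2 x" "sqnorm countZ2 (\<lambda>k. x k - mat_apply A x k) < 1 / (1 + real n) * sqnorm countZ2 x"
      using contr by (force simp: not_le dest: spec[of _ "1 / (1 + real n)"])
    have "sqnorm countZ2 x \<noteq> 0"
      using x(2) sqnorm_nonneg[of countZ2 "\<lambda>k. x k - mat_apply A x k"] by (metis mult_zero_right not_less)
    then have pos: "sqnorm countZ2 x > 0" using sqnorm_nonneg[of countZ2 x] by linarith
    define s where "s = complex_of_real (1 / sqrt (sqnorm countZ2 x))"
    have s: "(cmod s)\<^sup>2 = 1 / sqnorm countZ2 x" using pos by (simp add: s_def norm_divide power_divide)
    let ?y = "\<lambda>k. s * x k"
    have "(\<lambda>k. ?y k - mat_apply A ?y k) = (\<lambda>k. s * (x k - mat_apply A x k))"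
      by (simp add: mat_apply_cmult algebra_simps)
    then have "sqnorm countZ2 (\<lambda>k. ?y k - mat_apply A ?y k) = sqnorm countZ2 (\<lambda>k. x k - mat_apply A x k) / sqnorm countZ2 x"
      using sqint_cmult(2)[of countZ2 "\<lambda>k. x k - mat_apply A x k" s] sqint_diff(1)[OF x(1) mat_apply_sqint(1)[OF x(1)]] s by simp
    also have "\<dots> \<le> 1 / (1 + real n)" using x(2) pos by (simp add: field_simps)
    finally show ?thesis
      using sqint_cmult[OF x(1), of s] s pos by (intro exI[of _ ?y]) auto
  qed
  then obtain y where y: "\<And>n. sqint countZ2 (y n)" "\<And>n. sqnorm countZ2 (y n) = 1"
      "\<And>n. sqnorm countZ2 (\<lambda>k. y n k - mat_apply A (y n) k) \<le> 1 / (1 + real n)"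
    by metis
  have y1: "cmod (y n k) \<le> 1" for n k
    using cmod_le_sqnorm_CZ[OF y(1), of n k] y(2)[of n] by (simp add: power_le_one_iff abs_square_le_1)
  obtain r where r: "strict_mono r" "\<And>k. \<exists>l. (\<lambda>n. y (r n) k) \<longlonglongrightarrow> l"
    using function_convergent_subsequence[of "UNIV::(int\<times>int) set" y 1] y1 by (metis UNIV_I countableI_type)
  then obtain z where z: "\<And>k. (\<lambda>n. y (r n) k) \<longlonglongrightarrow> z k" by metis
  have zs: "sqint countZ2 z"
  proof (rule sqint_CZ_bounded_sums)
    fix F :: "(int \<times> int) set" assume F: "finite F"
    have "(\<lambda>n. \<Sum>k\<in>F. (cmod (y (r n) k))\<^sup>2) \<longlonglongrightarrow> (\<Sum>k\<in>F. (cmod (z k))\<^sup>2)"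
      by (intro tendsto_intros z)
    then show "(\<Sum>k\<in>F. (cmod (z k))\<^sup>2) \<le> 1"
      by (rule LIMSEQ_le_const2) (use sum_le_sqnorm_CZ[OF y(1) F] y(2) in auto)
  qed
  have lim0: "(\<lambda>n. 1 / (1 + real (r n))) \<longlonglongrightarrow> 0"
    using LIMSEQ_subseq_LIMSEQ[OF LIMSEQ_inverse_real_of_nat r(1)] by (simp add: o_def inverse_eq_divide)
  have lim1: "(\<lambda>n. sqnorm countZ2 (\<lambda>k. y (r n) k - mat_apply A (y (r n)) k)) \<longlonglongrightarrow> 0"
    by (rule tendsto_sandwich[OF _ _ tendsto_const lim0]) (use y(3) in auto)
  have "z k = mat_apply A z k" for k
  proof -
    have "(\<lambda>n. (cmod (y (r n) k - mat_apply A (y (r n)) k))\<^sup>2) \<longlonglongrightarrow> 0"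
      by (rule tendsto_sandwich[OF _ _ tendsto_const lim1])
        (use cmod_le_sqnorm_CZ[OF sqint_diff(1)[OF y(1) mat_apply_sqint(1)[OF y(1)]]] in auto)
    then have "(\<lambda>n. y (r n) k - mat_apply A (y (r n)) k) \<longlonglongrightarrow> 0"
      by (simp add: tendsto_norm_zero_iff power_tendsto_0_iff)
    moreover have "(\<lambda>n. y (r n) k - mat_apply A (y (r n)) k) \<longlonglongrightarrow> z k - mat_apply A z k"
      by (intro tendsto_diff z mat_apply_tendsto y1)
    ultimately show ?thesis using LIMSEQ_unique by fastforce
  qed
  then have z0: "z k = 0" for k using inj[OF zs] by blast
  obtain L where L: "finite L" "\<And>x. sqint countZ2 x \<Longrightarrow> sqnorm countZ2 x \<le> 8 * sqnorm countZ2 (\<lambda>k. x k - mat_apply A x k) + 8 * majorant_sum\<^sup>2 * (\<Sum>k\<in>L. (cmod (x k))\<^sup>2)"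
    using a_priori_bound by blast
  have "(\<lambda>n. 8 * sqnorm countZ2 (\<lambda>k. y (r n) k - mat_apply A (y (r n)) k) + 8 * majorant_sum\<^sup>2 * (\<Sum>k\<in>L. (cmod (y (r n) k))\<^sup>2))
     \<longlonglongrightarrow> 8 * 0 + 8 * majorant_sum\<^sup>2 * (\<Sum>k\<in>L. (cmod (z k))\<^sup>2)"
    by (intro tendsto_intros lim1 z)
  then have "1 \<le> 8 * 0 + 8 * majorant_sum\<^sup>2 * (\<Sum>k\<in>L. (cmod (z k))\<^sup>2)"
    by (rule LIMSEQ_le_const) (use L(2)[OF y(1)] y(2) in auto)
  then show False by (simp add: z0)
qed

section \<open>Banded finite sections and their errors\<close>

definition band_section :: "nat \<Rightarrow> real \<Rightarrow> int \<times> int \<Rightarrow> int \<times> int \<Rightarrow> complex" where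
  "band_section n T k l = (if k \<in> idx n \<and> l \<in> idx n \<and> rnorm1 (k - l) \<le> T then A k l else 0)"

text \<open>Dominates the entries that the band cut-off discards.\<close>

definition far_majorant :: "real \<Rightarrow> int \<times> int \<Rightarrow> real" where
  "far_majorant T m = (if rnorm1 m > T then C * exp (- \<beta> * rnorm1 m) else 0)"

lemma far_majorant_nonneg: "far_majorant T m \<ge> 0"
  using C_nonneg by (simp add: far_majorant_def)

lemma far_majorant_integrable: "integrable countZ2 (far_majorant T)"
  by (rule Bochner_Integration.integrable_bound[OF majorant_integrable0]) (auto simp: far_majorant_def)

text \<open>Beyond \<open>T\<close> a factor \<open>exp (- b * T)\<close> splits off and the rest is
  summable with exponent \<open>\<beta> - b\<close>. With equal exponents, the growing number of
  lattice points of a given norm would cost a factor of order \<open>T\<close>, which is the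
  logarithm of \<open>N\<close>.\<close>

lemma far_majorant_integral_le:
  assumes "0 < b" "b < \<beta>"
  shows "(\<integral>m. far_majorant T m \<partial>countZ2) \<le> exp (- b * T) * (\<integral>m. C * exp (- (\<beta> - b) * rnorm1 m) \<partial>countZ2)"
proof -
  have i: "integrable countZ2 (\<lambda>m. C * exp (- (\<beta> - b) * rnorm1 m))"
    using integrable_mult_right[OF integrable_exp_norm1[of "\<beta> - b" 0], of C] assms by simp
  have "far_majorant T m \<le> exp (- b * T) * (C * exp (- (\<beta> - b) * rnorm1 m))" for m
  proof (cases "rnorm1 m > T")
    case True
    have "exp (- \<beta> * rnorm1 m) = exp (- b * rnorm1 m) * exp (- (\<beta> - b) * rnorm1 m)"
      by (simp add: mult_exp_exp algebra_simps)
    also have "\<dots> \<le> exp (- b * T) * exp (- (\<beta> - b) * rnorm1 m)"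
      using True assms by (intro mult_right_mono) auto
    finally have "C * exp (- \<beta> * rnorm1 m) \<le> C * (exp (- b * T) * exp (- (\<beta> - b) * rnorm1 m))"
      using C_nonneg by (intro mult_left_mono)
    then show ?thesis using True by (simp add: far_majorant_def mult_ac)
  qed (use C_nonneg in \<open>simp add: far_majorant_def\<close>)
  then have "(\<integral>m. far_majorant T m \<partial>countZ2) \<le> (\<integral>m. exp (- b * T) * (C * exp (- (\<beta> - b) * rnorm1 m)) \<partial>countZ2)"
    by (intro integral_mono far_majorant_integrable integrable_mult_right i)
  then show ?thesis by simp
qed

lemma section_bound: "cmod (band_section n T k l) \<le> C * exp (- \<beta> * rnorm1 (k - l))"
  using decay[of k l] C_nonneg by (auto simp: band_section_def)

lemma section_sqint:
  assumes "sqint countZ2 x"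
  shows "sqint countZ2 (mat_apply (band_section n T) x)" "integrable countZ2 (\<lambda>l. band_section n T k l * x l)"
  using mat_apply_Schur[OF majorant_integrable0 section_bound[of n T] assms] by auto

lemma mat_apply_diff:
  assumes "sqint countZ2 x" "sqint countZ2 y" shows "mat_apply A (\<lambda>k. x k - y k) k = mat_apply A x k - mat_apply A y k"
  using mat_apply_sqint(3)[OF assms(1), of k] mat_apply_sqint(3)[OF assms(2), of k]
  by (simp add: mat_apply_def right_diff_distrib)

lemma section_diff:
  assumes "sqint countZ2 x" "sqint countZ2 y"
  shows "mat_apply (band_section n T) (\<lambda>k. x k - y k) k = mat_apply (band_section n T) x k - mat_apply (band_section n T) y k"
  using section_sqint(2)[OF assms(1), where n = n and T = T and k = k] section_sqint(2)[OF assms(2), where n = n and T = T and k = k]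
  by (simp add: mat_apply_def right_diff_distrib)

lemma section_restrict0: "mat_apply (band_section n T) (restrict0 (idx n) x) = mat_apply (band_section n T) x"
  unfolding mat_apply_def band_section_def restrict0_def by (intro ext Bochner_Integration.integral_cong) auto

text \<open>The projected matrix and the banded section differ in far entries alone.\<close>

lemma section_consistency:
  assumes x: "sqint countZ2 x"
  shows "sqint countZ2 (\<lambda>k. restrict0 (idx n) (mat_apply A (restrict0 (idx n) x)) k - mat_apply (band_section n T) x k)"
    "sqnorm countZ2 (\<lambda>k. restrict0 (idx n) (mat_apply A (restrict0 (idx n) x)) k - mat_apply (band_section n T) x k) \<le> (\<integral>m. far_majorant T m \<partial>countZ2)\<^sup>2 * sqnorm countZ2 x"
proof -
  let ?E = "\<lambda>k l. if k \<in> idx n \<and> l \<in> idx n \<and> rnorm1 (k - l) > T then A k l else 0"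
  have E: "cmod (?E k l) \<le> far_majorant T (k - l)" for k l
    using decay[of k l] C_nonneg by (auto simp: far_majorant_def)
  have "restrict0 (idx n) (mat_apply A (restrict0 (idx n) x)) k - mat_apply (band_section n T) x k = mat_apply ?E x k" for k
  proof (cases "k \<in> idx n")
    case True
    have "mat_apply A (restrict0 (idx n) x) k - mat_apply (band_section n T) x k
       = (\<integral>l. A k l * restrict0 (idx n) x l - band_section n T k l * x l \<partial>countZ2)"
      unfolding mat_apply_def by (intro Bochner_Integration.integral_diff[symmetric] mat_apply_sqint(3) section_sqint(2) sqint_restrict0 x)
    also have "\<dots> = mat_apply ?E x k"
      unfolding mat_apply_def using True
      by (intro Bochner_Integration.integral_cong) (auto simp: restrict0_def band_section_def not_le)
    finally show ?thesis using True by (simp add: restrict0_def)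
  next
    case False
    then show ?thesis by (simp add: restrict0_def mat_apply_def band_section_def)
  qed
  then have "(\<lambda>k. restrict0 (idx n) (mat_apply A (restrict0 (idx n) x)) k - mat_apply (band_section n T) x k) = mat_apply ?E x" by auto
  then show "sqint countZ2 (\<lambda>k. restrict0 (idx n) (mat_apply A (restrict0 (idx n) x)) k - mat_apply (band_section n T) x k)"
    "sqnorm countZ2 (\<lambda>k. restrict0 (idx n) (mat_apply A (restrict0 (idx n) x)) k - mat_apply (band_section n T) x k) \<le> (\<integral>m. far_majorant T m \<partial>countZ2)\<^sup>2 * sqnorm countZ2 x"
    using mat_apply_Schur[OF far_majorant_integrable E x] by auto
qed

text \<open>On diagonal \<open>m\<close>, row \<open>l\<close> meets column \<open>l - m\<close>, so
  the exceptional rows are translates of the exceptional columns and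
  \<open>dominated_diagonals_small\<close> applies again. The outcome is convergence of the
  projected matrix to \<open>A\<close> in operator norm.\<close>

lemma rows_outside_small:
  assumes "e > 0"
  shows "\<exists>n0. \<forall>n\<ge>n0. \<forall>x. sqint countZ2 x \<longrightarrow> sqnorm countZ2 (\<lambda>k. mat_apply A x k - restrict0 (idx n) (mat_apply A x) k) \<le> e * sqnorm countZ2 x"
proof -
  have b: "cmod (A l (l - m)) \<le> C * exp (- \<beta> * rnorm1 m)" for m l
    using decay[of l "l - m"] by simp
  have fin: "finite {l. cmod (A l (l - m)) > e}" if "e > 0" for m e
  proof -
    have "{l. cmod (A l (l - m)) > e} \<subseteq> (\<lambda>l. l + m) ` {l. cmod (A (l + m) l) > e}"
    proof
      fix l assume "l \<in> {l. cmod (A l (l - m)) > e}"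
      then show "l \<in> (\<lambda>l. l + m) ` {l. cmod (A (l + m) l) > e}"
        by (intro image_eqI[where x = "l - m"]) auto
    qed
    then show ?thesis using diagonals[OF that] finite_surj by blast
  qed
  obtain L d where L: "finite L" "\<And>m. 0 \<le> d m" "integrable countZ2 d"
    "(\<integral>m. d m \<partial>countZ2) \<le> sqrt e" "\<And>m l. l \<notin> L \<Longrightarrow> cmod (A l (l - m)) \<le> d m"
    using dominated_diagonals_small[of "\<lambda>m l. cmod (A l (l - m))" C \<beta> "sqrt e" 0, OF b beta_pos C_nonneg fin] assms
    by auto
  obtain n0 where n0: "\<And>n. n \<ge> n0 \<Longrightarrow> L \<subseteq> idx n" using finite_subset_idx[OF L(1)] by blast
  have "sqnorm countZ2 (\<lambda>k. mat_apply A x k - restrict0 (idx n) (mat_apply A x) k) \<le> e * sqnorm countZ2 x" if "n \<ge> n0" "sqint countZ2 x" for n x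
  proof -
    let ?E = "\<lambda>k l. if k \<in> idx n then 0 else A k l"
    have E: "cmod (?E k l) \<le> d (k - l)" for k l
      using L(5)[of k "k - l"] L(2)[of "k - l"] n0[OF that(1)] by (auto simp del: fst_diff snd_diff)
    have "(\<lambda>k. mat_apply A x k - restrict0 (idx n) (mat_apply A x) k) = mat_apply ?E x"
      by (auto simp: restrict0_def mat_apply_def)
    then have "sqnorm countZ2 (\<lambda>k. mat_apply A x k - restrict0 (idx n) (mat_apply A x) k) \<le> (\<integral>m. d m \<partial>countZ2)\<^sup>2 * sqnorm countZ2 x"
      using mat_apply_Schur(2)[OF L(3) E that(2)] by simp
    also have "\<dots> \<le> (sqrt e)\<^sup>2 * sqnorm countZ2 x"
      using L(2,4) by (intro mult_right_mono power_mono integral_nonneg) auto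
    finally show ?thesis using assms by simp
  qed
  then show ?thesis by blast
qed

text \<open>With \<open>P\<close> the projection and \<open>S\<close> the section, and
  \<open>x\<close> supported in \<open>idx n\<close>, the operators \<open>I - A\<close> and
  \<open>I - S\<close> differ by \<open>A - P A\<close>, small by \<open>rows_outside_small\<close>,
  and by \<open>P A P - S\<close>, small because the band width tends to infinity. The lower bound
  for \<open>I - A\<close> survives both.\<close>

lemma section_bounded_below:
  assumes inj: "\<And>x. sqint countZ2 x \<Longrightarrow> \<forall>k. x k = mat_apply A x k \<Longrightarrow> \<forall>k. x k = 0"
    and T: "filterlim T at_top sequentially"
  shows "\<exists>c>0. \<exists>n0. \<forall>n\<ge>n0. \<forall>x. sqint countZ2 x \<and> restrict0 (idx n) x = x \<longrightarrow>
           c * sqnorm countZ2 x \<le> sqnorm countZ2 (\<lambda>k. x k - mat_apply (band_section n (T n)) x k)"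
proof -
  obtain c where c: "c > 0" "\<And>x. sqint countZ2 x \<Longrightarrow> c * sqnorm countZ2 x \<le> sqnorm countZ2 (\<lambda>k. x k - mat_apply A x k)"
    using bounded_below[OF inj] by blast
  \<comment> \<open>In squared norms, two errors of \<open>c/16\<close> combine to
    \<open>c/4\<close>, and \<open>c <= 2 * r + 2 * (c/4)\<close> leaves
    \<open>r >= c/4\<close>.\<close>
  obtain n1 where n1: "\<And>n x. n \<ge> n1 \<Longrightarrow> sqint countZ2 x \<Longrightarrow>
      sqnorm countZ2 (\<lambda>k. mat_apply A x k - restrict0 (idx n) (mat_apply A x) k) \<le> (c/16) * sqnorm countZ2 x"
    using rows_outside_small[of "c/16"] c(1) by auto
  \<comment> \<open>Any exponent strictly between 0 and \<open>\<beta>\<close> would do; only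
    convergence to 0 matters at this point.\<close>
  define J where "J = (\<integral>m. C * exp (- (\<beta> - \<beta>/2) * rnorm1 m) \<partial>countZ2)"
  have J0: "J \<ge> 0" unfolding J_def using C_nonneg by simp
  have "filterlim (\<lambda>n. \<beta>/2 * T n) at_top sequentially"
    using T beta_pos by (intro filterlim_tendsto_pos_mult_at_top[OF tendsto_const]) auto
  then have "(\<lambda>n. exp (- (\<beta>/2 * T n))) \<longlonglongrightarrow> 0"
    by (intro filterlim_compose[OF exp_at_bot]) (simp add: filterlim_uminus_at_bot)
  then have lim: "(\<lambda>n. (exp (- (\<beta>/2 * T n)) * J)\<^sup>2) \<longlonglongrightarrow> (0 * J)\<^sup>2"
    by (intro tendsto_intros)
  have "\<forall>\<^sub>F n in sequentially. (exp (- (\<beta>/2 * T n)) * J)\<^sup>2 < c/16"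
    by (rule order_tendstoD(2)[OF lim]) (use c(1) in simp)
  then obtain n2 where n2: "\<And>n. n \<ge> n2 \<Longrightarrow> (exp (- (\<beta>/2 * T n)) * J)\<^sup>2 < c/16"
    by (auto simp: eventually_sequentially)
  have "c/4 * sqnorm countZ2 x \<le> sqnorm countZ2 (\<lambda>k. x k - mat_apply (band_section n (T n)) x k)"
    if n: "n \<ge> max n1 n2" and x: "sqint countZ2 x" "restrict0 (idx n) x = x" for n x
  proof -
    let ?S = "mat_apply (band_section n (T n)) x" and ?A = "mat_apply A x"
    let ?u = "\<lambda>k. ?A k - restrict0 (idx n) ?A k" and ?v = "\<lambda>k. restrict0 (idx n) ?A k - ?S k"
    have A: "sqint countZ2 ?A" by (rule mat_apply_sqint(1)[OF x(1)])
    have S: "sqint countZ2 ?S" by (rule section_sqint(1)[OF x(1)])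
    have u: "sqint countZ2 ?u" by (intro sqint_diff A sqint_restrict0)
    have v: "sqint countZ2 ?v" "sqnorm countZ2 ?v \<le> (\<integral>m. far_majorant (T n) m \<partial>countZ2)\<^sup>2 * sqnorm countZ2 x"
      using section_consistency[OF x(1), of n "T n"] x(2) by auto
    have "(\<integral>m. far_majorant (T n) m \<partial>countZ2)\<^sup>2 \<le> (exp (- (\<beta>/2 * T n)) * J)\<^sup>2"
      using far_majorant_integral_le[of "\<beta>/2" "T n"] beta_pos far_majorant_nonneg
      by (intro power_mono integral_nonneg) (auto simp: J_def)
    then have v2: "sqnorm countZ2 ?v \<le> c/16 * sqnorm countZ2 x"
      using n2[of n] n by (intro order_trans[OF v(2)] mult_right_mono) auto
    have u2: "sqnorm countZ2 ?u \<le> c/16 * sqnorm countZ2 x" using n1[of n x] n x(1) by auto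
    have uv: "sqnorm countZ2 (\<lambda>k. ?u k + ?v k) \<le> c/4 * sqnorm countZ2 x"
      using sqint_add(2)[OF u v(1)] u2 v2 by simp
    have "(\<lambda>k. x k - ?A k) = (\<lambda>k. (x k - ?S k) - (?u k + ?v k))" by auto
    then have "sqnorm countZ2 (\<lambda>k. x k - ?A k) \<le> 2 * sqnorm countZ2 (\<lambda>k. x k - ?S k) + 2 * sqnorm countZ2 (\<lambda>k. ?u k + ?v k)"
      using sqint_diff(2)[OF sqint_diff(1)[OF x(1) S] sqint_add(1)[OF u v(1)]] by simp
    then show ?thesis using c(2)[OF x(1)] uv by simp
  qed
  then show ?thesis using c(1) by (intro exI[of _ "c/4"] conjI exI[of _ "max n1 n2"]) auto
qed

text \<open>Outside \<open>idx n\<close> one component has modulus at least \<open>n + 1\<close>, so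
  the weight is at least \<open>(1 + n) ^ p\<close>.\<close>

lemma tail_le_weighted:
  assumes x: "sqint countZ2 (\<lambda>k. of_real (weight p k) * x k)"
  shows "sqint countZ2 (\<lambda>k. x k - restrict0 (idx n) x k)"
    "sqnorm countZ2 (\<lambda>k. x k - restrict0 (idx n) x k) \<le> (1 / (1 + real n) ^ p)\<^sup>2 * sqnorm countZ2 (\<lambda>k. of_real (weight p k) * x k)"
proof -
  have *: "cmod (x k - restrict0 (idx n) x k) \<le> 1 / (1 + real n) ^ p * cmod (of_real (weight p k) * x k)" for k
  proof (cases "k \<in> idx n")
    case True
    then show ?thesis by (simp add: restrict0_def)
  next
    case False
    then have "\<bar>fst k\<bar> \<ge> 1 + int n \<or> \<bar>snd k\<bar> \<ge> 1 + int n" by (cases k) (auto simp: idx_def)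
    then have "\<bar>real_of_int (fst k)\<bar> \<ge> 1 + real n \<or> \<bar>real_of_int (snd k)\<bar> \<ge> 1 + real n" by linarith
    then have "(real_of_int (fst k))\<^sup>2 \<ge> (1 + real n)\<^sup>2 \<or> (real_of_int (snd k))\<^sup>2 \<ge> (1 + real n)\<^sup>2"
      using power_mono[of "1 + real n" _ 2] by (metis power2_abs add_nonneg_nonneg of_nat_0_le_iff zero_le_one)
    then have "(1 + real n)\<^sup>2 \<le> 1 + (real_of_int (fst k))\<^sup>2 + (real_of_int (snd k))\<^sup>2"
      using zero_le_power2[of "real_of_int (fst k)"] zero_le_power2[of "real_of_int (snd k)"] by linarith
    then have "sqrt (((1 + real n)\<^sup>2) ^ p) \<le> weight p k"
      unfolding weight_def by (intro real_sqrt_le_mono power_mono) auto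
    also have "((1 + real n)\<^sup>2) ^ p = ((1 + real n) ^ p)\<^sup>2" by (simp add: power_mult[symmetric] mult.commute)
    finally have "(1 + real n) ^ p \<le> weight p k" by (simp add: real_sqrt_abs)
    then have "1 \<le> weight p k / (1 + real n) ^ p" by (simp add: le_divide_eq)
    from mult_right_mono[OF this norm_ge_zero[of "x k"]] show ?thesis
      using False weight_ge_1[of p k] by (simp add: restrict0_def norm_mult)
  qed
  show "sqint countZ2 (\<lambda>k. x k - restrict0 (idx n) x k)"
    "sqnorm countZ2 (\<lambda>k. x k - restrict0 (idx n) x k) \<le> (1 / (1 + real n) ^ p)\<^sup>2 * sqnorm countZ2 (\<lambda>k. of_real (weight p k) * x k)"
    using sqint_bound[OF x _ *] by auto
qed

text \<open>Stability and consistency. For \<open>z = P x - y\<close> the two equations give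
  \<open>(I - S) z = P A (x - P x) + (P A P x - S x)\<close>; the lower bound turns this into a
  bound for \<open>z\<close>, and the tail \<open>x - P x\<close> is added at the end.\<close>

lemma section_error:
  assumes c: "c > 0" and low: "\<And>z. sqint countZ2 z \<Longrightarrow> restrict0 (idx n) z = z \<Longrightarrow>
           c * sqnorm countZ2 z \<le> sqnorm countZ2 (\<lambda>k. z k - mat_apply (band_section n T) z k)"
    and x: "sqint countZ2 x" "sqint countZ2 (\<lambda>k. of_real (weight p k) * x k)"
    and y: "sqint countZ2 y" "restrict0 (idx n) y = y"
    and eq: "\<And>k. y k - mat_apply (band_section n T) y k = restrict0 (idx n) (\<lambda>k. x k - mat_apply A x k) k"
  shows "sqnorm countZ2 (\<lambda>k. x k - y k) \<le> ((2 + 4 * majorant_sum\<^sup>2 / c) * (1 / (1 + real n) ^ p)\<^sup>2 + 4 * (\<integral>m. far_majorant T m \<partial>countZ2)\<^sup>2 / c)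
            * sqnorm countZ2 (\<lambda>k. of_real (weight p k) * x k)"
proof -
  let ?P = "restrict0 (idx n)" and ?S = "mat_apply (band_section n T)" and ?w = "sqnorm countZ2 (\<lambda>k. of_real (weight p k) * x k)"
  let ?z = "\<lambda>k. ?P x k - y k" and ?t = "\<lambda>k. x k - ?P x k"
  note Px = sqint_restrict0(1)[OF x(1), of "idx n"]
  note t = tail_le_weighted[OF x(2), of n]
  have z: "sqint countZ2 ?z" by (rule sqint_diff(1)[OF Px y(1)])
  have zP: "?P ?z = ?z" using y(2) by (auto simp: restrict0_def fun_eq_iff split: if_splits)
  have tail: "sqint countZ2 (mat_apply A ?t)" "sqnorm countZ2 (mat_apply A ?t) \<le> majorant_sum\<^sup>2 * sqnorm countZ2 ?t"
    using mat_apply_sqint[OF t(1)] by auto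
  note r = sqint_restrict0[OF tail(1), of "idx n"]
  note v = section_consistency[OF x(1), of n T]
  have "?z k - ?S ?z k = ?P (mat_apply A ?t) k + (?P (mat_apply A (?P x)) k - ?S x k)" for k
  proof -
    have E1: "?z k - ?S ?z k = ?P x k - ?S x k - ?P (\<lambda>k. x k - mat_apply A x k) k"
      unfolding section_diff[OF Px y(1)] section_restrict0 eq[symmetric] by simp
    show ?thesis unfolding E1 using mat_apply_diff[OF x(1) Px, of k] by (simp add: restrict0_def)
  qed
  then have "sqnorm countZ2 (\<lambda>k. ?z k - ?S ?z k) \<le> 2 * sqnorm countZ2 (?P (mat_apply A ?t)) + 2 * ((\<integral>m. far_majorant T m \<partial>countZ2)\<^sup>2 * sqnorm countZ2 x)"
    using sqint_add(2)[OF r(1) v(1)] v(2) by simp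
  also have "sqnorm countZ2 (?P (mat_apply A ?t)) \<le> majorant_sum\<^sup>2 * sqnorm countZ2 ?t" using r(2) tail(2) by linarith
  also have "sqnorm countZ2 x \<le> ?w"
    using sqint_bound(2)[OF x(2), of x 1] weight_ge_1[of p] mult_right_mono[of 1 _ "cmod _"]
    by (auto simp: norm_mult abs_of_nonneg[OF order_trans[OF zero_le_one weight_ge_1]])
  finally have "sqnorm countZ2 (\<lambda>k. ?z k - ?S ?z k) \<le> 2 * (majorant_sum\<^sup>2 * sqnorm countZ2 ?t) + 2 * ((\<integral>m. far_majorant T m \<partial>countZ2)\<^sup>2 * ?w)"
    by (simp add: mult_left_mono)
  then have "sqnorm countZ2 ?z \<le> (2 * (majorant_sum\<^sup>2 * sqnorm countZ2 ?t) + 2 * ((\<integral>m. far_majorant T m \<partial>countZ2)\<^sup>2 * ?w)) / c"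
    using low[OF z zP] c by (simp add: field_simps)
  moreover have "sqnorm countZ2 (\<lambda>k. x k - y k) \<le> 2 * sqnorm countZ2 ?t + 2 * sqnorm countZ2 ?z"
    using sqint_add(2)[OF t(1) z] by simp
  ultimately have "sqnorm countZ2 (\<lambda>k. x k - y k) \<le> (2 + 4 * majorant_sum\<^sup>2 / c) * sqnorm countZ2 ?t + 4 * (\<integral>m. far_majorant T m \<partial>countZ2)\<^sup>2 / c * ?w"
  proof -
    assume a: "sqnorm countZ2 ?z \<le> (2 * (majorant_sum\<^sup>2 * sqnorm countZ2 ?t) + 2 * ((\<integral>m. far_majorant T m \<partial>countZ2)\<^sup>2 * ?w)) / c"
      "sqnorm countZ2 (\<lambda>k. x k - y k) \<le> 2 * sqnorm countZ2 ?t + 2 * sqnorm countZ2 ?z"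
    have "(2 + 4 * o' / c) * u + 4 * f / c * v = 2 * u + 2 * ((2 * (o' * u) + 2 * (f * v)) / c)" for o' u f v
      using c by (simp add: field_simps)
    then show ?thesis using a by (smt (verit))
  qed
  also have "\<dots> \<le> (2 + 4 * majorant_sum\<^sup>2 / c) * ((1 / (1 + real n) ^ p)\<^sup>2 * ?w) + 4 * (\<integral>m. far_majorant T m \<partial>countZ2)\<^sup>2 / c * ?w"
    using c by (intro add_right_mono mult_left_mono t(2)) auto
  finally show ?thesis by (simp add: algebra_simps)
qed

end

section \<open>Fourier series on the square\<close>

abbreviation SqM :: "(real \<times> real) measure" where "SqM \<equiv> restrict_space lborel Sq"

lemma Sq_borel [measurable]: "Sq \<in> sets borel"
proof -
  have "Sq = {x \<in> space borel. fst x \<in> {0..<2*pi} \<and> snd x \<in> {0..<2*pi}}" by (auto simp: Sq_def)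
  also have "\<dots> \<in> sets borel" unfolding borel_prod[symmetric] by measurable
  finally show ?thesis .
qed

lemma Sq_lborel: "Sq \<inter> space lborel \<in> sets lborel" by simp

lemma space_SqM [simp]: "space SqM = Sq" by (simp add: space_restrict_space)

lemma Sq_subset_cbox: "Sq \<subseteq> cbox (0,0) (2*pi,2*pi)"
  by (auto simp: Sq_def cbox_Pair_eq)

lemma box_subset_Sq: "box (0,0) (2*pi,2*pi) \<subseteq> Sq"
  by (auto simp: Sq_def box_prod)

lemma finite_measure_SqM: "finite_measure SqM"
proof
  have "emeasure SqM (space SqM) = emeasure lborel Sq"
    by (simp add: emeasure_restrict_space)
  also have "\<dots> \<le> emeasure lborel (cbox (0,0) (2*pi,2*pi) :: (real \<times> real) set)"
    by (intro emeasure_mono Sq_subset_cbox) auto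
  also have "\<dots> < \<infinity>" by (rule emeasure_lborel_cbox_finite)
  finally show "emeasure SqM (space SqM) \<noteq> \<infinity>" by simp
qed

interpretation SqM: finite_measure SqM by (rule finite_measure_SqM)

lemma sigma_finite_SqM: "sigma_finite_measure SqM" ..

lemma L2_iff: "f \<in> L2 \<longleftrightarrow> sqint SqM f"
  unfolding L2_def sqint_def set_borel_measurable_def set_integrable_def
  by (simp add: borel_measurable_restrict_space_iff[OF Sq_lborel] integrable_restrict_space[OF Sq_lborel])

lemma L2norm_eq: "L2norm f = sqrt (sqnorm SqM f)"
  by (simp add: L2norm_def sqnorm_def set_lebesgue_integral_def integral_restrict_space[OF Sq_lborel])

lemma set_integral_Sq: "(LINT x:Sq|lborel. f x) = (\<integral>x. f x \<partial>SqM)" for f :: "real \<times> real \<Rightarrow> complex"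
  by (simp add: set_lebesgue_integral_def integral_restrict_space[OF Sq_lborel])

lemma fcoef_eq: "fcoef f k = (\<integral>x. f x * cnj (ebas k x) \<partial>SqM)"
  by (simp add: fcoef_def L2inner_def set_integral_Sq)

lemma AE_Sq: "(AE t in lborel. t \<in> Sq \<longrightarrow> P t) \<longleftrightarrow> (AE t in SqM. P t)"
  by (simp add: AE_restrict_space_iff[OF Sq_lborel])

lemma measurable_SqM: "f \<in> borel_measurable borel \<Longrightarrow> f \<in> borel_measurable SqM"
  by (intro measurable_restrict_space1) simp

lemma continuous_ebas: "continuous_on UNIV (ebas k)"
  unfolding ebas_def by (intro continuous_intros) auto

lemma ebas_measurable [measurable]: "ebas k \<in> borel_measurable borel"
  by (rule borel_measurable_continuous_onI[OF continuous_ebas])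

lemma ebas_measurable' [measurable]: "ebas k \<in> borel_measurable SqM"
  by (rule measurable_SqM) measurable

lemma cmod_ebas: "cmod (ebas k t) = 1 / (2 * pi)"
  by (simp add: ebas_def norm_mult norm_divide)

lemma sqint_bounded:
  assumes "f \<in> borel_measurable SqM" "\<And>x. x \<in> Sq \<Longrightarrow> cmod (f x) \<le> B"
  shows "sqint SqM f" "sqnorm SqM f \<le> B\<^sup>2 * measure SqM Sq"
proof -
  have c: "sqint SqM (\<lambda>x. 1)" "sqnorm SqM (\<lambda>x. 1) = measure SqM Sq" by (simp_all add: sqint_def sqnorm_def)
  show "sqint SqM f" "sqnorm SqM f \<le> B\<^sup>2 * measure SqM Sq"
    using sqint_bound[OF c(1) assms(1), of B] assms(2) by (auto simp: c(2))
qed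

lemma sqint_ebas: "sqint SqM (ebas k)"
  by (rule sqint_bounded[where B = "1 / (2*pi)"]) (auto simp: cmod_ebas)

lemma cnj_measurable [measurable]: "cnj \<in> borel_measurable borel"
  by (intro borel_measurable_continuous_onI continuous_on_cnj continuous_on_id)

lemma sqint_cnj: "sqint M f \<Longrightarrow> sqint M (\<lambda>x. cnj (f x))"
  using sqint_bound(1)[of M f "\<lambda>x. cnj (f x)" 1] by (auto simp: sqint_def)

lemma fcoef_integrable: "sqint SqM f \<Longrightarrow> integrable SqM (\<lambda>x. f x * cnj (ebas k x))"
  by (intro sqint_mult_integrable sqint_cnj sqint_ebas)

lemma fcoef_add: "sqint SqM f \<Longrightarrow> sqint SqM g \<Longrightarrow> fcoef (\<lambda>x. f x + g x) k = fcoef f k + fcoef g k"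
  unfolding fcoef_eq distrib_right by (intro Bochner_Integration.integral_add fcoef_integrable)

lemma fcoef_diff: "sqint SqM f \<Longrightarrow> sqint SqM g \<Longrightarrow> fcoef (\<lambda>x. f x - g x) k = fcoef f k - fcoef g k"
  unfolding fcoef_eq left_diff_distrib by (intro Bochner_Integration.integral_diff fcoef_integrable)

lemma fcoef_cmult: "fcoef (\<lambda>x. c * f x) k = c * fcoef f k"
  unfolding fcoef_eq mult.assoc by simp

lemma fcoef_sum: "(\<And>i. i \<in> I \<Longrightarrow> sqint SqM (f i)) \<Longrightarrow> fcoef (\<lambda>x. \<Sum>i\<in>I. f i x) k = (\<Sum>i\<in>I. fcoef (f i) k)"
  by (induction I rule: infinite_finite_induct) (auto simp: fcoef_add sqint_sum fcoef_eq[of "\<lambda>x. 0"])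

text \<open>The half-open and the closed square differ by a null set. On the closed one the integral
  is an iterated gauge integral, to which the fundamental theorem of calculus applies.\<close>

lemma SqM_integral_continuous:
  fixes f :: "real \<times> real \<Rightarrow> complex"
  assumes f: "continuous_on (cbox (0,0) (2*pi,2*pi)) f"
  shows "integrable SqM f"
    "(\<integral>x. f x \<partial>SqM) = integral {0..2*pi} (\<lambda>x. integral {0..2*pi} (\<lambda>y. f (x, y)))"
proof -
  let ?C = "cbox (0,0) (2*pi,2*pi) :: (real \<times> real) set"
  have i: "integrable lborel (\<lambda>x. indicator ?C x *\<^sub>R f x)"
    by (rule borel_integrable_compact[OF compact_cbox f])
  have "?C - box (0,0) (2*pi,2*pi) \<in> null_sets lborel"
    using negligible_frontier_interval[of "(0,0)" "(2*pi,2*pi) :: real \<times> real"]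
    by (auto simp: negligible_iff_null_sets null_sets_completion_iff)
  then have "AE x in lborel. x \<notin> ?C - box (0,0) (2*pi,2*pi)" by (rule AE_not_in)
  then have ae: "AE x in lborel. indicator ?C x *\<^sub>R f x = indicator Sq x *\<^sub>R f x"
    by eventually_elim (use Sq_subset_cbox box_subset_Sq in \<open>auto simp: indicator_def\<close>)
  have m: "(\<lambda>x. indicator Sq x *\<^sub>R f x) \<in> borel_measurable lborel"
  proof -
    have "(\<lambda>x. indicator Sq x *\<^sub>R (indicator ?C x *\<^sub>R f x)) \<in> borel_measurable lborel"
      using borel_measurable_integrable[OF i] by measurable
    also have "(\<lambda>x. indicator Sq x *\<^sub>R (indicator ?C x *\<^sub>R f x)) = (\<lambda>x. indicator Sq x *\<^sub>R f x)"
      using Sq_subset_cbox by (auto simp: indicator_def fun_eq_iff)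
    finally show ?thesis .
  qed
  have "integrable lborel (\<lambda>x. indicator Sq x *\<^sub>R f x)"
    using i integrable_cong_AE[OF borel_measurable_integrable[OF i] m ae] by simp
  then show "integrable SqM f" by (simp add: integrable_restrict_space[OF Sq_lborel])
  have "(\<integral>x. f x \<partial>SqM) = (\<integral>x. indicator Sq x *\<^sub>R f x \<partial>lborel)"
    by (rule integral_restrict_space[OF Sq_lborel])
  also have "\<dots> = (\<integral>x. indicator ?C x *\<^sub>R f x \<partial>lborel)"
    by (rule integral_cong_AE[OF borel_measurable_integrable[OF i] m ae, symmetric])
  also have "\<dots> = integral ?C f"
    using set_borel_integral_eq_integral(2)[of ?C f] i by (simp add: set_integrable_def set_lebesgue_integral_def)
  also have "\<dots> = integral {0..2*pi} (\<lambda>x. integral {0..2*pi} (\<lambda>y. f (x, y)))"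
    using integral_prod_continuous[OF f] by simp
  finally show "(\<integral>x. f x \<partial>SqM) = integral {0..2*pi} (\<lambda>x. integral {0..2*pi} (\<lambda>y. f (x, y)))" .
qed

lemma integral_exp_int:
  "integral {0..2*pi} (\<lambda>x. exp (\<i> * complex_of_real (of_int m * x))) = (if m = 0 then 2 * pi else 0)"
proof (cases "m = 0")
  case False
  define P where "P x = exp (\<i> * complex_of_real (of_int m * x)) / (\<i> * of_int m)" for x :: real
  have "((\<lambda>x. exp (\<i> * complex_of_real (of_int m * x))) has_integral (P (2*pi) - P 0)) {0..2*pi}"
  proof (rule fundamental_theorem_of_calculus)
    show "(P has_vector_derivative exp (\<i> * complex_of_real (of_int m * x))) (at x within {0..2*pi})" for x
    proof -
      have "((\<lambda>z. exp (\<i> * (of_int m * z)) / (\<i> * of_int m)) has_field_derivative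
          exp (\<i> * (of_int m * complex_of_real x))) (at (complex_of_real x))"
        using False by (auto intro!: derivative_eq_intros simp: complex_eq_iff)
      from has_vector_derivative_real_field[OF this]
      show ?thesis by (simp add: P_def[abs_def] has_vector_derivative_at_within)
    qed
  qed simp
  moreover have "P (2*pi) = P 0"
  proof -
    have "exp (\<i> * complex_of_real (of_int m * (2 * pi))) = exp (of_int m * (2 * of_real pi * \<i>))"
      by (simp add: mult_ac)
    also have "\<dots> = 1" by (subst exp_eq_1) auto
    finally show ?thesis by (simp add: P_def)
  qed
  ultimately show ?thesis using False by (simp add: integral_unique)
qed (simp add: scaleR_conv_of_real)

lemma ebas_mult_cnj: "ebas k t * cnj (ebas l t) = 1 / (4 * pi\<^sup>2) *
    (exp (\<i> * complex_of_real (of_int (fst k - fst l) * fst t)) * exp (\<i> * complex_of_real (of_int (snd k - snd l) * snd t)))"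
proof -
  have "cnj (ebas l t) = 1 / (2 * complex_of_real pi) * exp (- (\<i> * complex_of_real (of_int (fst l) * fst t + of_int (snd l) * snd t)))"
    by (simp add: ebas_def exp_cnj)
  then show ?thesis
    by (simp add: ebas_def exp_add[symmetric] exp_minus[symmetric] mult_exp_exp power2_eq_square field_simps)
qed

lemma ebas_orthonormal: "fcoef (ebas k) l = (if k = l then 1 else 0)"
proof -
  have "fcoef (ebas k) l = 1 / (4 * pi\<^sup>2) * integral {0..2*pi} (\<lambda>x. integral {0..2*pi} (\<lambda>y.
    (exp (\<i> * complex_of_real (of_int (fst k - fst l) * x)) * exp (\<i> * complex_of_real (of_int (snd k - snd l) * y)))))"
    unfolding fcoef_eq ebas_mult_cnj
    by (subst SqM_integral_continuous) (auto intro!: continuous_intros)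
  also have "\<dots> = (if k = l then 1 else 0)"
    unfolding integral_mult_right integral_mult_left integral_exp_int
    by (auto simp: prod_eq_iff power2_eq_square)
  finally show ?thesis .
qed

section \<open>Density of trigonometric polynomials\<close>

inductive trig_poly :: "(real \<times> real \<Rightarrow> complex) \<Rightarrow> bool" where
  base: "trig_poly (ebas k)"
| add: "trig_poly f \<Longrightarrow> trig_poly g \<Longrightarrow> trig_poly (\<lambda>t. f t + g t)"
| cmult: "trig_poly f \<Longrightarrow> trig_poly (\<lambda>t. c * f t)"

lemma ebas_mult: "ebas k t * ebas l t = 1 / (2 * pi) * ebas (k + l) t"
  by (simp add: ebas_def mult_exp_exp algebra_simps)

lemma trig_poly_mult_ebas: "trig_poly f \<Longrightarrow> trig_poly (\<lambda>t. f t * ebas l t)"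
proof (induction rule: trig_poly.induct)
  case (base k)
  show ?case unfolding ebas_mult by (intro trig_poly.intros)
next
  case (add f g)
  then show ?case unfolding distrib_right by (intro trig_poly.intros)
next
  case (cmult f c)
  then show ?case unfolding mult.assoc by (intro trig_poly.intros)
qed

lemma trig_poly_mult: "trig_poly g \<Longrightarrow> trig_poly f \<Longrightarrow> trig_poly (\<lambda>t. f t * g t)"
proof (induction rule: trig_poly.induct)
  case (base k)
  then show ?case by (rule trig_poly_mult_ebas)
next
  case (add f g)
  then show ?case unfolding distrib_left by (intro trig_poly.intros) auto
next
  case (cmult f c)
  then show ?case unfolding mult.left_commute[of _ c] by (intro trig_poly.intros) auto
qed

lemma trig_poly_ebas': "trig_poly (\<lambda>t. exp (\<i> * complex_of_real (of_int (fst k) * fst t + of_int (snd k) * snd t)))"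
  using trig_poly.cmult[OF trig_poly.base[of k], of "2 * pi"] by (simp add: ebas_def)

lemma trig_poly_const: "trig_poly (\<lambda>t. c)"
  using trig_poly.cmult[OF trig_poly_ebas'[of "(0,0)"], of c] by simp

lemma trig_poly_cis: "trig_poly (\<lambda>t. cis (fst t))" "trig_poly (\<lambda>t. cis (snd t))"
  "trig_poly (\<lambda>t. cnj (cis (fst t)))" "trig_poly (\<lambda>t. cnj (cis (snd t)))"
  using trig_poly_ebas'[of "(1,0)"] trig_poly_ebas'[of "(0,1)"] trig_poly_ebas'[of "(-1,0)"] trig_poly_ebas'[of "(0,-1)"]
  by (simp_all add: cis_conv_exp exp_cnj)

lemma trig_poly_Re:
  assumes "trig_poly f" "trig_poly (\<lambda>t. cnj (f t))"
  shows "trig_poly (\<lambda>t. complex_of_real (Re (f t)))" "trig_poly (\<lambda>t. complex_of_real (Im (f t)))"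
proof -
  have "(\<lambda>t. complex_of_real (Re (f t))) = (\<lambda>t. (1/2) * (f t + cnj (f t)))"
    by (auto simp: complex_eq_iff)
  then show "trig_poly (\<lambda>t. complex_of_real (Re (f t)))"
    using trig_poly.cmult[OF trig_poly.add[OF assms], of "1/2"] by simp
  have "(\<lambda>t. complex_of_real (Im (f t))) = (\<lambda>t. (-\<i>/2) * (f t + (-1) * cnj (f t)))"
    by (auto simp: complex_eq_iff)
  then show "trig_poly (\<lambda>t. complex_of_real (Im (f t)))"
    using trig_poly.cmult[OF trig_poly.add[OF assms(1) trig_poly.cmult[OF assms(2), of "-1"]], of "-\<i>/2"] by simp
qed

text \<open>Real polynomials on \<open>complex \<times> complex\<close> are polynomials in four real
  coordinates. On the torus these coordinates are real and imaginary parts of \<open>cis\<close>,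
  which are trigonometric polynomials.\<close>

lemma trig_poly_polynomial:
  fixes g :: "complex \<times> complex \<Rightarrow> real"
  assumes "real_polynomial_function g"
  shows "trig_poly (\<lambda>t. complex_of_real (g (cis (fst t), cis (snd t))))"
  using assms
proof (induction rule: real_polynomial_function.induct)
  case (linear f)
  interpret bounded_linear f by fact
  have lin: "f (z, w) = Re z * f (1, 0) + Im z * f (\<i>, 0) + Re w * f (0, 1) + Im w * f (0, \<i>)" for z w
  proof -
    have "(z, w) = Re z *\<^sub>R (1, 0) + Im z *\<^sub>R (\<i>, 0) + Re w *\<^sub>R (0, 1) + Im w *\<^sub>R (0, \<i>)"
      by (auto simp: complex_eq_iff)
    then have "f (z, w) = f (Re z *\<^sub>R (1, 0) + Im z *\<^sub>R (\<i>, 0) + Re w *\<^sub>R (0, 1) + Im w *\<^sub>R (0, \<i>))"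
      by (rule arg_cong)
    also have "\<dots> = Re z * f (1, 0) + Im z * f (\<i>, 0) + Re w * f (0, 1) + Im w * f (0, \<i>)"
      by (simp only: add scaleR real_scaleR_def)
    finally show ?thesis .
  qed
  have "(\<lambda>t. complex_of_real (f (cis (fst t), cis (snd t)))) = (\<lambda>t.
      of_real (f (1, 0)) * of_real (Re (cis (fst t))) + of_real (f (\<i>, 0)) * of_real (Im (cis (fst t)))
    + of_real (f (0, 1)) * of_real (Re (cis (snd t))) + of_real (f (0, \<i>)) * of_real (Im (cis (snd t))))"
    by (intro ext, subst lin) (simp add: mult.commute)
  then show ?case
    by (simp only:) (intro trig_poly.add trig_poly.cmult trig_poly_Re trig_poly_cis)
next
  case (const c)
  show ?case by (rule trig_poly_const)
next
  case (add f g)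
  then show ?case by (simp add: trig_poly.add)
next
  case (mult f g)
  then show ?case by (simp add: trig_poly_mult)
qed

lemma trig_poly_Xn: "trig_poly f \<Longrightarrow> \<exists>n. f \<in> Xn n"
proof -
  have mono: "f \<in> Xn m \<Longrightarrow> m \<le> n \<Longrightarrow> f \<in> Xn n" for f m n
  proof -
    assume "f \<in> Xn m" "m \<le> n"
    then obtain c where c: "\<And>t. f t = (\<Sum>k\<in>idx m. c k * ebas k t)" by (auto simp: Xn_def)
    have "f t = (\<Sum>k\<in>idx n. (if k \<in> idx m then c k else 0) * ebas k t)" for t
      unfolding c using idx_mono[OF \<open>m \<le> n\<close>] by (intro sum.mono_neutral_cong_left) auto
    then show "f \<in> Xn n"
      unfolding Xn_def by (intro CollectI exI[of _ "\<lambda>k. if k \<in> idx m then c k else 0"]) auto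
  qed
  show "trig_poly f \<Longrightarrow> \<exists>n. f \<in> Xn n"
  proof (induction rule: trig_poly.induct)
    case (base k)
    have "ebas k t = (\<Sum>j\<in>idx (nat (norm1 k)). (if j = k then 1 else 0) * ebas j t)" for t
      using in_idx_norm1[of k] by (simp add: if_distrib[of "\<lambda>u. u * _"] cong: if_cong)
    then show ?case
      unfolding Xn_def by (intro exI[of _ "nat (norm1 k)"] CollectI exI[of _ "\<lambda>j. if j = k then 1 else 0"]) auto
  next
    case (add f g)
    then obtain n where "f \<in> Xn n" "g \<in> Xn n" using mono by (meson nle_le)
    then obtain c d where "\<And>t. f t = (\<Sum>k\<in>idx n. c k * ebas k t)" "\<And>t. g t = (\<Sum>k\<in>idx n. d k * ebas k t)"
      by (auto simp: Xn_def)
    then have "f t + g t = (\<Sum>k\<in>idx n. (c k + d k) * ebas k t)" for t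
      by (simp add: sum.distrib distrib_right)
    then show ?case unfolding Xn_def by (intro exI[of _ n] CollectI exI[of _ "\<lambda>k. c k + d k"]) auto
  next
    case (cmult f a)
    then obtain n c where "\<And>t. f t = (\<Sum>k\<in>idx n. c k * ebas k t)" by (auto simp: Xn_def)
    then have "a * f t = (\<Sum>k\<in>idx n. (a * c k) * ebas k t)" for t
      by (simp add: sum_distrib_left mult.assoc)
    then show ?case unfolding Xn_def by (intro exI[of _ n] CollectI exI[of _ "\<lambda>k. a * c k"]) auto
  qed
qed

lemma trig_poly_sqint: "trig_poly p \<Longrightarrow> sqint SqM p"
  by (induction rule: trig_poly.induct) (auto intro: sqint_ebas sqint_add sqint_cmult)

text \<open>Membership in the closure of the trigonometric polynomials. It is extended in turn to
  continuous functions on the torus, to indicators of compact and of Borel sets, and to all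
  square-integrable functions.\<close>

definition trig_approx :: "(real \<times> real \<Rightarrow> complex) \<Rightarrow> bool" where
  "trig_approx f \<longleftrightarrow> sqint SqM f \<and> (\<forall>e>0. \<exists>p. trig_poly p \<and> sqnorm SqM (\<lambda>x. f x - p x) < e)"

lemma trig_poly_trig_approx: "trig_poly p \<Longrightarrow> trig_approx p"
  unfolding trig_approx_def by (auto intro!: trig_poly_sqint exI[of _ p])

lemma trig_approx_limit:
  assumes "sqint SqM f" "\<And>e. e > 0 \<Longrightarrow> \<exists>g. trig_approx g \<and> sqnorm SqM (\<lambda>x. f x - g x) < e"
  shows "trig_approx f"
  unfolding trig_approx_def
proof (intro conjI assms(1) allI impI)
  fix e :: real assume "e > 0"
  then obtain g where g: "trig_approx g" "sqnorm SqM (\<lambda>x. f x - g x) < e/4" using assms(2)[of "e/4"] by auto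
  then obtain p where p: "trig_poly p" "sqnorm SqM (\<lambda>x. g x - p x) < e/4"
    unfolding trig_approx_def using \<open>e > 0\<close> by (metis divide_pos_pos zero_less_numeral)
  have gs: "sqint SqM g" using g(1) by (simp add: trig_approx_def)
  have "sqnorm SqM (\<lambda>x. f x - p x) \<le> 2 * sqnorm SqM (\<lambda>x. f x - g x) + 2 * sqnorm SqM (\<lambda>x. g x - p x)"
    using sqint_add(2)[OF sqint_diff(1)[OF assms(1) gs] sqint_diff(1)[OF gs trig_poly_sqint[OF p(1)]]] by simp
  then show "\<exists>p. trig_poly p \<and> sqnorm SqM (\<lambda>x. f x - p x) < e"
    using g(2) p by (intro exI[of _ p]) auto
qed

lemma trig_approx_add: 
  assumes "trig_approx f" "trig_approx g" shows "trig_approx (\<lambda>x. f x + g x)"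
  unfolding trig_approx_def
proof (intro conjI allI impI)
  have s: "sqint SqM f" "sqint SqM g" using assms by (auto simp: trig_approx_def)
  show "sqint SqM (\<lambda>x. f x + g x)" by (intro sqint_add s)
  fix e :: real assume "e > 0"
  then have "e/4 > 0" by simp
  then obtain p q where p: "trig_poly p" "sqnorm SqM (\<lambda>x. f x - p x) < e/4" and q: "trig_poly q" "sqnorm SqM (\<lambda>x. g x - q x) < e/4"
    using assms unfolding trig_approx_def by meson
  have "sqnorm SqM (\<lambda>x. (f x - p x) + (g x - q x)) \<le> 2 * sqnorm SqM (\<lambda>x. f x - p x) + 2 * sqnorm SqM (\<lambda>x. g x - q x)"
    by (intro sqint_add sqint_diff s trig_poly_sqint p q)
  then show "\<exists>p. trig_poly p \<and> sqnorm SqM (\<lambda>x. f x + g x - p x) < e"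
    using p q by (intro exI[of _ "\<lambda>x. p x + q x"]) (auto intro: trig_poly.add simp: algebra_simps)
qed

lemma trig_approx_cmult:
  assumes "trig_approx f" shows "trig_approx (\<lambda>x. c * f x)"
  unfolding trig_approx_def
proof (intro conjI allI impI)
  have s: "sqint SqM f" using assms by (auto simp: trig_approx_def)
  show "sqint SqM (\<lambda>x. c * f x)" by (intro sqint_cmult s)
  fix e :: real assume "e > 0"
  then have "e / (1 + (cmod c)\<^sup>2) > 0" by (simp add: add_pos_nonneg)
  then obtain p where p: "trig_poly p" "sqnorm SqM (\<lambda>x. f x - p x) < e / (1 + (cmod c)\<^sup>2)"
    using assms unfolding trig_approx_def by meson
  have "sqnorm SqM (\<lambda>x. c * (f x - p x)) = (cmod c)\<^sup>2 * sqnorm SqM (\<lambda>x. f x - p x)"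
    by (intro sqint_cmult sqint_diff s trig_poly_sqint p)
  also have "\<dots> \<le> (1 + (cmod c)\<^sup>2) * sqnorm SqM (\<lambda>x. f x - p x)"
    by (intro mult_right_mono) auto
  also have "\<dots> < e" using p(2) by (simp add: less_divide_eq add_pos_nonneg mult.commute)
  finally show "\<exists>p. trig_poly p \<and> sqnorm SqM (\<lambda>x. c * f x - p x) < e"
    using p by (intro exI[of _ "\<lambda>x. c * p x"]) (auto intro: trig_poly.cmult simp: right_diff_distrib)
qed

lemma trig_approx_continuous:
  assumes u: "continuous_on UNIV (u :: complex \<times> complex \<Rightarrow> real)"
  shows "trig_approx (\<lambda>t. complex_of_real (u (cis (fst t), cis (snd t))))" (is "trig_approx ?f")
proof -
  have m: "?f \<in> borel_measurable SqM"
    by (intro measurable_SqM borel_measurable_continuous_onI continuous_intros continuous_on_compose2[OF u]) auto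
  \<comment> \<open>Stone-Weierstrass is applied on the torus in
    \<open>complex \<times> complex\<close>: periodic functions on the square are functions of the
    two values of \<open>cis\<close>.\<close>
  define S :: "(complex \<times> complex) set" where "S = sphere 0 1 \<times> sphere 0 1"
  have S: "compact S" unfolding S_def by (intro compact_Times compact_sphere)
  have hS: "(cis (fst t), cis (snd t)) \<in> S" for t by (simp add: S_def)
  have uS: "continuous_on S u" using u continuous_on_subset by blast
  have ap: "\<exists>p. trig_poly p \<and> (\<forall>t. cmod (?f t - p t) \<le> e)" if e: "e > 0" for e
  proof -
    obtain g where g: "real_polynomial_function g" "\<And>x. x \<in> S \<Longrightarrow> \<bar>u x - g x\<bar> < e"
      using Stone_Weierstrass_real_polynomial_function[OF S uS e] by blast
    show ?thesis
      using trig_poly_polynomial[OF g(1)] g(2)[OF hS]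
      by (intro exI[of _ "\<lambda>t. complex_of_real (g (cis (fst t), cis (snd t)))"])
        (auto simp flip: of_real_diff intro: less_imp_le)
  qed
  obtain p where p: "trig_poly p" "\<And>t. cmod (?f t - p t) \<le> 1" using ap[of 1] by auto
  have "sqint SqM (\<lambda>t. ?f t - p t)"
    by (rule sqint_bounded[where B = 1]) (use p m trig_poly_sqint[OF p(1)] in \<open>auto simp: sqint_def\<close>)
  from sqint_add(1)[OF this trig_poly_sqint[OF p(1)]] have s: "sqint SqM ?f" by simp
  show ?thesis
    unfolding trig_approx_def
  proof (intro conjI s allI impI)
    fix e :: real assume e: "e > 0"
    define d where "d = sqrt (e / (1 + measure SqM Sq))"
    have "d > 0" using e by (simp add: d_def add_pos_nonneg)
    then obtain p where p: "trig_poly p" "\<And>t. cmod (?f t - p t) \<le> d" using ap[of d] by auto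
    have "sqnorm SqM (\<lambda>t. ?f t - p t) \<le> d\<^sup>2 * measure SqM Sq"
      by (rule sqint_bounded(2)) (use p m trig_poly_sqint[OF p(1)] in \<open>auto simp: sqint_def\<close>)
    also have "\<dots> < e"
      using e by (simp add: d_def add_pos_nonneg divide_less_eq less_imp_le)
    finally show "\<exists>p. trig_poly p \<and> sqnorm SqM (\<lambda>x. ?f x - p x) < e" using p by auto
  qed
qed

lemma cis_inj_on_Sq:
  assumes "s \<in> Sq" "t \<in> Sq" "cis (fst s) = cis (fst t)" "cis (snd s) = cis (snd t)" shows "s = t"
proof -
  have "x = y" if "cis x = cis y" "0 \<le> x" "x < 2*pi" "0 \<le> y" "y < 2*pi" for x y
  proof -
    have "sin x = sin y \<and> cos x = cos y" using that(1) by (simp add: complex_eq_iff)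
    then obtain n :: int where n: "x = y + 2 * pi * n" using sin_cos_eq_iff[of x y] by auto
    have "\<bar>2 * pi * real_of_int n\<bar> < 2 * pi" using that n by linarith
    then have "\<bar>real_of_int n\<bar> < 1" by (simp add: abs_mult)
    then show ?thesis using n by simp
  qed
  then show ?thesis using assms by (auto simp: Sq_def prod_eq_iff)
qed

text \<open>The cut-off functions \<open>u n\<close> depend on distances on the torus, so
  \<open>trig_approx_continuous\<close> covers them. They converge to the indicator at every point
  of \<open>Sq\<close>, because the map to the torus is injective on the half-open square.\<close>

lemma trig_approx_indicator_compact:
  assumes K: "compact K" "K \<subseteq> Sq" shows "trig_approx (indicator K)"
proof (cases "K = {}")
  case True
  then show ?thesis using trig_poly_trig_approx[OF trig_poly_const[of 0]] by (simp add: indicator_def[abs_def])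
next
  case False
  define h :: "real \<times> real \<Rightarrow> complex \<times> complex" where "h t = (cis (fst t), cis (snd t))" for t
  have hc: "continuous_on X h" for X unfolding h_def by (intro continuous_intros)
  have hK: "closed (h ` K)" "h ` K \<noteq> {}"
    using compact_continuous_image[OF hc K(1)] compact_imp_closed False by auto
  define u where "u n z = max 0 (1 - real n * infdist z (h ` K))" for n z
  have uc: "continuous_on UNIV (u n)" for n unfolding u_def by (intro continuous_intros)
  have ua: "trig_approx (\<lambda>t. complex_of_real (u n (h t)))" for n
    using trig_approx_continuous[OF uc[of n]] by (simp add: h_def)
  have m: "(indicator K :: _ \<Rightarrow> complex) \<in> borel_measurable SqM"
    using K(1) by (intro measurable_SqM borel_measurable_indicator) (simp add: compact_imp_closed)
  have s: "sqint SqM (indicator K)" by (rule sqint_bounded[OF m, where B = 1]) (auto simp: indicator_def)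
  have lim: "(\<lambda>n. u n (h t)) \<longlonglongrightarrow> indicator K t" if t: "t \<in> Sq" for t
  proof (cases "t \<in> K")
    case True
    then have "infdist (h t) (h ` K) = 0" by simp
    then show ?thesis using True by (simp add: u_def)
  next
    case False
    have "h t \<notin> h ` K"
    proof
      assume "h t \<in> h ` K"
      then obtain s where "s \<in> K" "cis (fst t) = cis (fst s)" "cis (snd t) = cis (snd s)"
        unfolding h_def by blast
      then have "t = s" using cis_inj_on_Sq[OF t, of s] K(2) by blast
      then show False using False \<open>s \<in> K\<close> by simp
    qed
    then have pos: "infdist (h t) (h ` K) > 0" using hK in_closed_iff_infdist_zero infdist_nonneg less_eq_real_def by metis
    obtain N :: nat where N: "real N * infdist (h t) (h ` K) > 1" using reals_Archimedean3[OF pos] by blast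
    have "u n (h t) = 0" if "n \<ge> N" for n
    proof -
      have "real N * infdist (h t) (h ` K) \<le> real n * infdist (h t) (h ` K)" using that pos by simp
      then show ?thesis using N by (simp add: u_def)
    qed
    then have "(\<lambda>n. u n (h t)) \<longlonglongrightarrow> 0"
      by (intro tendsto_eventually) (auto simp: eventually_sequentially)
    then show ?thesis using False by simp
  qed
  have u01: "0 \<le> u n z" "u n z \<le> 1" for n z by (auto simp: u_def infdist_nonneg)
  have "(\<lambda>n. sqnorm SqM (\<lambda>t. indicator K t - complex_of_real (u n (h t)))) \<longlonglongrightarrow> (\<integral>t. 0 \<partial>SqM)"
    unfolding sqnorm_def
  proof (rule integral_dominated_convergence[where w = "\<lambda>_. 1"])
    show "AE t in SqM. (\<lambda>n. (cmod (indicator K t - complex_of_real (u n (h t))))\<^sup>2) \<longlonglongrightarrow> 0"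
    proof (rule AE_I2)
      fix t assume "t \<in> space SqM"
      then have "(\<lambda>n. (cmod (complex_of_real (indicator K t) - complex_of_real (u n (h t))))\<^sup>2) \<longlonglongrightarrow>
           (cmod (complex_of_real (indicator K t) - complex_of_real (indicator K t)))\<^sup>2"
        by (intro tendsto_intros lim) simp
      then show "(\<lambda>n. (cmod (indicator K t - complex_of_real (u n (h t))))\<^sup>2) \<longlonglongrightarrow> 0"
        by (simp add: indicator_def of_bool_def if_distrib[of complex_of_real] cong: if_cong)
    qed
    show "AE t in SqM. norm ((cmod (indicator K t - complex_of_real (u n (h t))))\<^sup>2) \<le> 1" for n
    proof (rule AE_I2)
      fix t
      have "cmod (indicator K t - complex_of_real (u n (h t))) \<le> 1"
      proof -
        have "indicator K t - complex_of_real (u n (h t)) = complex_of_real (indicator K t - u n (h t))"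
          by (simp add: indicator_def)
        moreover have "\<bar>indicator K t - u n (h t)\<bar> \<le> 1"
          using u01(1)[of n "h t"] u01(2)[of n "h t"] by (cases "t \<in> K") auto
        ultimately show ?thesis by (simp only: norm_of_real)
      qed
      then show "norm ((cmod (indicator K t - complex_of_real (u n (h t))))\<^sup>2) \<le> 1"
        by (simp add: abs_square_le_1)
    qed
    show "(\<lambda>t. (cmod (indicator K t - complex_of_real (u n (h t))))\<^sup>2) \<in> borel_measurable SqM" for n
      using m ua[of n] by (auto simp: trig_approx_def sqint_def)
  qed auto
  then have lim0: "(\<lambda>n. sqnorm SqM (\<lambda>t. indicator K t - complex_of_real (u n (h t)))) \<longlonglongrightarrow> 0" by simp
  show ?thesis
  proof (rule trig_approx_limit[OF s])
    fix e :: real assume "e > 0"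
    then obtain n where "sqnorm SqM (\<lambda>t. indicator K t - complex_of_real (u n (h t))) < e"
      using order_tendstoD(2)[OF lim0] by (auto simp: eventually_sequentially)
    then show "\<exists>g. trig_approx g \<and> sqnorm SqM (\<lambda>x. indicator K x - g x) < e" using ua by blast
  qed
qed

text \<open>Inner regularity: the squared norm of the difference of the indicators of
  \<open>B\<close> and of a compact subset is the measure of what is left over.\<close>

lemma trig_approx_indicator:
  assumes B: "B \<in> sets SqM" shows "trig_approx (indicator B)"
proof -
  have BS: "B \<subseteq> Sq" "B \<in> sets borel" using B by (auto simp: sets_restrict_space)
  have s: "sqint SqM (indicator B)" using B by (intro sqint_bounded[where B = 1]) (auto simp: indicator_def)
  show ?thesis
  proof (rule trig_approx_limit[OF s])
    fix e :: real assume e: "e > 0"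
    have "B \<in> sets lebesgue" using BS(2) by simp
    from sets_lebesgue_inner_closed[OF this e] obtain T where
      T: "closed T" "T \<subseteq> B" "emeasure lebesgue (B - T) < ennreal e" .
    have "bounded T" 
      by (rule bounded_subset[OF bounded_cbox]) (use T(2) BS(1) Sq_subset_cbox in blast)
    then have c: "compact T" using T(1) by (simp add: compact_eq_bounded_closed)
    have BT: "B - T \<in> sets borel" using BS T(1) by auto
    have "sqnorm SqM (\<lambda>x. indicator B x - indicator T x) = (\<integral>x. indicator (B - T) x \<partial>SqM)"
      unfolding sqnorm_def using T(2) by (intro Bochner_Integration.integral_cong) (auto simp: indicator_def)
    also have "\<dots> = measure SqM ((B - T) \<inter> space SqM)"
      by simp
    also have "(B - T) \<inter> space SqM = B - T" using BS by auto
    also have "measure SqM (B - T) = measure lborel (B - T)"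
      using BS BT by (subst measure_restrict_space) auto
    also have "\<dots> < e"
    proof -
      have "emeasure lborel (B - T) < ennreal e" using T(3) BT by (simp add: emeasure_completion)
      then have "ennreal (enn2real (emeasure lborel (B - T))) < ennreal e"
        by (subst ennreal_enn2real) (auto intro: less_trans)
      then show ?thesis by (simp add: measure_def ennreal_less_iff)
    qed
    finally show "\<exists>g. trig_approx g \<and> sqnorm SqM (\<lambda>x. indicator B x - g x) < e"
      using trig_approx_indicator_compact[OF c] T(2) BS(1) by blast
  qed
qed

lemma trig_approx_sqint:
  assumes f: "sqint SqM f" shows "trig_approx f"
proof (rule trig_approx_limit[OF f])
  have fm: "f \<in> borel_measurable SqM" using f by (simp add: sqint_def)
  from borel_measurable_implies_sequence_metric[OF fm, of 0] obtain F where F: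
    "\<And>i. simple_function SqM (F i)" "\<And>x. x \<in> Sq \<Longrightarrow> (\<lambda>i. F i x) \<longlonglongrightarrow> f x"
    "\<And>i x. x \<in> Sq \<Longrightarrow> dist (F i x) 0 \<le> 2 * dist (f x) 0"
    unfolding space_SqM by blast
  have Fm: "F i \<in> borel_measurable SqM" for i by (rule borel_measurable_simple_function[OF F(1)])
  have Fa: "trig_approx (F i)" for i
  proof -
    let ?g = "\<lambda>x. \<Sum>y\<in>F i ` Sq. y * indicator (F i -` {y} \<inter> Sq) x"
    have "trig_approx ?g"
    proof -
      have "trig_approx (\<lambda>x. \<Sum>y\<in>Y. y * indicator (F i -` {y} \<inter> Sq) x)" if "finite Y" for Y
        using that
      proof (induction Y)
        case empty
        show ?case using trig_poly_trig_approx[OF trig_poly_const[of 0]] by simp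
      next
        case (insert y Y)
        have "F i -` {y} \<inter> space SqM \<in> sets SqM" using measurable_sets[OF Fm[of i], of "{y}"] by simp
        then have "trig_approx (\<lambda>x. y * indicator (F i -` {y} \<inter> Sq) x)"
          by (intro trig_approx_cmult trig_approx_indicator) simp
        from trig_approx_add[OF this insert.IH] show ?case using insert.hyps by (simp only: sum.insert not_False_eq_True)
      qed
      then show ?thesis using F(1)[of i] by (simp add: simple_function_def)
    qed
    moreover have eq: "?g x = F i x" if "x \<in> Sq" for x
    proof -
      have "?g x = (\<Sum>y\<in>F i ` Sq. if y = F i x then y else 0)"
        using that by (intro sum.cong) (auto simp: indicator_def)
      then show ?thesis using that F(1)[of i] by (simp add: simple_function_def)
    qed
    ultimately show ?thesis
    proof -
      assume g: "trig_approx ?g"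
      have e: "sqnorm SqM (\<lambda>x. F i x - p x) = sqnorm SqM (\<lambda>x. ?g x - p x)" for p
        unfolding sqnorm_def using eq by (intro Bochner_Integration.integral_cong) auto
      have "sqint SqM (F i)"
      proof (rule sqint_cong_AE(1)[OF _ Fm AE_I2])
        show "sqint SqM ?g" using g by (simp only: trig_approx_def)
        show "?g x = F i x" if "x \<in> space SqM" for x using eq that by simp
      qed
      then show ?thesis using g unfolding trig_approx_def e by auto
    qed
  qed
  have "(\<lambda>i. sqnorm SqM (\<lambda>x. f x - F i x)) \<longlonglongrightarrow> (\<integral>x. 0 \<partial>SqM)"
    unfolding sqnorm_def
  \<comment> \<open>The approximations satisfy \<open>cmod (F i x) <= 2 * cmod (f x)\<close>, so the
    difference is at most \<open>3 * cmod (f x)\<close>.\<close>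
  proof (rule integral_dominated_convergence[where w = "\<lambda>x. 9 * (cmod (f x))\<^sup>2"])
    show "AE x in SqM. (\<lambda>i. (cmod (f x - F i x))\<^sup>2) \<longlonglongrightarrow> 0"
    proof (rule AE_I2)
      fix x assume "x \<in> space SqM"
      then have "(\<lambda>i. (cmod (f x - F i x))\<^sup>2) \<longlonglongrightarrow> (cmod (f x - f x))\<^sup>2"
        by (intro tendsto_intros F(2)) simp
      then show "(\<lambda>i. (cmod (f x - F i x))\<^sup>2) \<longlonglongrightarrow> 0" by simp
    qed
    show "AE x in SqM. norm ((cmod (f x - F i x))\<^sup>2) \<le> 9 * (cmod (f x))\<^sup>2" for i
    proof (rule AE_I2)
      fix x assume "x \<in> space SqM"
      then have "cmod (f x - F i x) \<le> 3 * cmod (f x)"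
        using F(3)[of x i] norm_triangle_ineq4[of "f x" "F i x"] by (simp add: dist_norm)
      from power_mono[OF this norm_ge_zero, of 2]
      show "norm ((cmod (f x - F i x))\<^sup>2) \<le> 9 * (cmod (f x))\<^sup>2" by (simp add: power_mult_distrib)
    qed
  qed (use f fm Fm in \<open>auto simp: sqint_def\<close>)
  then have lim0: "(\<lambda>i. sqnorm SqM (\<lambda>x. f x - F i x)) \<longlonglongrightarrow> 0" by simp
  fix e :: real assume "e > 0"
  then obtain n where "sqnorm SqM (\<lambda>x. f x - F n x) < e"
    using order_tendstoD(2)[OF lim0] by (auto simp: eventually_sequentially)
  then show "\<exists>g. trig_approx g \<and> sqnorm SqM (\<lambda>x. f x - g x) < e" using Fa by blast
qed


section \<open>Parseval's identity and functions with prescribed coefficients\<close>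

lemma Parseval_expansion:
  assumes f: "sqint SqM f"
  shows "sqnorm SqM (\<lambda>t. f t - (\<Sum>k\<in>I. c k * ebas k t))
     = sqnorm SqM f - (\<Sum>k\<in>I. (cmod (fcoef f k))\<^sup>2) + (\<Sum>k\<in>I. (cmod (fcoef f k - c k))\<^sup>2)"
proof (cases "finite I")
  \<comment> \<open>For infinite \<open>I\<close> all sums over \<open>I\<close> are 0 by
    convention, and both sides are \<open>sqnorm SqM f\<close>.\<close>
  case fin: True
  let ?p = "\<lambda>t. \<Sum>k\<in>I. c k * ebas k t"
  have p: "sqint SqM ?p" by (intro sqint_sum sqint_cmult sqint_ebas)
  have sq: "complex_of_real (sqnorm SqM h) = (\<integral>x. h x * cnj (h x) \<partial>SqM)" if "sqint SqM h" for h
    unfolding sqnorm_def by (subst integral_complex_of_real[symmetric]) (simp only: complex_norm_square)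
  have ip: "(\<integral>x. h x * cnj (?p x) \<partial>SqM) = (\<Sum>k\<in>I. fcoef h k * cnj (c k))" if h: "sqint SqM h" for h
  proof -
    have "(\<integral>x. h x * cnj (?p x) \<partial>SqM) = (\<integral>x. (\<Sum>k\<in>I. (h x * cnj (ebas k x)) * cnj (c k)) \<partial>SqM)"
      by (intro Bochner_Integration.integral_cong) (auto simp: sum_distrib_left mult_ac)
    also have "\<dots> = (\<Sum>k\<in>I. fcoef h k * cnj (c k))"
      using fcoef_integrable[OF h] by (subst Bochner_Integration.integral_sum) (auto simp: fcoef_eq)
    finally show ?thesis .
  qed
  have pk: "fcoef ?p k = (if k \<in> I then c k else 0)" for k
    using fin by (subst fcoef_sum) (auto simp: sqint_cmult sqint_ebas fcoef_cmult ebas_orthonormal if_distrib[of "\<lambda>u. _ * u"] cong: if_cong)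
  have pf: "(\<integral>x. ?p x * cnj (f x) \<partial>SqM) = cnj (\<Sum>k\<in>I. fcoef f k * cnj (c k))"
  proof -
    have "(\<integral>x. ?p x * cnj (f x) \<partial>SqM) = (\<integral>x. cnj (f x * cnj (?p x)) \<partial>SqM)"
      by (intro Bochner_Integration.integral_cong) (auto simp: mult.commute)
    then show ?thesis unfolding ip[OF f, symmetric] by (simp only: Bochner_Integration.integral_cnj)
  qed
  have "complex_of_real (sqnorm SqM (\<lambda>t. f t - ?p t))
      = (\<integral>x. (f x * cnj (f x) - f x * cnj (?p x)) - (?p x * cnj (f x) - ?p x * cnj (?p x)) \<partial>SqM)"
    unfolding sq[OF sqint_diff(1)[OF f p]] by (intro Bochner_Integration.integral_cong) (auto simp: algebra_simps)
  also have "\<dots> = ((\<integral>x. f x * cnj (f x) \<partial>SqM) - (\<integral>x. f x * cnj (?p x) \<partial>SqM)) - ((\<integral>x. ?p x * cnj (f x) \<partial>SqM) - (\<integral>x. ?p x * cnj (?p x) \<partial>SqM))"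
  proof -
    have i: "integrable SqM (\<lambda>x. u x * cnj (v x))" if "sqint SqM u" "sqint SqM v" for u v
      by (intro sqint_mult_integrable sqint_cnj that)
    show ?thesis
      using i[OF f f] i[OF f p] i[OF p f] i[OF p p]
      by (simp only: Bochner_Integration.integral_diff Bochner_Integration.integrable_diff)
  qed
  also have "\<dots> = of_real (sqnorm SqM f) - (\<Sum>k\<in>I. fcoef f k * cnj (c k)) - (cnj (\<Sum>k\<in>I. fcoef f k * cnj (c k)) - (\<Sum>k\<in>I. c k * cnj (c k)))"
    unfolding sq[OF f, symmetric] ip[OF f] pf ip[OF p] pk by simp
  also have "\<dots> = of_real (sqnorm SqM f - (\<Sum>k\<in>I. (cmod (fcoef f k))\<^sup>2) + (\<Sum>k\<in>I. (cmod (fcoef f k - c k))\<^sup>2))"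
  proof -
    have "complex_of_real ((cmod (fcoef f k - c k))\<^sup>2) = of_real ((cmod (fcoef f k))\<^sup>2) - fcoef f k * cnj (c k) - (cnj (fcoef f k * cnj (c k)) - c k * cnj (c k))" for k
      unfolding complex_norm_square by (simp add: algebra_simps)
    then show ?thesis
      by (simp only: of_real_diff of_real_add of_real_sum sum_subtractf cnj_sum) (simp add: algebra_simps)
  qed
  finally show ?thesis using of_real_eq_iff by blast
qed simp

text \<open>In \<open>Parseval_expansion\<close> the choice \<open>c = fcoef f\<close> gives
  Bessel's inequality. Taking for \<open>c\<close> the coefficients of an approximating
  trigonometric polynomial gives the converse, because the term containing \<open>c\<close> is
  nonnegative.\<close>

lemma Parseval:
  assumes f: "sqint SqM f"
  shows "sqint countZ2 (fcoef f)" "sqnorm countZ2 (fcoef f) = sqnorm SqM f"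
proof -
  have Bessel: "(\<Sum>k\<in>I. (cmod (fcoef f k))\<^sup>2) \<le> sqnorm SqM f" for I
    using Parseval_expansion[OF f, where I = I and c = "fcoef f"]
      sqnorm_nonneg[of SqM "\<lambda>t. f t - (\<Sum>k\<in>I. fcoef f k * ebas k t)"] by simp
  show s: "sqint countZ2 (fcoef f)" by (rule sqint_CZ_bounded_sums(1)[OF Bessel])
  have "sqnorm countZ2 (fcoef f) \<le> sqnorm SqM f" by (rule sqint_CZ_bounded_sums(2)[OF Bessel])
  moreover have "sqnorm SqM f \<le> sqnorm countZ2 (fcoef f) + e" if e: "e > 0" for e
  proof -
    obtain p where p: "trig_poly p" "sqnorm SqM (\<lambda>x. f x - p x) < e"
      using trig_approx_sqint[OF f] e unfolding trig_approx_def by blast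
    obtain n c where "\<And>t. p t = (\<Sum>k\<in>idx n. c k * ebas k t)" using trig_poly_Xn[OF p(1)] by (auto simp: Xn_def)
    then have "sqnorm SqM f - (\<Sum>k\<in>idx n. (cmod (fcoef f k))\<^sup>2) + (\<Sum>k\<in>idx n. (cmod (fcoef f k - c k))\<^sup>2) < e"
      using p(2) Parseval_expansion[OF f, where I = "idx n" and c = c] by simp
    moreover have "(\<Sum>k\<in>idx n. (cmod (fcoef f k - c k))\<^sup>2) \<ge> 0" by (intro sum_nonneg) auto
    ultimately show ?thesis using sum_le_sqnorm_CZ[OF s finite_idx[of n]] by linarith
  qed
  ultimately show "sqnorm countZ2 (fcoef f) = sqnorm SqM f" by (meson antisym field_le_epsilon)
qed

text \<open>Valid on any measure: applied once on the square and once to sequences, it transfers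
  Parseval's identity from norms to inner products.\<close>

lemma polarization:
  assumes f: "sqint M f" and g: "sqint M g"
  shows "4 * (\<integral>x. f x * cnj (g x) \<partial>M) = of_real (sqnorm M (\<lambda>x. f x + 1 * g x)) - of_real (sqnorm M (\<lambda>x. f x + (-1) * g x))
     + \<i> * of_real (sqnorm M (\<lambda>x. f x + \<i> * g x)) - \<i> * of_real (sqnorm M (\<lambda>x. f x + (-\<i>) * g x))"
proof -
  have sq: "complex_of_real (sqnorm M (\<lambda>x. f x + c * g x)) = (\<integral>x. (f x + c * g x) * cnj (f x + c * g x) \<partial>M)"
    and i: "integrable M (\<lambda>x. (f x + c * g x) * cnj (f x + c * g x))" for c
  proof -
    have s: "sqint M (\<lambda>x. f x + c * g x)" by (intro sqint_add sqint_cmult f g)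
    show "complex_of_real (sqnorm M (\<lambda>x. f x + c * g x)) = (\<integral>x. (f x + c * g x) * cnj (f x + c * g x) \<partial>M)"
      unfolding sqnorm_def by (subst integral_complex_of_real[symmetric]) (simp only: complex_norm_square)
    show "integrable M (\<lambda>x. (f x + c * g x) * cnj (f x + c * g x))"
      by (intro sqint_mult_integrable sqint_cnj s)
  qed
  have i4: "integrable M (\<lambda>x. a * ((f x + c * g x) * cnj (f x + c * g x)))" for a c
    using i[of c] by simp
  have "4 * (\<integral>x. f x * cnj (g x) \<partial>M) = (\<integral>x. 4 * (f x * cnj (g x)) \<partial>M)" by simp
  also have "\<dots> = (\<integral>x. 1 * ((f x + 1 * g x) * cnj (f x + 1 * g x)) - 1 * ((f x + (-1) * g x) * cnj (f x + (-1) * g x))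
    + \<i> * ((f x + \<i> * g x) * cnj (f x + \<i> * g x)) - \<i> * ((f x + (-\<i>) * g x) * cnj (f x + (-\<i>) * g x)) \<partial>M)"
    by (intro Bochner_Integration.integral_cong) (auto simp: algebra_simps)
  also have "\<dots> = of_real (sqnorm M (\<lambda>x. f x + 1 * g x)) - of_real (sqnorm M (\<lambda>x. f x + (-1) * g x))
     + \<i> * of_real (sqnorm M (\<lambda>x. f x + \<i> * g x)) - \<i> * of_real (sqnorm M (\<lambda>x. f x + (-\<i>) * g x))"
    unfolding sq using i4[of 1 1] i4[of 1 "-1"] i4[of \<i> \<i>] i4[of \<i> "-\<i>"]
    by (simp only: Bochner_Integration.integral_diff Bochner_Integration.integrable_diff
        Bochner_Integration.integral_add Bochner_Integration.integrable_add integral_mult_right_zero mult_1_left)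
  finally show ?thesis .
qed

lemma Parseval_inner:
  assumes f: "sqint SqM f" and g: "sqint SqM g"
  shows "(\<integral>x. f x * cnj (g x) \<partial>SqM) = (\<integral>k. fcoef f k * cnj (fcoef g k) \<partial>countZ2)"
proof -
  have "sqnorm countZ2 (\<lambda>k. fcoef f k + c * fcoef g k) = sqnorm SqM (\<lambda>x. f x + c * g x)" for c
    using Parseval(2)[OF sqint_add(1)[OF f sqint_cmult(1)[OF g, of c]]]
    by (simp add: fcoef_add[OF f sqint_cmult(1)[OF g], abs_def] fcoef_cmult)
  then have "4 * (\<integral>x. f x * cnj (g x) \<partial>SqM) = 4 * (\<integral>k. fcoef f k * cnj (fcoef g k) \<partial>countZ2)"
    unfolding polarization[OF f g] polarization[OF Parseval(1)[OF f] Parseval(1)[OF g]] by (simp only:)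
  then show ?thesis by simp
qed

lemma fcoef_eq_imp_AE:
  assumes "sqint SqM f" "sqint SqM g" "\<And>k. fcoef f k = fcoef g k" shows "AE t in SqM. f t = g t"
proof -
  have d: "sqint SqM (\<lambda>t. f t - g t)" by (intro sqint_diff assms)
  have "fcoef (\<lambda>t. f t - g t) = (\<lambda>k. 0)" using assms by (auto simp: fcoef_diff)
  then have "sqnorm SqM (\<lambda>t. f t - g t) = 0" using Parseval(2)[OF d] by simp
  then show ?thesis using sqnorm_eq_0_iff[OF d] by simp
qed

text \<open>Absolute summability makes the series a bounded function whose coefficients Fubini
  computes. This form suffices because \<open>regularity\<close> with \<open>p = 2\<close> makes the
  relevant square-summable sequences absolutely summable.\<close>

lemma fcoef_synthesis:
  assumes x: "integrable countZ2 x"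
  shows "\<exists>\<phi>. sqint SqM \<phi> \<and> (\<forall>k. fcoef \<phi> k = x k)"
proof -
  define \<phi> where "\<phi> t = (\<integral>k. x k * ebas k t \<partial>countZ2)" for t
  have sCZ: "sigma_finite_measure countZ2" by (rule sigma_finite_measure_count_space)
  interpret P: pair_sigma_finite countZ2 SqM
    by (intro pair_sigma_finite.intro sCZ sigma_finite_SqM)
  have m: "(\<lambda>(k, t). x k * ebas k t) \<in> borel_measurable (countZ2 \<Otimes>\<^sub>M SqM)"
    by (rule measurable_pair_measure_countable1) auto
  have m2: "(\<lambda>(k, t). x k * ebas k t * cnj (ebas l t)) \<in> borel_measurable (countZ2 \<Otimes>\<^sub>M SqM)" for l
    by (rule measurable_pair_measure_countable1) auto
  have \<phi>m: "\<phi> \<in> borel_measurable SqM"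
    unfolding \<phi>_def using m by (intro P.M1.borel_measurable_lebesgue_integral) (subst measurable_pair_swap_iff, simp add: case_prod_beta)
  have \<phi>b: "cmod (\<phi> t) \<le> (\<integral>k. cmod (x k) \<partial>countZ2)" for t
  proof -
    have "cmod (\<phi> t) \<le> (\<integral>k. cmod (x k * ebas k t) \<partial>countZ2)" unfolding \<phi>_def by simp
    also have "\<dots> \<le> (\<integral>k. cmod (x k) \<partial>countZ2)"
    proof (rule integral_mono_AE')
      show "integrable countZ2 (\<lambda>k. cmod (x k))" using x by simp
      have "1 / (2 * pi) \<le> 1" using pi_ge_two by simp
      then have "cmod (x k * ebas k t) \<le> cmod (x k)" for k
        unfolding norm_mult cmod_ebas by (rule mult_left_le) simp
      then show "AE k in countZ2. cmod (x k * ebas k t) \<le> cmod (x k)" by simp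
    qed auto
    finally show ?thesis .
  qed
  have \<phi>s: "sqint SqM \<phi>" by (rule sqint_bounded[OF \<phi>m \<phi>b])
  have "fcoef \<phi> l = x l" for l
  proof -
    have int: "integrable (countZ2 \<Otimes>\<^sub>M SqM) (\<lambda>(k, t). x k * ebas k t * cnj (ebas l t))"
    proof (rule P.Fubini_integrable[OF m2])
      have "(\<lambda>k. \<integral>t. norm (x k * ebas k t * cnj (ebas l t)) \<partial>SqM) = (\<lambda>k. cmod (x k) * (1 / (2*pi) * (1 / (2*pi)) * measure SqM Sq))"
        by (auto simp: norm_mult cmod_ebas)
      then show "integrable countZ2 (\<lambda>k. \<integral>t. norm (case (k, t) of (k, t) \<Rightarrow> x k * ebas k t * cnj (ebas l t)) \<partial>SqM)"
        using x by simp
      show "AE k in countZ2. integrable SqM (\<lambda>t. case (k, t) of (k, t) \<Rightarrow> x k * ebas k t * cnj (ebas l t))"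
        using fcoef_integrable[OF sqint_ebas, of _ l] by (auto simp: mult.assoc)
    qed
    have "fcoef \<phi> l = (\<integral>t. (\<integral>k. x k * ebas k t * cnj (ebas l t) \<partial>countZ2) \<partial>SqM)"
      unfolding fcoef_eq \<phi>_def by simp
    also have "\<dots> = (\<integral>k. (\<integral>t. x k * ebas k t * cnj (ebas l t) \<partial>SqM) \<partial>countZ2)"
      using P.Fubini_integral[OF int] by simp
    also have "\<dots> = (\<integral>k. x k * fcoef (ebas k) l \<partial>countZ2)"
      unfolding fcoef_eq by (simp add: mult.assoc)
    also have "\<dots> = (\<integral>k. indicator {l} k *\<^sub>R x l \<partial>countZ2)"
      by (intro Bochner_Integration.integral_cong) (auto simp: ebas_orthonormal indicator_def)
    also have "\<dots> = x l" by (subst integral_scaleR_left) (auto simp: integrable_indicator_iff measure_count_space)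
    finally show ?thesis .
  qed
  then show ?thesis using \<phi>s by blast
qed

section \<open>Separately holomorphic functions of two variables\<close>

lemma holo2_onD:
  assumes "holo2_on U F"
  shows "open U" "continuous_on U F"
    "\<And>z w. (z, w) \<in> U \<Longrightarrow> (\<lambda>v. F (v, w)) field_differentiable at z"
    "\<And>z w. (z, w) \<in> U \<Longrightarrow> (\<lambda>v. F (z, v)) field_differentiable at w"
  using assms by (auto simp: holo2_on_def)

lemma holo2_on_subset: "holo2_on U F \<Longrightarrow> open V \<Longrightarrow> V \<subseteq> U \<Longrightarrow> holo2_on V F"
  unfolding holo2_on_def by (auto intro: continuous_on_subset)

text \<open>Cauchy's formula writes the derivative as an integral of \<open>F\<close> itself, so its
  dependence on \<open>z\<close> and \<open>w\<close> is accessible to theorems on parameter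
  integrals.\<close>

lemma pd0_integral:
  assumes h: "holo2_on U F" and sub: "cball z r \<times> {w} \<subseteq> U" and r: "r > 0"
  shows "pd0 F (z, w) = integral {0..1} (\<lambda>t. F (z + r * exp (2 * of_real pi * \<i> * of_real t), w) / (r * exp (2 * of_real pi * \<i> * of_real t)))"
proof -
  have sl: "(v, w) \<in> U" if "v \<in> cball z r" for v using that sub by auto
  have c: "continuous_on (cball z r) (\<lambda>v. F (v, w))"
    by (intro continuous_on_compose2[OF holo2_onD(2)[OF h]] continuous_intros) (use sub in auto)
  have hol: "(\<lambda>v. F (v, w)) holomorphic_on ball z r"
    unfolding holomorphic_on_def
    using holo2_onD(3)[OF h sl] by (auto intro: field_differentiable_at_within)
  let ?e = "\<lambda>t::real. exp (2 * of_real pi * \<i> * of_real t)"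
  have "((\<lambda>v. F (v, w)) has_field_derivative (1 / (2 * of_real pi * \<i>) * contour_integral (circlepath z r) (\<lambda>u. F (u, w) / (u-z)^2))) (at z)"
    by (rule Cauchy_derivative_integral_circlepath(2)[OF c hol]) (use r in auto)
  then have "pd0 F (z, w) = 1 / (2 * of_real pi * \<i>) * contour_integral (circlepath z r) (\<lambda>u. F (u, w) / (u-z)^2)"
    by (simp add: pd0_def DERIV_imp_deriv)
  also have "\<dots> = integral {0..1} (\<lambda>t. 1 / (2 * of_real pi * \<i>) * (F (z + r * ?e t, w) / (r * ?e t)^2 * (2 * pi * \<i> * r * ?e t)))"
    unfolding contour_integral_integral vector_derivative_circlepath
    by (simp only: circlepath add_diff_cancel_left' integral_mult_right)
  also have "\<dots> = integral {0..1} (\<lambda>t. F (z + r * ?e t, w) / (r * ?e t))"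
    using r by (intro integral_cong) (simp add: power2_eq_square)
  finally show ?thesis .
qed

lemma open_prod_cball:
  fixes a c :: complex
  assumes "open U" "(a, c) \<in> U"
  obtains r where "r > 0" "cball a (2 * r) \<times> cball c (2 * r) \<subseteq> U"
proof -
  obtain A B where AB: "open A" "open B" "a \<in> A" "c \<in> B" "A \<times> B \<subseteq> U"
    using assms open_prod_elim by (metis mem_Sigma_iff)
  obtain r s where "r > 0" "cball a r \<subseteq> A" "s > 0" "cball c s \<subseteq> B"
    using AB open_contains_cball by metis
  then show ?thesis
    using AB(5) by (intro that[of "min r s / 2"]) (auto simp: subset_iff)
qed

text \<open>One radius serves all centres in \<open>ball a r\<close>, since the circles stay in
  \<open>cball a (2 * r)\<close>; parameter integrals require this uniformity.\<close>

lemma pd0_local: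
  assumes h: "holo2_on U F" and sub: "cball a (2 * r) \<times> cball c (2 * r) \<subseteq> U" and r: "r > 0"
    and z: "z \<in> ball a r" and w: "w \<in> cball c (2 * r)"
  shows "pd0 F (z, w) = integral {0..1} (\<lambda>t. F (z + r * exp (2 * of_real pi * \<i> * of_real t), w) / (r * exp (2 * of_real pi * \<i> * of_real t)))"
proof (rule pd0_integral[OF h _ r])
  have "cball z r \<subseteq> cball a (2 * r)"
    using z by (auto simp: subset_iff) (smt (verit) dist_triangle)
  then show "cball z r \<times> {w} \<subseteq> U" using sub w by auto
qed

lemma circle_in_cball:
  assumes "z \<in> ball a r" shows "z + complex_of_real r * exp (2 * of_real pi * \<i> * of_real t) \<in> cball a (2 * r)"
proof -
  have r: "r > 0" using assms by (smt (verit) mem_ball zero_le_dist)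
  have "dist a (z + complex_of_real r * exp (2 * of_real pi * \<i> * of_real t)) \<le> dist a z + norm (complex_of_real r * exp (2 * of_real pi * \<i> * of_real t))"
    by (metis add_diff_cancel_left' dist_norm dist_triangle norm_minus_commute)
  also have "\<dots> \<le> r + r" using assms r by (simp add: norm_mult)
  finally show ?thesis by simp
qed

lemma pd0_continuous:
  assumes h: "holo2_on U F" shows "continuous_on U (pd0 F)"
proof -
  have "isCont (pd0 F) p" if p: "p \<in> U" for p
  proof -
    obtain a c where ac: "p = (a, c)" by (cases p)
    obtain r where r: "r > 0" "cball a (2 * r) \<times> cball c (2 * r) \<subseteq> U"
      using open_prod_cball holo2_onD(1)[OF h] p ac by metis
    let ?e = "\<lambda>t::real. exp (2 * of_real pi * \<i> * of_real t)"
    let ?V = "ball a r \<times> ball c r"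
    let ?f = "\<lambda>p t. F (fst p + r * ?e t, snd p) / (r * ?e t)"
    have "continuous_on (?V \<times> cbox 0 1) (\<lambda>(p, t). ?f p t)"
      unfolding case_prod_beta
    proof (intro continuous_intros continuous_on_compose2[OF holo2_onD(2)[OF h]])
      show "(\<lambda>x. (fst (fst x) + r * ?e (snd x), snd (fst x))) ` (?V \<times> cbox 0 1) \<subseteq> U"
      proof
        fix y assume "y \<in> (\<lambda>x. (fst (fst x) + r * ?e (snd x), snd (fst x))) ` (?V \<times> cbox 0 1)"
        then obtain z w t where "y = (z + r * ?e t, w)" "z \<in> ball a r" "w \<in> ball c r" by force
        then show "y \<in> U" using circle_in_cball[of z a r t] r by auto
      qed
    qed (use r(1) in auto)
    then have "continuous_on ?V (\<lambda>p. integral (cbox 0 1) (?f p))" by (rule integral_continuous_on_param)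
    moreover have "pd0 F q = integral (cbox 0 1) (?f q)" if "q \<in> ?V" for q
      using pd0_local[OF h r(2) r(1), of "fst q" "snd q"] that r(1) by (cases q) auto
    ultimately have "continuous_on ?V (pd0 F)" by (metis (no_types, lifting) continuous_on_cong)
    then show ?thesis
      using r(1) ac by (subst (asm) continuous_on_eq_continuous_at) (auto intro: open_Times)
  qed
  then show ?thesis using continuous_at_imp_continuous_on by blast
qed

text \<open>Exchanging the variables lets facts about \<open>pd1\<close> follow from those about
  \<open>pd0\<close>.\<close>

lemma holo2_swap:
  assumes "holo2_on U F" shows "holo2_on (prod.swap -` U) (\<lambda>z. F (prod.swap z))"
proof -
  have c: "continuous_on S (prod.swap :: complex \<times> complex \<Rightarrow> _)" for S
    unfolding prod.swap_def[abs_def] by (intro continuous_intros)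
  have "open (prod.swap -` U)"
    using continuous_open_vimage[OF holo2_onD(1)[OF assms]] c continuous_on_eq_continuous_at open_UNIV by blast
  moreover have "continuous_on (prod.swap -` U) (\<lambda>z. F (prod.swap z))"
    by (rule continuous_on_compose2[OF holo2_onD(2)[OF assms] c]) auto
  ultimately show ?thesis
    using holo2_onD(3,4)[OF assms] unfolding holo2_on_def by auto
qed

lemma pd1_swap: "pd1 F z = pd0 (\<lambda>z. F (prod.swap z)) (prod.swap z)"
  "pd0 F z = pd1 (\<lambda>z. F (prod.swap z)) (prod.swap z)"
  by (simp_all add: pd0_def pd1_def)

lemma pd1_continuous:
  assumes h: "holo2_on U F" shows "continuous_on U (pd1 F)"
  unfolding pd1_swap(1)[abs_def]
  by (rule continuous_on_compose2[OF pd0_continuous[OF holo2_swap[OF h]]])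
    (auto simp: prod.swap_def[abs_def] intro!: continuous_intros)

lemma has_field_derivative_pd:
  assumes h: "holo2_on U F" and "(z, w) \<in> U"
  shows "((\<lambda>v. F (v, w)) has_field_derivative pd0 F (z, w)) (at z)"
    "((\<lambda>v. F (z, v)) has_field_derivative pd1 F (z, w)) (at w)"
  using holo2_onD(3,4)[OF h assms(2)] by (simp_all add: pd0_def pd1_def field_differentiable_derivI)

text \<open>In the first variable, the derivative of a holomorphic function of one variable is
  holomorphic; in the second, one differentiates under the Cauchy integral.\<close>

lemma holo2_pd0:
  assumes h: "holo2_on U F" shows "holo2_on U (pd0 F)"
  unfolding holo2_on_def
proof (intro conjI ballI)
  show "open U" "continuous_on U (pd0 F)" using holo2_onD(1)[OF h] pd0_continuous[OF h] by auto
  fix p assume p: "p \<in> U"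
  obtain a c where ac: "p = (a, c)" by (cases p)
  obtain r where r: "r > 0" "cball a (2 * r) \<times> cball c (2 * r) \<subseteq> U"
    using open_prod_cball holo2_onD(1)[OF h] p ac by metis
  have "(\<lambda>v. F (v, c)) holomorphic_on ball a r"
    unfolding holomorphic_on_def using r
    by (auto intro!: field_differentiable_at_within holo2_onD(3)[OF h])
  from holomorphic_deriv[OF this] have "deriv (\<lambda>v. F (v, c)) holomorphic_on ball a r" by simp
  then have "deriv (\<lambda>v. F (v, c)) field_differentiable at a"
    using r(1) by (simp add: holomorphic_on_imp_differentiable_at)
  then show "(\<lambda>w. pd0 F (w, snd p)) field_differentiable at (fst p)"
    by (simp add: pd0_def ac)
  let ?e = "\<lambda>t::real. exp (2 * of_real pi * \<i> * of_real t)"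
  have U: "(a + r * ?e t, w) \<in> U" if "w \<in> ball c r" for w t
  proof -
    have "a \<in> ball a r" using r(1) by simp
    from circle_in_cball[OF this, of t] show ?thesis using that r by auto
  qed
  have hol: "(\<lambda>w. integral (cbox 0 1) (\<lambda>t. F (a + r * ?e t, w) / (r * ?e t))) holomorphic_on ball c r"
  proof (rule leibniz_rule_holomorphic)
    show "((\<lambda>w. F (a + r * ?e t, w) / (r * ?e t)) has_field_derivative pd1 F (a + r * ?e t, w) / (r * ?e t)) (at w within ball c r)"
      if "w \<in> ball c r" for w t
      by (rule has_field_derivative_at_within, rule DERIV_cdivide, rule has_field_derivative_pd(2)[OF h U[OF that]])
    show "(\<lambda>t. F (a + r * ?e t, w) / (r * ?e t)) integrable_on cbox 0 1" if "w \<in> ball c r" for w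
      using r(1) U[OF that]
      by (intro integrable_continuous continuous_intros continuous_on_compose2[OF holo2_onD(2)[OF h]]) auto
    show "continuous_on (ball c r \<times> cbox 0 1) (\<lambda>(w, t). pd1 F (a + r * ?e t, w) / (r * ?e t))"
      unfolding case_prod_beta using r(1) U
      by (intro continuous_intros continuous_on_compose2[OF pd1_continuous[OF h]]) auto
  qed auto
  have eq: "integral (cbox 0 1) (\<lambda>t. F (a + r * ?e t, w) / (r * ?e t)) = pd0 F (a, w)" if "w \<in> ball c r" for w
    using pd0_local[OF h r(2) r(1), of a w] that r(1) by auto
  have "(\<lambda>w. pd0 F (a, w)) holomorphic_on ball c r"
    by (rule holomorphic_transform[OF hol eq])
  then show "(\<lambda>w. pd0 F (fst p, w)) field_differentiable at (snd p)"
    using r(1) ac by (simp add: holomorphic_on_imp_differentiable_at)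
qed

lemma holo2_pd1:
  assumes h: "holo2_on U F" shows "holo2_on U (pd1 F)"
proof -
  have "pd1 F = (\<lambda>z. pd0 (\<lambda>z. F (prod.swap z)) (prod.swap z))" by (simp add: pd1_swap(1)[abs_def])
  moreover have "prod.swap -` prod.swap -` U = U" by auto
  ultimately show ?thesis using holo2_swap[OF holo2_pd0[OF holo2_swap[OF h]]] by simp
qed

text \<open>Continuity of one partial derivative upgrades separate differentiability to total
  differentiability, which yields the chain rule along segments.\<close>

lemma holo2_has_derivative:
  assumes h: "holo2_on U F" and p: "p \<in> U"
  shows "(F has_derivative (\<lambda>v. pd0 F p * fst v + pd1 F p * snd v)) (at p)"
proof -
  obtain a c where ac: "p = (a, c)" by (cases p)
  obtain r where r: "r > 0" "cball a (2 * r) \<times> cball c (2 * r) \<subseteq> U"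
    using open_prod_cball holo2_onD(1)[OF h] p ac by metis
  let ?X = "ball a r" and ?Y = "ball c r"
  have XY: "?X \<times> ?Y \<subseteq> U" using r by auto
  have "((\<lambda>(x, y). F (x, y)) has_derivative (\<lambda>(tx, ty). pd0 F (a, c) * tx + blinfun_apply (blinfun_mult_right (pd1 F (a, c))) ty)) (at (a, c) within ?X \<times> ?Y)"
  proof (rule has_derivative_partialsI)
    show "((\<lambda>x. F (x, c)) has_derivative (*) (pd0 F (a, c))) (at a within ?X)"
    proof (rule has_derivative_at_withinI)
      show "((\<lambda>x. F (x, c)) has_derivative (*) (pd0 F (a, c))) (at a)"
        using has_field_derivative_pd(1)[OF h, of a c] p ac by (simp add: has_field_derivative_def)
    qed
    show "((\<lambda>y. F (x, y)) has_derivative blinfun_apply (blinfun_mult_right (pd1 F (x, y)))) (at y within ?Y)"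
      if "x \<in> ?X" "y \<in> ?Y" for x y
    proof (rule has_derivative_at_withinI)
      show "((\<lambda>y. F (x, y)) has_derivative blinfun_apply (blinfun_mult_right (pd1 F (x, y)))) (at y)"
      proof -
        have "(x, y) \<in> U" using that XY by blast
        then show ?thesis using has_field_derivative_pd(2)[OF h, of x y]
          by (simp add: has_field_derivative_def blinfun_mult_right.rep_eq)
      qed
    qed
    have "continuous_on (?X \<times> ?Y) (\<lambda>(x, y). blinfun_mult_right (pd1 F (x, y)))"
      unfolding case_prod_beta using XY
      by (intro bounded_linear.continuous_on[OF bounded_linear_blinfun_mult_right] continuous_on_compose2[OF pd1_continuous[OF h]] continuous_intros) auto
    then show "continuous (at (a, c) within ?X \<times> ?Y) (\<lambda>(x, y). blinfun_mult_right (pd1 F (x, y)))"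
      using r(1) unfolding continuous_on_eq_continuous_within by auto
  qed (use r in auto)
  moreover have "at (a, c) within ?X \<times> ?Y = at (a, c)"
    using r(1) by (intro at_within_open) (auto intro: open_Times)
  ultimately show ?thesis by (simp add: ac case_prod_unfold blinfun_mult_right.rep_eq)
qed

lemma holo2_line_derivative:
  assumes h: "holo2_on U F" and p: "p + of_real t *\<^sub>R v \<in> U"
  shows "((\<lambda>t. F (p + t *\<^sub>R v)) has_vector_derivative (pd0 F (p + t *\<^sub>R v) * fst v + pd1 F (p + t *\<^sub>R v) * snd v)) (at t)"
proof -
  have "((\<lambda>t. p + t *\<^sub>R v) has_derivative (\<lambda>s. s *\<^sub>R v)) (at t)" by (auto intro!: derivative_eq_intros)
  from has_derivative_compose[OF this holo2_has_derivative[OF h]] p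
  have "((\<lambda>t. F (p + t *\<^sub>R v)) has_derivative (\<lambda>s. pd0 F (p + t *\<^sub>R v) * fst (s *\<^sub>R v) + pd1 F (p + t *\<^sub>R v) * snd (s *\<^sub>R v))) (at t)"
    by simp
  then show ?thesis by (simp add: has_vector_derivative_def scaleR_conv_of_real algebra_simps)
qed

lemma norm_diff_le_vector_derivative:
  fixes u :: "real \<Rightarrow> complex"
  assumes "\<And>t. t \<in> {0..1} \<Longrightarrow> (u has_vector_derivative u' t) (at t)" "\<And>t. t \<in> {0..1} \<Longrightarrow> norm (u' t) \<le> B"
  shows "norm (u 1 - u 0) \<le> B"
proof -
  have "(u' has_integral (u 1 - u 0)) {0..1}"
  proof (rule fundamental_theorem_of_calculus)
    show "(u has_vector_derivative u' t) (at t within {0..1})" if "t \<in> {0..1}" for t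
      by (rule has_vector_derivative_at_within[OF assms(1)[OF that]])
  qed simp
  moreover have "B \<ge> 0" using order_trans[OF norm_ge_zero assms(2)[of 0]] by simp
  ultimately have "norm (u 1 - u 0) \<le> B * measure lborel (cbox 0 (1::real))"
    using assms(2) by (intro has_integral_bound[where f = u']) auto
  then show ?thesis by simp
qed

lemma cnorm2_eq: "cnorm2 a b = norm (a, b)"
  by (simp add: cnorm2_def norm_Pair)

lemma cmod_bilinear_le: "cmod (a * u + b * v) \<le> cnorm2 a b * cnorm2 u v"
proof -
  have "cmod (a * u + b * v) \<le> cmod a * cmod u + cmod b * cmod v"
    using norm_triangle_ineq[of "a * u" "b * v"] by (simp add: norm_mult)
  also have "\<dots> = inner (cmod a, cmod b) (cmod u, cmod v)" by simp
  also have "\<dots> \<le> norm (cmod a, cmod b) * norm (cmod u, cmod v)" by (rule norm_cauchy_schwarz)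
  finally show ?thesis by (simp add: cnorm2_eq norm_Pair)
qed

lemma cmat_norm_bdd: "bdd_above ((\<lambda>v. cnorm2 (a * fst v + b * snd v) (c * fst v + d * snd v)) ` {v. cnorm2 (fst v) (snd v) = 1})"
  and cmat_norm_le: "cmat_norm a b c d \<le> cnorm2 a b + cnorm2 c d"
proof -
  have le: "cnorm2 (a * fst v + b * snd v) (c * fst v + d * snd v) \<le> cnorm2 a b + cnorm2 c d"
    if "cnorm2 (fst v) (snd v) = 1" for v
  proof -
    have "cnorm2 (a * fst v + b * snd v) (c * fst v + d * snd v) \<le> cmod (a * fst v + b * snd v) + cmod (c * fst v + d * snd v)"
      unfolding cnorm2_def by (rule sqrt_sum_squares_le_sum) auto
    also have "\<dots> \<le> cnorm2 a b + cnorm2 c d"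
      using cmod_bilinear_le[of a "fst v" b "snd v"] cmod_bilinear_le[of c "fst v" d "snd v"] that by simp
    finally show ?thesis .
  qed
  show "bdd_above ((\<lambda>v. cnorm2 (a * fst v + b * snd v) (c * fst v + d * snd v)) ` {v. cnorm2 (fst v) (snd v) = 1})"
    using le by (intro bdd_aboveI2) auto
  have "(1, 0) \<in> {v. cnorm2 (fst v) (snd v) = 1}" by (simp add: cnorm2_def)
  then show "cmat_norm a b c d \<le> cnorm2 a b + cnorm2 c d"
    unfolding cmat_norm_def using le by (intro cSup_least) auto
qed

text \<open>Homogeneity reduces the claim to unit vectors, where \<open>cmat_norm_bdd\<close>
  guarantees that the supremum bounds each element.\<close>

lemma cmat_norm_bound: "cnorm2 (a * u + b * v) (c * u + d * v) \<le> cmat_norm a b c d * cnorm2 u v"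
proof (cases "cnorm2 u v = 0")
  case True
  then have "u = 0" "v = 0" by (auto simp: cnorm2_eq zero_prod_def)
  then show ?thesis by (simp add: cnorm2_def)
next
  case False
  define n where "n = cnorm2 u v"
  have n: "n > 0" using False by (simp add: n_def cnorm2_eq)
  have hom: "cnorm2 (x / of_real n) (y / of_real n) = cnorm2 x y / n" for x y
    using n by (simp add: cnorm2_def norm_divide power_divide add_divide_distrib[symmetric] real_sqrt_divide)
  have 1: "cnorm2 (u / of_real n) (v / of_real n) = 1"
    unfolding hom using n by (simp add: n_def)
  have "cnorm2 (a * fst (u / of_real n, v / of_real n) + b * snd (u / of_real n, v / of_real n)) (c * fst (u / of_real n, v / of_real n) + d * snd (u / of_real n, v / of_real n)) \<le> cmat_norm a b c d"
    unfolding cmat_norm_def by (rule cSUP_upper[OF _ cmat_norm_bdd]) (use 1 in simp)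
  moreover have "cnorm2 (a * (u / of_real n) + b * (v / of_real n)) (c * (u / of_real n) + d * (v / of_real n)) = cnorm2 (a * u + b * v) (c * u + d * v) / n"
    using hom[of "a * u + b * v" "c * u + d * v"] by (simp add: add_divide_distrib)
  ultimately have "cnorm2 (a * u + b * v) (c * u + d * v) / n \<le> cmat_norm a b c d" by simp
  then show ?thesis using n by (simp add: n_def divide_le_eq)
qed

section \<open>Periodic functions on a product of strips\<close>

lemma open_strip: "open (strip R)"
proof -
  have "strip R = Im -` {-R<..<R}" by (auto simp: strip_def abs_less_iff)
  then show ?thesis by (simp add: continuous_open_vimage continuous_Im)
qed

lemma convex_strip: "convex (strip R)"
proof -
  have "strip R = {z. Im z < R} \<inter> {z. Im z > - R}" by (auto simp: strip_def abs_less_iff)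
  then show ?thesis by (simp add: convex_Int convex_halfspace_Im_lt convex_halfspace_Im_gt)
qed

text \<open>Identity theorem: the real axis accumulates at 0 inside the connected strip.\<close>

lemma holomorphic_strip_zero:
  assumes "g holomorphic_on strip R" "R > 0" "\<And>x. g (of_real x) = 0" "z \<in> strip R"
  shows "g z = 0"
proof (rule analytic_continuation[OF assms(1) open_strip convex_connected[OF convex_strip], of \<real> 0])
  show "0 islimpt (\<real> :: complex set)"
    unfolding islimpt_approachable
  proof (intro allI impI)
    fix e :: real assume "e > 0"
    then show "\<exists>x'\<in>\<real>. x' \<noteq> (0::complex) \<and> dist x' 0 < e"
      by (intro bexI[of _ "complex_of_real (e/2)"]) (auto simp: dist_norm)
  qed
qed (use assms in \<open>auto simp: strip_def elim!: Reals_cases\<close>)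

text \<open>The neighbourhood \<open>U\<close> of the closed strips matters: continuity up to the
  boundary and periodicity give boundedness of all derivatives on the open strips, hence finite
  suprema in \<open>M0j\<close> and \<open>M1j\<close>. Periodicity is assumed at real points, where
  it is inherited from \<open>Gamma\<close>.\<close>

locale strip_fn =
  fixes f :: "complex \<times> complex \<Rightarrow> complex" and U :: "(complex \<times> complex) set" and R :: real
  assumes R_pos: "R > 0" and sub: "cstrip R \<times> cstrip R \<subseteq> U" and holo: "holo2_on U f"
    and per_real: "\<And>x y. f (of_real (x + 2 * pi), of_real y) = f (of_real x, of_real y)"
      "\<And>x y. f (of_real x, of_real (y + 2 * pi)) = f (of_real x, of_real y)"
begin

abbreviation "W \<equiv> strip R \<times> strip R"

lemma open_W: "open W"
  by (intro open_Times open_strip)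

lemma W_sub: "W \<subseteq> U"
  using sub by (auto simp: strip_def cstrip_def)

lemma holoW: "holo2_on W f"
  by (rule holo2_on_subset[OF holo open_W W_sub])

lemma shift_W: "p \<in> W \<Longrightarrow> p + (of_real a, of_real b) \<in> W" "p \<in> W \<Longrightarrow> p - (of_real a, of_real b) \<in> W"
  by (auto simp: strip_def)

definition strip_per :: "(complex \<times> complex \<Rightarrow> complex) \<Rightarrow> bool" where
  "strip_per h \<longleftrightarrow> (\<forall>p\<in>W. h (p + (of_real (2*pi), 0)) = h p \<and> h (p + (0, of_real (2*pi))) = h p)"

text \<open>The identity theorem is applied one variable at a time: periodicity passes from real
  points to one complex and one real argument, and from there to two complex arguments.\<close>

lemma strip_per_f: "strip_per f"
proof -
  have h0: "(\<lambda>v. f (v + of_real a, w)) holomorphic_on strip R" if "w \<in> strip R" for a w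
    unfolding holomorphic_on_def
  proof
    fix v assume "v \<in> strip R"
    then have "(v + of_real a, w) \<in> W" using that by (simp add: strip_def)
    from has_field_derivative_pd(1)[OF holoW this]
    have "((\<lambda>v. f (v + of_real a, w)) has_field_derivative pd0 f (v + of_real a, w)) (at v)"
      by (simp add: DERIV_shift)
    then show "(\<lambda>v. f (v + of_real a, w)) field_differentiable at v within strip R"
      using field_differentiable_at_within field_differentiable_def by blast
  qed
  have h1: "(\<lambda>v. f (w, v + of_real a)) holomorphic_on strip R" if "w \<in> strip R" for a w
    unfolding holomorphic_on_def
  proof
    fix v assume "v \<in> strip R"
    then have "(w, v + of_real a) \<in> W" using that by (simp add: strip_def)
    from has_field_derivative_pd(2)[OF holoW this]
    have "((\<lambda>v. f (w, v + of_real a)) has_field_derivative pd1 f (w, v + of_real a)) (at v)"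
      by (simp add: DERIV_shift)
    then show "(\<lambda>v. f (w, v + of_real a)) field_differentiable at v within strip R"
      using field_differentiable_at_within field_differentiable_def by blast
  qed
  have real: "of_real x \<in> strip R" for x using R_pos by (simp add: strip_def)
  have A: "f (z + of_real (2*pi), of_real y) - f (z, of_real y) = 0" if "z \<in> strip R" for z y
    by (rule holomorphic_strip_zero[OF _ R_pos _ that]) (use h0[OF real[of y], of "2*pi"] h0[OF real[of y], of 0] per_real(1)[of _ y] in \<open>auto intro!: holomorphic_intros\<close>)
  have B: "f (z + of_real (2*pi), w) - f (z, w) = 0" if "z \<in> strip R" "w \<in> strip R" for z w
  proof (rule holomorphic_strip_zero[OF _ R_pos _ that(2)])
    have "z + of_real (2*pi) \<in> strip R" using that by (simp add: strip_def)
    from h1[OF this, of 0] h1[OF that(1), of 0]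
    show "(\<lambda>w. f (z + of_real (2*pi), w) - f (z, w)) holomorphic_on strip R" by (auto intro!: holomorphic_intros)
  qed (use A[OF that(1)] in auto)
  have A': "f (of_real x, w + of_real (2*pi)) - f (of_real x, w) = 0" if "w \<in> strip R" for x w
    by (rule holomorphic_strip_zero[OF _ R_pos _ that]) (use h1[OF real[of x], of "2*pi"] h1[OF real[of x], of 0] per_real(2)[of x] in \<open>auto intro!: holomorphic_intros\<close>)
  have B': "f (z, w + of_real (2*pi)) - f (z, w) = 0" if "z \<in> strip R" "w \<in> strip R" for z w
  proof (rule holomorphic_strip_zero[OF _ R_pos _ that(1)])
    have "w + of_real (2*pi) \<in> strip R" using that by (simp add: strip_def)
    from h0[OF this, of 0] h0[OF that(2), of 0]
    show "(\<lambda>z. f (z, w + of_real (2*pi)) - f (z, w)) holomorphic_on strip R" by (auto intro!: holomorphic_intros)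
  qed (use A'[OF that(2)] in auto)
  show ?thesis unfolding strip_per_def using B B' by auto
qed

lemma pd_translate:
  assumes h: "holo2_on W h" and eq: "\<And>p. p \<in> W \<Longrightarrow> h (p + (of_real a, of_real b)) = h p" and p: "p \<in> W"
  shows "pd0 h (p + (of_real a, of_real b)) = pd0 h p" "pd1 h (p + (of_real a, of_real b)) = pd1 h p"
proof -
  obtain z w where zw: "p = (z, w)" by (cases p)
  have zs: "z \<in> strip R" "w \<in> strip R" using p zw by auto
  note q = shift_W(1)[OF p, of a b, unfolded zw add_Pair]
  have "((\<lambda>v. h (v + of_real a, w + of_real b)) has_field_derivative pd0 h (z + of_real a, w + of_real b)) (at z)"
    using has_field_derivative_pd(1)[OF h q] by (simp add: DERIV_shift)
  then have "((\<lambda>v. h (v, w)) has_field_derivative pd0 h (z + of_real a, w + of_real b)) (at z)"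
    by (rule has_field_derivative_transform_within_open[OF _ open_strip zs(1)])
      (use eq[of "(_, w)"] zs in auto)
  then show "pd0 h (p + (of_real a, of_real b)) = pd0 h p"
    using DERIV_unique[OF _ has_field_derivative_pd(1)[OF h, of z w]] p zw by auto
  have "((\<lambda>v. h (z + of_real a, v + of_real b)) has_field_derivative pd1 h (z + of_real a, w + of_real b)) (at w)"
    using has_field_derivative_pd(2)[OF h q] by (simp add: DERIV_shift)
  then have "((\<lambda>v. h (z, v)) has_field_derivative pd1 h (z + of_real a, w + of_real b)) (at w)"
    by (rule has_field_derivative_transform_within_open[OF _ open_strip zs(2)])
      (use eq[of "(z, _)"] zs in auto)
  then show "pd1 h (p + (of_real a, of_real b)) = pd1 h p"
    using DERIV_unique[OF _ has_field_derivative_pd(2)[OF h, of z w]] p zw by auto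
qed

lemma strip_per_pd:
  assumes h: "holo2_on W h" and "strip_per h" shows "strip_per (pd0 h)" "strip_per (pd1 h)"
proof -
  have 1: "\<And>p. p \<in> W \<Longrightarrow> h (p + (of_real (2*pi), of_real 0)) = h p"
    and 2: "\<And>p. p \<in> W \<Longrightarrow> h (p + (of_real 0, of_real (2*pi))) = h p"
    using assms(2) by (auto simp: strip_per_def)
  show "strip_per (pd0 h)" "strip_per (pd1 h)" unfolding strip_per_def
    using pd_translate[OF h 1] pd_translate[OF h 2] by auto
qed

lemma strip_per_nat:
  assumes "strip_per h" "p \<in> W"
  shows "h (p + (of_real (2*pi*real m), of_real (2*pi*real n))) = h p"
proof -
  have a: "h (p + (of_real (2*pi*real m), of_real b)) = h (p + (0, of_real b))" for b
  proof (induction m)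
    case (Suc m)
    have "p + (of_real (2*pi*real m), of_real b) \<in> W" using shift_W(1)[OF assms(2)] .
    from assms(1)[unfolded strip_per_def, rule_format, OF this] Suc show ?case
      by (simp add: algebra_simps plus_prod_def)
  qed (simp add: zero_prod_def)
  have b: "h (p + (0, of_real (2*pi*real n))) = h p"
  proof (induction n)
    case (Suc n)
    have "p + (0, of_real (2*pi*real n)) \<in> W" using shift_W(1)[OF assms(2), of 0 "2*pi*real n"] by simp
    from assms(1)[unfolded strip_per_def, rule_format, OF this] Suc show ?case
      by (simp add: algebra_simps plus_prod_def)
  qed (simp flip: zero_prod_def)
  show ?thesis using a[of "2*pi*real n"] b by simp
qed

lemma strip_per_int:
  assumes h: "strip_per h" and p: "p \<in> W"
  shows "h (p + (of_real (2*pi* of_int m), of_real (2*pi* of_int n))) = h p"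
proof -
  define M N where "M = nat (- m)" and "N = nat (- n)"
  define M' N' where "M' = nat m" and "N' = nat n"
  have mn: "real_of_int m + real M = real M'" "real_of_int n + real N = real N'"
    by (auto simp: M_def N_def M'_def N'_def)
  let ?q = "p + (of_real (2*pi* of_int m), of_real (2*pi* of_int n))"
  have q: "?q \<in> W" using shift_W(1)[OF p] .
  have "?q + (of_real (2*pi*real M), of_real (2*pi*real N)) = p + (of_real (2*pi*real M'), of_real (2*pi*real N'))"
    unfolding mn[symmetric] by (simp add: algebra_simps plus_prod_def)
  then show ?thesis using strip_per_nat[OF h q, of M N] strip_per_nat[OF h p, of M' N'] by metis
qed

text \<open>Translation by periods moves every point of the strips into a fixed compact subset of
  \<open>U\<close>.\<close>

lemma strip_per_bounded:
  assumes h: "continuous_on U h" and per: "strip_per h"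
  obtains B where "\<And>p. p \<in> W \<Longrightarrow> cmod (h p) \<le> B"
proof -
  let ?C = "cbox (Complex 0 (-R)) (Complex (2*pi) R)"
  have "?C \<times> ?C \<subseteq> U" using sub by (auto simp: in_cbox_complex_iff cstrip_def abs_le_iff subset_iff)
  then have "compact (h ` (?C \<times> ?C))"
    by (intro compact_continuous_image compact_Times compact_cbox continuous_on_subset[OF h])
  then obtain B where B: "\<And>p. p \<in> ?C \<times> ?C \<Longrightarrow> cmod (h p) \<le> B"
    using compact_imp_bounded bounded_iff by (metis image_eqI)
  have "cmod (h p) \<le> B" if p: "p \<in> W" for p
  proof -
    obtain z w where zw: "p = (z, w)" by (cases p)
    define m n where "m = - \<lfloor>Re z / (2*pi)\<rfloor>" and "n = - \<lfloor>Re w / (2*pi)\<rfloor>"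
    have red: "0 \<le> x + 2*pi* of_int (- \<lfloor>x / (2*pi)\<rfloor>) \<and> x + 2*pi* of_int (- \<lfloor>x / (2*pi)\<rfloor>) \<le> 2*pi" for x
    proof -
      define k where "k = \<lfloor>x / (2*pi)\<rfloor>"
      have "of_int k \<le> x / (2*pi)" "x / (2*pi) < of_int k + 1" unfolding k_def by linarith+
      then have "of_int k * (2*pi) \<le> x" "x < (of_int k + 1) * (2*pi)"
        by (simp_all add: pos_le_divide_eq pos_divide_less_eq)
      then show ?thesis unfolding k_def[symmetric] by (simp add: algebra_simps)
    qed
    have "p + (of_real (2*pi* of_int m), of_real (2*pi* of_int n)) \<in> ?C \<times> ?C"
      using p red[of "Re z"] red[of "Re w"]
      by (auto simp: zw m_def n_def in_cbox_complex_iff strip_def)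
    from B[OF this] show ?thesis using strip_per_int[OF per p] by simp
  qed
  then show ?thesis using that by blast
qed

lemma holo_pds: "holo2_on U (pd0 f)" "holo2_on U (pd1 f)"
  using holo holo2_pd0 holo2_pd1 by auto

lemma strip_per_pds: "strip_per (pd0 f)" "strip_per (pd1 f)"
  using strip_per_pd[OF holoW strip_per_f] by auto

lemma pd_bounded: obtains B where "\<And>p. p \<in> W \<Longrightarrow> cmod (pd0 f p) \<le> B" "\<And>p. p \<in> W \<Longrightarrow> cmod (pd1 f p) \<le> B"
proof -
  obtain B0 where "\<And>p. p \<in> W \<Longrightarrow> cmod (pd0 f p) \<le> B0"
    using strip_per_bounded[OF pd0_continuous[OF holo] strip_per_pds(1)] by blast
  moreover obtain B1 where "\<And>p. p \<in> W \<Longrightarrow> cmod (pd1 f p) \<le> B1"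
    using strip_per_bounded[OF pd1_continuous[OF holo] strip_per_pds(2)] by blast
  ultimately show ?thesis by (intro that[of "max B0 B1"]) (auto simp: le_max_iff_disj)
qed

lemma Re2_W: "Re2 p \<in> W"
  using R_pos by (simp add: Re2_def strip_def)

lemma cnorm2_le: "cnorm2 a b \<le> cmod a + cmod b"
  unfolding cnorm2_def by (rule sqrt_sum_squares_le_sum) auto

lemma M0j_bound:
  assumes "p \<in> W" shows "cnorm2 (pd0 f p + pd0 f (Re2 p)) (pd1 f p + pd1 f (Re2 p)) \<le> M0j R f"
  unfolding M0j_def
proof (rule cSUP_upper[OF assms])
  obtain B where B: "\<And>p. p \<in> W \<Longrightarrow> cmod (pd0 f p) \<le> B" "\<And>p. p \<in> W \<Longrightarrow> cmod (pd1 f p) \<le> B"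
    using pd_bounded by blast
  show "bdd_above ((\<lambda>z. cnorm2 (pd0 f z + pd0 f (Re2 z)) (pd1 f z + pd1 f (Re2 z))) ` W)"
  proof (rule bdd_aboveI2)
    fix p assume p: "p \<in> W"
    show "cnorm2 (pd0 f p + pd0 f (Re2 p)) (pd1 f p + pd1 f (Re2 p)) \<le> 4 * B"
      using cnorm2_le[of "pd0 f p + pd0 f (Re2 p)" "pd1 f p + pd1 f (Re2 p)"]
        norm_triangle_ineq[of "pd0 f p" "pd0 f (Re2 p)"] norm_triangle_ineq[of "pd1 f p" "pd1 f (Re2 p)"]
        B[OF p] B[OF Re2_W[of p]] by linarith
  qed
qed

lemma M1j_bound:
  assumes "p \<in> W" shows "cmat_norm (pd0 (pd0 f) p) (pd1 (pd0 f) p) (pd0 (pd1 f) p) (pd1 (pd1 f) p) \<le> M1j R f"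
  unfolding M1j_def
proof (rule cSUP_upper[OF assms])
  have hW: "holo2_on W (pd0 f)" "holo2_on W (pd1 f)" using holoW holo2_pd0 holo2_pd1 by auto
  obtain B1 B2 B3 B4 where B: "\<And>p. p \<in> W \<Longrightarrow> cmod (pd0 (pd0 f) p) \<le> B1" "\<And>p. p \<in> W \<Longrightarrow> cmod (pd1 (pd0 f) p) \<le> B2"
     "\<And>p. p \<in> W \<Longrightarrow> cmod (pd0 (pd1 f) p) \<le> B3" "\<And>p. p \<in> W \<Longrightarrow> cmod (pd1 (pd1 f) p) \<le> B4"
    using strip_per_bounded[OF pd0_continuous[OF holo_pds(1)] strip_per_pd(1)[OF hW(1) strip_per_pds(1)]]
      strip_per_bounded[OF pd1_continuous[OF holo_pds(1)] strip_per_pd(2)[OF hW(1) strip_per_pds(1)]]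
      strip_per_bounded[OF pd0_continuous[OF holo_pds(2)] strip_per_pd(1)[OF hW(2) strip_per_pds(2)]]
      strip_per_bounded[OF pd1_continuous[OF holo_pds(2)] strip_per_pd(2)[OF hW(2) strip_per_pds(2)]] by metis
  show "bdd_above ((\<lambda>p. cmat_norm (pd0 (pd0 f) p) (pd1 (pd0 f) p) (pd0 (pd1 f) p) (pd1 (pd1 f) p)) ` W)"
  proof (rule bdd_aboveI2)
    fix p assume p: "p \<in> W"
    show "cmat_norm (pd0 (pd0 f) p) (pd1 (pd0 f) p) (pd0 (pd1 f) p) (pd1 (pd1 f) p) \<le> B1 + B2 + B3 + B4"
      using cmat_norm_le[of "pd0 (pd0 f) p" "pd1 (pd0 f) p" "pd0 (pd1 f) p" "pd1 (pd1 f) p"]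
        cnorm2_le[of "pd0 (pd0 f) p" "pd1 (pd0 f) p"] cnorm2_le[of "pd0 (pd1 f) p" "pd1 (pd1 f) p"]
        B(1)[OF p] B(2)[OF p] B(3)[OF p] B(4)[OF p] by linarith
  qed
qed

lemma convex_W: "convex W"
  by (intro convex_Times convex_strip)

lemma W_segment:
  assumes "p \<in> W" "p + v \<in> W" "t \<in> {0..1}" shows "p + t *\<^sub>R v \<in> W"
proof -
  have "p + t *\<^sub>R v = (1 - t) *\<^sub>R p + t *\<^sub>R (p + v)" by (simp add: algebra_simps)
  then show ?thesis using convexD[OF convex_W assms(1,2), of "1 - t" t] assms(3) by auto
qed

text \<open>The complex differential of \<open>f\<close> at \<open>p\<close>, applied to
  \<open>v\<close>.\<close>

definition D :: "complex \<times> complex \<Rightarrow> complex \<times> complex \<Rightarrow> complex" where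
  "D p v = pd0 f p * fst v + pd1 f p * snd v"

lemma D_diff_bound:
  assumes "p \<in> W" "p + v \<in> W"
  shows "cmod (D (p + v) w - D p w) \<le> M1j R f * norm v * norm w"
proof -
  have hW: "holo2_on W (pd0 f)" "holo2_on W (pd1 f)" using holoW holo2_pd0 holo2_pd1 by auto
  let ?q = "\<lambda>t. p + t *\<^sub>R v"
  let ?u = "\<lambda>t. D (?q t) w"
  let ?u' = "\<lambda>t. (pd0 (pd0 f) (?q t) * fst v + pd1 (pd0 f) (?q t) * snd v) * fst w + (pd0 (pd1 f) (?q t) * fst v + pd1 (pd1 f) (?q t) * snd v) * snd w"
  have "cmod (?u 1 - ?u 0) \<le> M1j R f * norm v * norm w"
  proof (rule norm_diff_le_vector_derivative)
    fix t :: real assume t: "t \<in> {0..1}"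
    note q = W_segment[OF assms t]
    show "(?u has_vector_derivative ?u' t) (at t)"
      unfolding D_def using q
      by (intro has_vector_derivative_add has_vector_derivative_mult_left holo2_line_derivative[OF hW(1)] holo2_line_derivative[OF hW(2)]) auto
    have "cmod (?u' t) \<le> cnorm2 (pd0 (pd0 f) (?q t) * fst v + pd1 (pd0 f) (?q t) * snd v) (pd0 (pd1 f) (?q t) * fst v + pd1 (pd1 f) (?q t) * snd v) * cnorm2 (fst w) (snd w)"
      by (rule cmod_bilinear_le)
    also have "\<dots> \<le> (cmat_norm (pd0 (pd0 f) (?q t)) (pd1 (pd0 f) (?q t)) (pd0 (pd1 f) (?q t)) (pd1 (pd1 f) (?q t)) * cnorm2 (fst v) (snd v)) * cnorm2 (fst w) (snd w)"
      by (intro mult_right_mono cmat_norm_bound) (simp add: cnorm2_eq)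
    also have "\<dots> \<le> (M1j R f * cnorm2 (fst v) (snd v)) * cnorm2 (fst w) (snd w)"
      by (intro mult_right_mono M1j_bound q) (simp_all add: cnorm2_eq)
    finally show "cmod (?u' t) \<le> M1j R f * norm v * norm w" by (simp add: cnorm2_eq)
  qed
  then show ?thesis by simp
qed

lemma f_line_derivative:
  assumes "p + t *\<^sub>R v \<in> W"
  shows "((\<lambda>t. f (p + t *\<^sub>R v)) has_vector_derivative D (p + t *\<^sub>R v) v) (at t)"
  unfolding D_def using holo2_line_derivative[OF holoW] assms by simp

lemma M_nonneg: "M0j R f \<ge> 0" "M1j R f \<ge> 0"
proof -
  have p: "(0, 0) \<in> W" using R_pos by (simp add: strip_def)
  show "M0j R f \<ge> 0" using M0j_bound[OF p] norm_ge_zero order_trans unfolding cnorm2_eq by blast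
  have "0 \<le> cmat_norm a b c d" for a b c d
  proof -
    have "cnorm2 a c \<le> cmat_norm a b c d" using cmat_norm_bound[of a 1 b 0 c d] by (simp add: cnorm2_def)
    moreover have "0 \<le> cnorm2 a c" by (simp add: cnorm2_eq)
    ultimately show ?thesis by linarith
  qed
  then show "M1j R f \<ge> 0" using M1j_bound[OF p] order_trans by blast
qed

text \<open>The increment \<open>v\<close> is real, so \<open>Re2\<close> maps the segment from
  \<open>z\<close> to \<open>z - v\<close> onto the parallel segment from \<open>Re2 z\<close>.
  Adding the two increments therefore produces the sum of gradients that \<open>M0j\<close>
  bounds.\<close>

lemma Delta_sum_bound:
  assumes z: "z \<in> W" and v: "v = (complex_of_real v0, complex_of_real v1)"
  shows "cmod ((f z - f (z - v)) + (f (Re2 z) - f (Re2 z - v))) \<le> M0j R f * norm v"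
proof -
  let ?x = "Re2 z"
  have W: "z + t *\<^sub>R (- v) \<in> W" "?x + t *\<^sub>R (- v) \<in> W" for t
    using z Re2_W[of z] by (auto simp: v strip_def)
  have R: "Re2 (z + t *\<^sub>R (- v)) = ?x + t *\<^sub>R (- v)" for t
    by (simp add: Re2_def v scaleR_conv_of_real minus_prod_def plus_prod_def)
  let ?u = "\<lambda>t. f (z + t *\<^sub>R (- v)) + f (?x + t *\<^sub>R (- v))"
  let ?u' = "\<lambda>t. D (z + t *\<^sub>R (- v)) (- v) + D (?x + t *\<^sub>R (- v)) (- v)"
  have "cmod (?u 1 - ?u 0) \<le> M0j R f * norm v"
  proof (rule norm_diff_le_vector_derivative)
    fix t :: real assume t: "t \<in> {0..1}"
    show "(?u has_vector_derivative ?u' t) (at t)"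
      by (intro has_vector_derivative_add f_line_derivative W)
    have "cmod (?u' t) = cmod ((pd0 f (z + t *\<^sub>R (- v)) + pd0 f (?x + t *\<^sub>R (- v))) * fst (- v) + (pd1 f (z + t *\<^sub>R (- v)) + pd1 f (?x + t *\<^sub>R (- v))) * snd (- v))"
      by (simp add: D_def algebra_simps)
    also have "\<dots> \<le> cnorm2 (pd0 f (z + t *\<^sub>R (- v)) + pd0 f (?x + t *\<^sub>R (- v))) (pd1 f (z + t *\<^sub>R (- v)) + pd1 f (?x + t *\<^sub>R (- v))) * cnorm2 (fst (- v)) (snd (- v))"
      by (rule cmod_bilinear_le)
    also have "\<dots> \<le> M0j R f * cnorm2 (fst (- v)) (snd (- v))"
      using M0j_bound[OF W(1)[of t]] unfolding R by (intro mult_right_mono) (auto simp: cnorm2_eq)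
    finally show "cmod (?u' t) \<le> M0j R f * norm v" by (simp add: cnorm2_eq norm_Pair v)
  qed
  moreover have "?u 1 - ?u 0 = - ((f z - f (z - v)) + (f (Re2 z) - f (Re2 z - v)))" by simp
  ultimately show ?thesis by (metis norm_minus_cancel)
qed

text \<open>Along the same two parallel segments the differentials differ by a second-derivative
  term over the purely imaginary step \<open>z - Re2 z\<close>. Multiplied with
  \<open>Delta_sum_bound\<close> it controls a difference of squares.\<close>

lemma Delta_diff_bound:
  assumes z: "z \<in> W" and v: "v = (complex_of_real v0, complex_of_real v1)"
  shows "cmod ((f z - f (z - v)) - (f (Re2 z) - f (Re2 z - v))) \<le> M1j R f * norm (z - Re2 z) * norm v"
proof -
  let ?x = "Re2 z"
  have W: "z + t *\<^sub>R (- v) \<in> W" "?x + t *\<^sub>R (- v) \<in> W" for t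
    using z Re2_W[of z] by (auto simp: v strip_def)
  let ?u = "\<lambda>t. f (z + t *\<^sub>R (- v)) - f (?x + t *\<^sub>R (- v))"
  let ?u' = "\<lambda>t. D (z + t *\<^sub>R (- v)) (- v) - D (?x + t *\<^sub>R (- v)) (- v)"
  have "cmod (?u 1 - ?u 0) \<le> M1j R f * norm (z - ?x) * norm v"
  proof (rule norm_diff_le_vector_derivative)
    fix t :: real assume t: "t \<in> {0..1}"
    show "(?u has_vector_derivative ?u' t) (at t)"
      by (intro has_vector_derivative_diff f_line_derivative W)
    have "(?x + t *\<^sub>R (- v)) + (z - ?x) = z + t *\<^sub>R (- v)" by simp
    then show "cmod (?u' t) \<le> M1j R f * norm (z - ?x) * norm v"
      using D_diff_bound[of "?x + t *\<^sub>R (- v)" "z - ?x" "- v"] W[of t] by simp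
  qed
  moreover have "?u 1 - ?u 0 = - ((f z - f (z - v)) - (f (Re2 z) - f (Re2 z - v)))" by simp
  ultimately show ?thesis by (metis norm_minus_cancel)
qed

text \<open>The expansion is at \<open>z - v\<close> rather than at \<open>z\<close>, because the
  normal vector in the kernel is taken at that point.\<close>

lemma Taylor_bound:
  assumes z: "z \<in> W" and v: "v = (complex_of_real v0, complex_of_real v1)"
  shows "cmod ((f z - f (z - v)) - D (z - v) v) \<le> M1j R f * (norm v)\<^sup>2"
proof -
  let ?w = "z - v"
  have w: "?w \<in> W" using z by (auto simp: v strip_def)
  have W: "?w + t *\<^sub>R v \<in> W" for t
    using w by (auto simp: v strip_def)
  let ?u = "\<lambda>t. f (?w + t *\<^sub>R v) - t *\<^sub>R D ?w v"
  let ?u' = "\<lambda>t. D (?w + t *\<^sub>R v) v - D ?w v"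
  have "cmod (?u 1 - ?u 0) \<le> M1j R f * (norm v)\<^sup>2"
  proof (rule norm_diff_le_vector_derivative)
    fix t :: real assume t: "t \<in> {0..1}"
    have "((\<lambda>t. t *\<^sub>R D ?w v) has_vector_derivative D ?w v) (at t)"
      by (auto intro!: derivative_eq_intros)
    then show "(?u has_vector_derivative ?u' t) (at t)"
      by (intro has_vector_derivative_diff f_line_derivative W)
    have "cmod (?u' t) \<le> M1j R f * norm (t *\<^sub>R v) * norm v"
      by (rule D_diff_bound[OF w W])
    also have "\<dots> \<le> M1j R f * norm v * norm v"
      using t M_nonneg(2) by (intro mult_right_mono mult_left_mono) (auto intro: mult_left_le_one_le)
    finally show "cmod (?u' t) \<le> M1j R f * (norm v)\<^sup>2" by (simp add: power2_eq_square)
  qed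
  moreover have "?u 1 - ?u 0 = (f z - f (z - v)) - D (z - v) v" by simp
  ultimately show ?thesis by (simp only:)
qed

end

section \<open>Contour shifts\<close>

lemma holo2_const: "open U \<Longrightarrow> holo2_on U (\<lambda>z. c)"
  by (simp add: holo2_on_def)

lemma holo2_add: "holo2_on U f \<Longrightarrow> holo2_on U g \<Longrightarrow> holo2_on U (\<lambda>z. f z + g z)"
  unfolding holo2_on_def by (auto intro!: continuous_intros field_differentiable_add)

lemma holo2_diff: "holo2_on U f \<Longrightarrow> holo2_on U g \<Longrightarrow> holo2_on U (\<lambda>z. f z - g z)"
  unfolding holo2_on_def by (auto intro!: continuous_intros field_differentiable_diff)

lemma holo2_mult: "holo2_on U f \<Longrightarrow> holo2_on U g \<Longrightarrow> holo2_on U (\<lambda>z. f z * g z)"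
  unfolding holo2_on_def by (auto intro!: continuous_intros field_differentiable_mult)

lemma holo2_divide:
  "holo2_on U f \<Longrightarrow> holo2_on U g \<Longrightarrow> (\<And>z. z \<in> U \<Longrightarrow> g z \<noteq> 0) \<Longrightarrow> holo2_on U (\<lambda>z. f z / g z)"
  unfolding holo2_on_def by (auto intro!: continuous_intros field_differentiable_divide)

lemma holo2_sum: "open U \<Longrightarrow> (\<And>i. i \<in> I \<Longrightarrow> holo2_on U (f i)) \<Longrightarrow> holo2_on U (\<lambda>z. \<Sum>i\<in>I. f i z)"
  by (induction I rule: infinite_finite_induct) (auto intro: holo2_const holo2_add)

text \<open>A positive real part keeps \<open>f\<close> off the branch cut of
  \<open>csqrt\<close>.\<close>

lemma holo2_csqrt:
  assumes "holo2_on U f" "\<And>z. z \<in> U \<Longrightarrow> Re (f z) > 0" shows "holo2_on U (\<lambda>z. csqrt (f z))"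
proof -
  have n: "f z \<notin> \<real>\<^sub>\<le>\<^sub>0" if "z \<in> U" for z using assms(2)[OF that] by (auto simp: complex_nonpos_Reals_iff)
  have "continuous_on U (\<lambda>z. csqrt (f z))"
  proof (rule continuous_on_compose2[OF _ holo2_onD(2)[OF assms(1)]])
    show "continuous_on (f ` U) csqrt"
      using n continuous_at_csqrt continuous_at_imp_continuous_on by blast
  qed simp
  moreover have "(\<lambda>w. csqrt (f (w, snd z))) field_differentiable at (fst z) \<and> (\<lambda>w. csqrt (f (fst z, w))) field_differentiable at (snd z)" if "z \<in> U" for z
  proof -
    have d: "csqrt field_differentiable at (f z)" using n[OF that] by (rule field_differentiable_at_csqrt)
    obtain a b where ab: "z = (a, b)" by (cases z)
    show ?thesis
      using field_differentiable_compose[OF holo2_onD(3)[OF assms(1), of a b] , of csqrt]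
        field_differentiable_compose[OF holo2_onD(4)[OF assms(1), of a b] , of csqrt] d that
      by (auto simp: ab o_def)
  qed
  ultimately show ?thesis using holo2_onD(1)[OF assms(1)] unfolding holo2_on_def by blast
qed

lemma holo2_exp_linear: "open U \<Longrightarrow> holo2_on U (\<lambda>z. exp (a * fst z + b * snd z))"
  unfolding holo2_on_def field_differentiable_def
  by (auto intro!: continuous_intros exI derivative_eq_intros)

lemma holo2_translate:
  assumes "holo2_on U f" "open V" "\<And>z. z \<in> V \<Longrightarrow> z - c \<in> U" shows "holo2_on V (\<lambda>z. f (z - c))"
proof -
  have "continuous_on V (\<lambda>z. f (z - c))"
    using assms(3) by (intro continuous_on_compose2[OF holo2_onD(2)[OF assms(1)]] continuous_intros) auto
  moreover have "(\<lambda>w. f ((w, snd z) - c)) field_differentiable at (fst z) \<and> (\<lambda>w. f ((fst z, w) - c)) field_differentiable at (snd z)" if "z \<in> V" for z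
  proof -
    obtain a b where ab: "z = (a, b)" by (cases z)
    obtain c0 c1 where c: "c = (c0, c1)" by (cases c)
    have "(a - c0, b - c1) \<in> U" using assms(3)[OF that] by (simp add: ab c)
    from has_field_derivative_pd[OF assms(1) this]
    have "((\<lambda>w. f (w - c0, b - c1)) has_field_derivative pd0 f (a - c0, b - c1)) (at a)"
      "((\<lambda>w. f (a - c0, w - c1)) has_field_derivative pd1 f (a - c0, b - c1)) (at b)"
      using DERIV_shift[of "\<lambda>w. f (w, b - c1)" "pd0 f (a - c0, b - c1)" a "- c0"]
        DERIV_shift[of "\<lambda>w. f (a - c0, w)" "pd1 f (a - c0, b - c1)" b "- c1"] by simp_all
    then show ?thesis by (auto simp: ab c field_differentiable_def)
  qed
  ultimately show ?thesis using assms(2) unfolding holo2_on_def by blast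
qed

text \<open>On the convex strip \<open>g\<close> has a primitive \<open>P\<close>. Periodicity of
  \<open>g\<close> makes \<open>P (z + 2 * pi) - P z\<close> constant, and this constant is the
  integral over a period at every height.\<close>

lemma integral_shift_strip:
  assumes g: "g holomorphic_on strip B" and per: "\<And>z. z \<in> strip B \<Longrightarrow> g (z + of_real (2*pi)) = g z" and \<eta>: "\<bar>\<eta>\<bar> < B"
  shows "integral {0..2*pi} (\<lambda>x. g (of_real x + \<i> * of_real \<eta>)) = integral {0..2*pi} (\<lambda>x. g (of_real x))"
proof -
  obtain P where P: "\<And>z. z \<in> strip B \<Longrightarrow> (P has_field_derivative g z) (at z within strip B)"
    using holomorphic_convex_primitive'[OF convex_strip open_strip g] by blast
  then have P: "(P has_field_derivative g z) (at z)" if "z \<in> strip B" for z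
    using P[OF that] at_within_open[OF that open_strip] by simp
  have sh: "z + of_real (2*pi) \<in> strip B" if "z \<in> strip B" for z using that by (simp add: strip_def)
  have "\<exists>c. \<forall>z\<in>strip B. P (z + of_real (2*pi)) - P z = c"
  proof (rule has_field_derivative_zero_constant[OF convex_strip])
    fix z assume z: "z \<in> strip B"
    have "((\<lambda>z. P (z + of_real (2*pi))) has_field_derivative g (z + of_real (2*pi))) (at z)"
      using P[OF sh[OF z]] by (simp add: DERIV_shift)
    from DERIV_diff[OF this P[OF z]]
    have "((\<lambda>z. P (z + of_real (2*pi)) - P z) has_field_derivative 0) (at z)" using per[OF z] by simp
    then show "((\<lambda>z. P (z + of_real (2*pi)) - P z) has_field_derivative 0) (at z within strip B)"
      by (rule has_field_derivative_at_within)
  qed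
  then obtain c where c: "\<And>z. z \<in> strip B \<Longrightarrow> P (z + of_real (2*pi)) - P z = c" by blast
  have I: "integral {0..2*pi} (\<lambda>x. g (of_real x + \<i> * of_real y)) = c" if "\<bar>y\<bar> < B" for y
  proof -
    have s: "of_real x + \<i> * of_real y \<in> strip B" for x using that by (simp add: strip_def)
    have "((\<lambda>x. g (of_real x + \<i> * of_real y)) has_integral (P (of_real (2*pi) + \<i> * of_real y) - P (of_real 0 + \<i> * of_real y))) {0..2*pi}"
    proof (rule fundamental_theorem_of_calculus)
      fix x
      have "((\<lambda>z. P (z + \<i> * of_real y)) has_field_derivative g (of_real x + \<i> * of_real y)) (at (of_real x))"
        using P[OF s[of x]] by (simp add: DERIV_shift)
      from has_vector_derivative_real_field[OF this]
      show "((\<lambda>x. P (of_real x + \<i> * of_real y)) has_vector_derivative g (of_real x + \<i> * of_real y)) (at x within {0..2*pi})"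
        by (simp add: o_def has_vector_derivative_at_within)
    qed simp
    then show ?thesis using c[OF s[of 0]] by (simp add: integral_unique add.commute)
  qed
  show ?thesis using I[OF \<eta>] I[of 0] \<eta> by simp
qed

text \<open>Each variable is shifted on its own, with an exchange of the order of integration in
  between.\<close>

lemma integral_shift_strip2:
  assumes h: "holo2_on (strip B \<times> strip B) h"
    and per: "\<And>z. z \<in> strip B \<times> strip B \<Longrightarrow> h (z + (of_real (2*pi), 0)) = h z"
      "\<And>z. z \<in> strip B \<times> strip B \<Longrightarrow> h (z + (0, of_real (2*pi))) = h z"
    and \<eta>: "\<bar>\<eta>0\<bar> < B" "\<bar>\<eta>1\<bar> < B"
  shows "(\<integral>t. h (of_real (fst t) + \<i> * of_real \<eta>0, of_real (snd t) + \<i> * of_real \<eta>1) \<partial>SqM)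
      = (\<integral>t. h (of_real (fst t), of_real (snd t)) \<partial>SqM)"
proof -
  have W: "(of_real x + \<i> * of_real a, of_real y + \<i> * of_real b) \<in> strip B \<times> strip B"
    if "\<bar>a\<bar> < B" "\<bar>b\<bar> < B" for x y a b using that by (simp add: strip_def)
  have c: "continuous_on X (\<lambda>t. h (of_real (fst t) + \<i> * of_real a, of_real (snd t) + \<i> * of_real b))"
    if "\<bar>a\<bar> < B" "\<bar>b\<bar> < B" for X a b
    using W[OF that] by (intro continuous_on_compose2[OF holo2_onD(2)[OF h]] continuous_intros) auto
  have B0: "\<bar>0::real\<bar> < B" using \<eta> by linarith
  let ?H = "\<lambda>a b. integral {0..2*pi} (\<lambda>x. integral {0..2*pi} (\<lambda>y. h (of_real x + \<i> * of_real a, of_real y + \<i> * of_real b)))"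
  have H: "(\<integral>t. h (of_real (fst t) + \<i> * of_real a, of_real (snd t) + \<i> * of_real b) \<partial>SqM) = ?H a b" if "\<bar>a\<bar> < B" "\<bar>b\<bar> < B" for a b
    using SqM_integral_continuous(2)[OF c[OF that]] by simp
  have hol1: "(\<lambda>w. h (z, w)) holomorphic_on strip B" "(\<lambda>w. h (w, z)) holomorphic_on strip B" if "z \<in> strip B" for z
    unfolding holomorphic_on_def using holo2_onD(3,4)[OF h] that by (auto intro: field_differentiable_at_within)
  have swap: "?H a b = integral {0..2*pi} (\<lambda>y. integral {0..2*pi} (\<lambda>x. h (of_real x + \<i> * of_real a, of_real y + \<i> * of_real b)))"
    if "\<bar>a\<bar> < B" "\<bar>b\<bar> < B" for a b
    using integral_swap_continuous[of 0 0 "2*pi" "2*pi" "\<lambda>x y. h (of_real x + \<i> * of_real a, of_real y + \<i> * of_real b)"] c[OF that]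
    by (simp add: case_prod_unfold)
  have in0: "of_real x + \<i> * of_real a \<in> strip B" if "\<bar>a\<bar> < B" for x a using that by (simp add: strip_def)
  have i1: "integral {0..2*pi} (\<lambda>y. h (z, of_real y + \<i> * of_real \<eta>1)) = integral {0..2*pi} (\<lambda>y. h (z, of_real y + \<i> * of_real 0))"
    if "z \<in> strip B" for z
    using integral_shift_strip[OF hol1(1)[OF that] _ \<eta>(2)] per(2)[of "(z, _)"] that by simp
  have i0: "integral {0..2*pi} (\<lambda>x. h (of_real x + \<i> * of_real \<eta>0, z)) = integral {0..2*pi} (\<lambda>x. h (of_real x + \<i> * of_real 0, z))"
    if "z \<in> strip B" for z
    using integral_shift_strip[OF hol1(2)[OF that] _ \<eta>(1)] per(1)[of "(_, z)"] that by simp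
  have "?H \<eta>0 \<eta>1 = ?H \<eta>0 0"
    by (rule integral_cong) (rule i1[OF in0[OF \<eta>(1)]])
  also have "\<dots> = integral {0..2*pi} (\<lambda>y. integral {0..2*pi} (\<lambda>x. h (of_real x + \<i> * of_real \<eta>0, of_real y + \<i> * of_real 0)))"
    by (rule swap[OF \<eta>(1) B0])
  also have "\<dots> = integral {0..2*pi} (\<lambda>y. integral {0..2*pi} (\<lambda>x. h (of_real x + \<i> * of_real 0, of_real y + \<i> * of_real 0)))"
    by (rule integral_cong) (rule i0[OF in0[OF B0]])
  also have "\<dots> = ?H 0 0" by (rule swap[OF B0 B0, symmetric])
  finally show ?thesis using H[OF \<eta>] H[OF B0 B0] by simp
qed

abbreviation cplx :: "real \<times> real \<Rightarrow> complex \<times> complex" where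
  "cplx t \<equiv> (complex_of_real (fst t), complex_of_real (snd t))"

section \<open>The periodic distance\<close>

lemma infdist_twopiZ_periodic: "infdist (x + 2 * pi * of_int k) twopiZ = infdist x twopiZ"
proof -
  have ne: "twopiZ \<noteq> {}" by (auto simp: twopiZ_def)
  have "(\<lambda>a. dist (x + 2 * pi * of_int k) a) ` twopiZ = (\<lambda>a. dist x a) ` twopiZ"
  proof (intro set_eqI iffI)
    fix d assume "d \<in> (\<lambda>a. dist (x + 2 * pi * of_int k) a) ` twopiZ"
    then obtain m :: int where "d = dist (x + 2 * pi * of_int k) (2 * pi * of_int m)" by (auto simp: twopiZ_def)
    then have "d = dist x (2 * pi * of_int (m - k))" by (simp add: dist_real_def algebra_simps)
    then show "d \<in> (\<lambda>a. dist x a) ` twopiZ" unfolding twopiZ_def by blast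
  next
    fix d assume "d \<in> (\<lambda>a. dist x a) ` twopiZ"
    then obtain m :: int where "d = dist x (2 * pi * of_int m)" by (auto simp: twopiZ_def)
    then have "d = dist (x + 2 * pi * of_int k) (2 * pi * of_int (m + k))" by (simp add: dist_real_def algebra_simps)
    then show "d \<in> (\<lambda>a. dist (x + 2 * pi * of_int k) a) ` twopiZ" unfolding twopiZ_def by blast
  qed
  then show ?thesis using ne by (simp add: infdist_def)
qed

lemma infdist_twopiZ_small: "\<bar>x\<bar> \<le> pi \<Longrightarrow> infdist x twopiZ \<ge> \<bar>x\<bar>"
proof -
  assume x: "\<bar>x\<bar> \<le> pi"
  have ne: "twopiZ \<noteq> {}" by (auto simp: twopiZ_def)
  have "\<bar>x\<bar> \<le> dist x a" if aZ: "a \<in> twopiZ" for a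
  proof -
    obtain k :: int where k: "a = 2 * pi * of_int k" using aZ unfolding twopiZ_def by blast
    show ?thesis
    proof (cases "k = 0")
      case False
      then have "\<bar>real_of_int k\<bar> \<ge> 1" by linarith
      then have "2 * pi * 1 \<le> 2 * pi * \<bar>real_of_int k\<bar>" by (intro mult_left_mono) auto
      then have "\<bar>a\<bar> \<ge> 2 * pi" by (simp add: k abs_mult)
      then show ?thesis using x by (simp add: dist_real_def)
    qed (simp add: k dist_real_def)
  qed
  then show ?thesis unfolding infdist_def using ne by (auto intro: cINF_greatest)
qed

lemma zeta_ge_norm:
  assumes "\<bar>fst v\<bar> \<le> pi" "\<bar>snd v\<bar> \<le> pi" shows "norm v \<le> zeta v"
proof -
  have "(fst v)\<^sup>2 \<le> (infdist (fst v) twopiZ)\<^sup>2" "(snd v)\<^sup>2 \<le> (infdist (snd v) twopiZ)\<^sup>2"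
    using infdist_twopiZ_small[OF assms(1)] infdist_twopiZ_small[OF assms(2)]
    by (metis abs_ge_zero power2_abs power_mono)+
  then have "(fst v)\<^sup>2 + (snd v)\<^sup>2 \<le> (infdist (fst v) twopiZ)\<^sup>2 + (infdist (snd v) twopiZ)\<^sup>2" by linarith
  then show ?thesis by (cases v) (simp add: zeta_def norm_Pair)
qed

section \<open>Analytic continuation of the kernel\<close>

locale torus_bie =
  fixes Gamma :: "real \<times> real \<Rightarrow> real^3" and C0 R0 :: real and F :: "3 \<Rightarrow> complex \<times> complex \<Rightarrow> complex"
  assumes periodic: "\<forall>t0 t1. Gamma (t0 + 2*pi, t1) = Gamma (t0, t1) \<and> Gamma (t0, t1 + 2*pi) = Gamma (t0, t1)"
    and diff: "\<forall>t. Gamma differentiable (at t)"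
    and A1: "C0 > 0" "\<forall>t\<in>Sq. \<forall>e\<in>Sq. norm (Gamma t - Gamma e) \<ge> C0 * zeta (t - e)"
    and A2: "R0 > 0" "\<forall>j. analytic_ext_closure R0 (\<lambda>t. Gamma t $ j) (F j)"
begin

text \<open>A fixed choice of domain, since the sublocale below needs it as a parameter.\<close>

definition ext_domain :: "3 \<Rightarrow> (complex \<times> complex) set" where
  "ext_domain j = (SOME U. cstrip R0 \<times> cstrip R0 \<subseteq> U \<and> holo2_on U (F j))"

lemma F_real: "F j (cplx t) = of_real (Gamma t $ j)"
  using A2(2) by (cases t) (auto simp: analytic_ext_closure_def)

lemma ext_domain_props: "cstrip R0 \<times> cstrip R0 \<subseteq> ext_domain j \<and> holo2_on (ext_domain j) (F j)"
  unfolding ext_domain_def by (rule someI_ex) (use A2(2) in \<open>auto simp: analytic_ext_closure_def\<close>)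

sublocale sf: strip_fn "F j" "ext_domain j" R0 for j
proof
  show "F j (complex_of_real (x + 2 * pi), complex_of_real y) = F j (complex_of_real x, complex_of_real y)"
    "F j (complex_of_real x, complex_of_real (y + 2 * pi)) = F j (complex_of_real x, complex_of_real y)" for x y
    using F_real[of j "(x + 2*pi, y)"] F_real[of j "(x, y)"] F_real[of j "(x, y + 2*pi)"] periodic by auto
qed (use A2(1) ext_domain_props in auto)

abbreviation "W \<equiv> strip R0 \<times> strip R0"

lemma cplx_W: "cplx t \<in> W"
  using A2(1) by (simp add: strip_def)

lemma norm_cplx: "norm (cplx v) = norm v"
  by (cases v) (simp add: norm_Pair)

lemma Gamma_periodic: "Gamma (t + (2 * pi * of_int m, 2 * pi * of_int n)) = Gamma t"
proof -
  have "Gamma (t + (2 * pi * of_int m, 2 * pi * of_int n)) $ j = Gamma t $ j" for j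
  proof -
    have "complex_of_real (Gamma (t + (2 * pi * of_int m, 2 * pi * of_int n)) $ j) = of_real (Gamma t $ j)"
      using sf.strip_per_int[OF sf.strip_per_f cplx_W[of t], of j m n]
      unfolding F_real[symmetric] by (cases t) (simp add: F_real)
    then show ?thesis by simp
  qed
  then show ?thesis by (simp add: vec_eq_iff)
qed

lemma shift_to_Sq: "\<exists>m n :: int. t + (2 * pi * of_int m, 2 * pi * of_int n) \<in> Sq"
proof -
  have red: "\<exists>m::int. 0 \<le> x + 2*pi* of_int m \<and> x + 2*pi* of_int m < 2*pi" for x
  proof -
    define k where "k = \<lfloor>x / (2*pi)\<rfloor>"
    have "of_int k \<le> x / (2*pi)" "x / (2*pi) < of_int k + 1" unfolding k_def by linarith+
    then have "of_int k * (2*pi) \<le> x" "x < (of_int k + 1) * (2*pi)"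
      by (simp_all add: pos_le_divide_eq pos_divide_less_eq)
    then show ?thesis by (intro exI[of _ "- k"]) (simp add: algebra_simps)
  qed
  obtain m n :: int where "0 \<le> fst t + 2*pi* of_int m \<and> fst t + 2*pi* of_int m < 2*pi"
    "0 \<le> snd t + 2*pi* of_int n \<and> snd t + 2*pi* of_int n < 2*pi"
    using red by meson
  then show ?thesis by (intro exI[of _ m] exI[of _ n]) (auto simp: Sq_def mem_Times_iff)
qed

text \<open>(A1) speaks of points of \<open>Sq\<close>. Both points are moved there by separate
  periods, which changes neither the values of \<open>Gamma\<close> nor \<open>zeta\<close> of the
  difference; for components up to \<open>pi\<close>, \<open>zeta\<close> dominates the
  norm.\<close>

lemma A1_global:
  assumes v: "\<bar>fst v\<bar> \<le> pi" "\<bar>snd v\<bar> \<le> pi"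
  shows "C0 * norm v \<le> norm (Gamma t - Gamma (t - v))"
proof -
  obtain m n :: int where s: "t + (2 * pi * of_int m, 2 * pi * of_int n) \<in> Sq" (is "?s \<in> Sq") using shift_to_Sq by blast
  obtain m' n' :: int where e: "(t - v) + (2 * pi * of_int m', 2 * pi * of_int n') \<in> Sq" (is "?e \<in> Sq") using shift_to_Sq by blast
  have "?s - ?e = v + (2 * pi * of_int (m - m'), 2 * pi * of_int (n - n'))"
    by (auto simp: algebra_simps prod_eq_iff)
  then have "zeta (?s - ?e) = zeta v" by (simp only: zeta_def fst_add snd_add fst_conv snd_conv infdist_twopiZ_periodic)
  then have "C0 * zeta v \<le> norm (Gamma ?s - Gamma ?e)" using A1(2) s e by metis
  also have "\<dots> = norm (Gamma t - Gamma (t - v))" by (simp only: Gamma_periodic)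
  finally show ?thesis using mult_left_mono[OF zeta_ge_norm[OF v], of C0] A1(1) by linarith
qed

text \<open>Along real lines \<open>F j\<close> restricts to a component of \<open>Gamma\<close>, so
  the directional derivatives agree; the two coordinate directions give the claim.\<close>

lemma pd_real:
  "pd0 (F j) (cplx e) = of_real (dGamma0 Gamma e $ j)" "pd1 (F j) (cplx e) = of_real (dGamma1 Gamma e $ j)"
proof -
  obtain x y where e: "e = (x, y)" by (cases e)
  have G: "(Gamma has_derivative frechet_derivative Gamma (at e)) (at e)"
    using diff[rule_format, of e] unfolding frechet_derivative_works .
  have line: "((\<lambda>s. of_real (Gamma (e + s *\<^sub>R v) $ j)) has_vector_derivative complex_of_real (frechet_derivative Gamma (at e) v $ j)) (at 0)" for v
  proof -
    have "((\<lambda>s. e + s *\<^sub>R v) has_derivative (\<lambda>s. s *\<^sub>R v)) (at 0)" by (auto intro!: derivative_eq_intros)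
    from has_derivative_compose[OF this, of Gamma "frechet_derivative Gamma (at e)"] G
    have "((\<lambda>s. Gamma (e + s *\<^sub>R v)) has_derivative (\<lambda>s. frechet_derivative Gamma (at e) (s *\<^sub>R v))) (at 0)" by simp
    then have "((\<lambda>s. Gamma (e + s *\<^sub>R v)) has_vector_derivative frechet_derivative Gamma (at e) v) (at 0)"
      using linear_frechet_derivative[of Gamma "at e"] diff by (simp add: has_vector_derivative_def linear_scale)
    from bounded_linear.has_vector_derivative[OF bounded_linear_vec_nth[of j] this]
    have "((\<lambda>s. Gamma (e + s *\<^sub>R v) $ j) has_vector_derivative frechet_derivative Gamma (at e) v $ j) (at 0)" .
    from bounded_linear.has_vector_derivative[OF bounded_linear_of_real this]
    show ?thesis .
  qed
  have Fl: "((\<lambda>s. F j (cplx e + s *\<^sub>R v)) has_vector_derivative pd0 (F j) (cplx e) * fst v + pd1 (F j) (cplx e) * snd v) (at 0)" for v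
    using holo2_line_derivative[OF sf.holoW, of "cplx e" 0 v j] cplx_W by simp
  have cxl: "cplx e + s *\<^sub>R cplx v = cplx (e + s *\<^sub>R v)" for s v by (simp add: scaleR_conv_of_real)
  have "pd0 (F j) (cplx e) * fst (cplx v) + pd1 (F j) (cplx e) * snd (cplx v) = complex_of_real (frechet_derivative Gamma (at e) v $ j)" for v
    using vector_derivative_unique_at[OF Fl[of "cplx v"] line[of v, folded F_real, folded cxl]] by simp
  from this[of "(1, 0)"] this[of "(0, 1)"]
  show "pd0 (F j) (cplx e) = of_real (dGamma0 Gamma e $ j)" "pd1 (F j) (cplx e) = of_real (dGamma1 Gamma e $ j)"
    by (simp_all add: dGamma0_def dGamma1_def)
qed

text \<open>\<open>kernel_ext v\<close> continues \<open>t \<mapsto> K(t, t - v)\<close> to complex \<open>t\<close>: \<open>S v\<close> replaces the squared norm of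
  \<open>Gamma t - Gamma (t - v)\<close>, so its cube is \<open>S * csqrt S\<close>, and \<open>normal_ext\<close> replaces the cross product.\<close>

definition Delta :: "real \<times> real \<Rightarrow> complex \<times> complex \<Rightarrow> 3 \<Rightarrow> complex" where
  "Delta v z j = F j z - F j (z - cplx v)"

definition S :: "real \<times> real \<Rightarrow> complex \<times> complex \<Rightarrow> complex" where
  "S v z = (\<Sum>j\<in>UNIV. (Delta v z j)\<^sup>2)"

definition normal_ext :: "complex \<times> complex \<Rightarrow> 3 \<Rightarrow> complex" where
  "normal_ext w j = (if j = 1 then pd0 (F 2) w * pd1 (F 3) w - pd0 (F 3) w * pd1 (F 2) w
     else if j = 2 then pd0 (F 3) w * pd1 (F 1) w - pd0 (F 1) w * pd1 (F 3) w
     else pd0 (F 1) w * pd1 (F 2) w - pd0 (F 2) w * pd1 (F 1) w)"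

definition Q :: "real \<times> real \<Rightarrow> complex \<times> complex \<Rightarrow> complex" where
  "Q v z = (\<Sum>j\<in>UNIV. Delta v z j * normal_ext (z - cplx v) j)"

definition kernel_ext :: "real \<times> real \<Rightarrow> complex \<times> complex \<Rightarrow> complex" where
  "kernel_ext v z = - (1 / (2 * of_real pi)) * (Q v z / (S v z * csqrt (S v z)))"

lemma cplx_diff: "cplx t - cplx v = cplx (t - v)" by simp

lemma Delta_real: "Delta v (cplx t) j = of_real ((Gamma t - Gamma (t - v)) $ j)"
  unfolding Delta_def cplx_diff F_real by simp

lemma S_real: "S v (cplx t) = of_real ((norm (Gamma t - Gamma (t - v)))\<^sup>2)"
proof -
  have "(norm x)\<^sup>2 = (\<Sum>j\<in>UNIV. (x $ j)\<^sup>2)" for x :: "real^3"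
    by (simp add: norm_vec_def L2_set_def sum_nonneg)
  then show ?thesis by (simp add: S_def Delta_real)
qed

text \<open>This includes points with \<open>Gamma t = Gamma (t - v)\<close>, where both sides are
  divisions by zero.\<close>

lemma kernel_ext_real: "kernel_ext v (cplx t) = of_real (kernK Gamma t (t - v))"
proof -
  let ?d = "Gamma t - Gamma (t - v)" and ?e = "t - v"
  have Q: "Q v (cplx t) = of_real (?d \<bullet> cross3 (dGamma0 Gamma ?e) (dGamma1 Gamma ?e))"
    unfolding Q_def normal_ext_def cplx_diff pd_real Delta_real sum_3
    by (simp add: inner_vec_def sum_3 cross3_def vector_3 cross_components)
  have "csqrt (S v (cplx t)) = of_real (norm ?d)"
    unfolding S_real by (simp flip: of_real_power add: of_real_sqrt[symmetric])
  then show ?thesis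
    unfolding kernel_ext_def kernK_def Q S_real by (simp add: power3_eq_cube power2_eq_square mult.assoc)
qed

definition M01 :: real where "M01 = M0 R0 F * M1 R0 F"

lemma M01_nonneg: "M01 \<ge> 0"
  by (simp add: M01_def M0_def M1_def sum_nonneg)

text \<open>The change of \<open>S\<close> between \<open>Re2 z\<close> and \<open>z\<close> is a
  sum of differences of squares. Each factors into terms bounded by \<open>Delta_diff_bound\<close>
  and \<open>Delta_sum_bound\<close>, and Cauchy-Schwarz over \<open>j\<close> produces the product
  \<open>M01\<close>. The factor \<open>sqrt 2\<close> stems from two imaginary parts, each below
  \<open>B\<close>.\<close>

lemma S_lower:
  assumes z: "z \<in> strip B \<times> strip B" and B: "0 < B" "B \<le> R0" and v: "\<bar>fst v\<bar> \<le> pi" "\<bar>snd v\<bar> \<le> pi"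
  shows "Re (S v z) \<ge> (C0\<^sup>2 - sqrt 2 * B * M01) * (norm v)\<^sup>2"
proof -
  have zW: "z \<in> W" using z B by (auto simp: strip_def)
  define t where "t = (Re (fst z), Re (snd z))"
  have x: "Re2 z = cplx t" by (simp add: Re2_def t_def)
  have y: "norm (z - Re2 z) \<le> sqrt 2 * B"
  proof -
    have "norm (z - Re2 z) = sqrt ((Im (fst z))\<^sup>2 + (Im (snd z))\<^sup>2)"
      by (cases z) (simp add: Re2_def norm_Pair cmod_power2)
    also have "\<dots> \<le> sqrt (B\<^sup>2 + B\<^sup>2)"
      using z by (intro real_sqrt_le_mono add_mono abs_le_square_iff[THEN iffD1]) (auto simp: strip_def)
    also have "\<dots> = sqrt 2 * B" using B by (simp add: real_sqrt_mult)
    finally show ?thesis .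
  qed
  have "cmod (S v z - S v (Re2 z)) \<le> (\<Sum>j\<in>UNIV. (M1j R0 (F j) * norm (z - Re2 z) * norm v) * (M0j R0 (F j) * norm v))"
  proof -
    have "S v z - S v (Re2 z) = (\<Sum>j\<in>UNIV. (Delta v z j - Delta v (Re2 z) j) * (Delta v z j + Delta v (Re2 z) j))"
      by (simp add: S_def sum_subtractf[symmetric] power2_eq_square algebra_simps)
    also have "cmod \<dots> \<le> (\<Sum>j\<in>UNIV. cmod ((Delta v z j - Delta v (Re2 z) j) * (Delta v z j + Delta v (Re2 z) j)))"
      by (rule norm_sum)
    also have "\<dots> \<le> (\<Sum>j\<in>UNIV. (M1j R0 (F j) * norm (z - Re2 z) * norm v) * (M0j R0 (F j) * norm v))"
    proof (rule sum_mono)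
      fix j :: 3
      show "cmod ((Delta v z j - Delta v (Re2 z) j) * (Delta v z j + Delta v (Re2 z) j)) \<le> (M1j R0 (F j) * norm (z - Re2 z) * norm v) * (M0j R0 (F j) * norm v)"
        unfolding norm_mult Delta_def norm_cplx[symmetric, of v]
        by (intro mult_mono sf.Delta_diff_bound[OF zW refl] sf.Delta_sum_bound[OF zW refl])
          (auto intro!: mult_nonneg_nonneg sf.M_nonneg)
    qed
    finally show ?thesis .
  qed
  also have "\<dots> = norm (z - Re2 z) * (norm v)\<^sup>2 * (\<Sum>j\<in>UNIV. \<bar>M0j R0 (F j)\<bar> * \<bar>M1j R0 (F j)\<bar>)"
    by (simp add: sum_distrib_left power2_eq_square mult_ac sf.M_nonneg)
  also have "\<dots> \<le> (sqrt 2 * B) * (norm v)\<^sup>2 * M01"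
  proof (rule mult_mono)
    show "(\<Sum>j\<in>UNIV. \<bar>M0j R0 (F j)\<bar> * \<bar>M1j R0 (F j)\<bar>) \<le> M01"
      using L2_set_mult_ineq[of "\<lambda>j. M0j R0 (F j)" "\<lambda>j. M1j R0 (F j)" UNIV]
      by (simp add: M01_def M0_def M1_def L2_set_def)
    show "norm (z - Re2 z) * (norm v)\<^sup>2 \<le> (sqrt 2 * B) * (norm v)\<^sup>2" using y by (intro mult_right_mono) auto
  qed (use B in \<open>auto intro!: sum_nonneg\<close>)
  finally have 1: "cmod (S v z - S v (Re2 z)) \<le> sqrt 2 * B * M01 * (norm v)\<^sup>2" by (simp add: mult_ac)
  have "(C0 * norm v)\<^sup>2 \<le> (norm (Gamma t - Gamma (t - v)))\<^sup>2"
    using A1_global[OF v, of t] A1(1) by (intro power_mono) auto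
  then have 2: "Re (S v (Re2 z)) \<ge> C0\<^sup>2 * (norm v)\<^sup>2" unfolding x S_real by (simp add: power_mult_distrib)
  have "Re (S v (Re2 z)) - Re (S v z) \<le> cmod (S v z - S v (Re2 z))"
    using abs_Re_le_cmod[of "S v z - S v (Re2 z)"] by simp
  then show ?thesis using 1 2 by (simp add: algebra_simps)
qed

text \<open>The linear part of \<open>Delta\<close> is tangential, hence orthogonal to \<open>normal_ext\<close>; only the second order remainder
  contributes.\<close>

lemma Q_upper:
  obtains Cq where "Cq \<ge> 0" "\<And>v z. z \<in> W \<Longrightarrow> cmod (Q v z) \<le> Cq * (norm v)\<^sup>2"
proof -
  have "\<forall>j. \<exists>B. (\<forall>p\<in>W. cmod (pd0 (F j) p) \<le> B) \<and> (\<forall>p\<in>W. cmod (pd1 (F j) p) \<le> B)"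
    using sf.pd_bounded by metis
  then obtain Bf where Bf: "\<And>j p. p \<in> W \<Longrightarrow> cmod (pd0 (F j) p) \<le> Bf j" "\<And>j p. p \<in> W \<Longrightarrow> cmod (pd1 (F j) p) \<le> Bf j" by metis
  define Bd where "Bd = (\<Sum>j\<in>UNIV. Bf j)"
  have Bf0: "Bf j \<ge> 0" for j using order_trans[OF norm_ge_zero Bf(1)[OF cplx_W]] .
  have "Bf j \<le> Bd" for j unfolding Bd_def using Bf0 by (intro member_le_sum) auto
  then have Bd: "cmod (pd0 (F j) p) \<le> Bd" "cmod (pd1 (F j) p) \<le> Bd" if "p \<in> W" for j p
    using Bf[OF that, of j] by (meson order_trans)+
  have Bd0: "Bd \<ge> 0" unfolding Bd_def using Bf0 by (intro sum_nonneg) auto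
  have m2: "cmod (a * b - c * d) \<le> 2 * Bd\<^sup>2" if "cmod a \<le> Bd" "cmod b \<le> Bd" "cmod c \<le> Bd" "cmod d \<le> Bd" for a b c d
  proof -
    have "cmod (a * b - c * d) \<le> cmod a * cmod b + cmod c * cmod d"
      using norm_triangle_ineq4[of "a * b" "c * d"] by (simp add: norm_mult)
    also have "\<dots> \<le> Bd * Bd + Bd * Bd" using that Bd0 by (intro add_mono mult_mono) auto
    finally show ?thesis by (simp add: power2_eq_square)
  qed
  have N: "cmod (normal_ext p j) \<le> 2 * Bd\<^sup>2" if "p \<in> W" for p j
    unfolding normal_ext_def using Bd[OF that] by (auto intro!: m2)
  define Cq where "Cq = (\<Sum>j\<in>UNIV. M1j R0 (F j) * (2 * Bd\<^sup>2))"
  show ?thesis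
  proof
    show "Cq \<ge> 0" unfolding Cq_def by (intro sum_nonneg mult_nonneg_nonneg sf.M_nonneg) auto
    fix v z assume z: "z \<in> W"
    let ?w = "z - cplx v"
    have w: "?w \<in> W" using z by (auto simp: strip_def)
    let ?D = "\<lambda>j. sf.D j ?w (cplx v)"
    have "(\<Sum>j\<in>UNIV. ?D j * normal_ext ?w j) = 0"
      unfolding sum_3 sf.D_def normal_ext_def by (simp add: algebra_simps)
    then have Qeq: "Q v z = (\<Sum>j\<in>UNIV. (Delta v z j - ?D j) * normal_ext ?w j)"
      unfolding Q_def by (simp add: left_diff_distrib sum_subtractf)
    have "cmod (Q v z) \<le> (\<Sum>j\<in>UNIV. cmod ((Delta v z j - ?D j) * normal_ext ?w j))" unfolding Qeq by (rule norm_sum)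
    also have "\<dots> \<le> (\<Sum>j\<in>UNIV. (M1j R0 (F j) * (norm v)\<^sup>2) * (2 * Bd\<^sup>2))"
      unfolding norm_mult Delta_def norm_cplx[symmetric, of v]
      by (intro sum_mono mult_mono sf.Taylor_bound[OF z refl] N w) (auto intro!: mult_nonneg_nonneg sf.M_nonneg)
    also have "\<dots> = Cq * (norm v)\<^sup>2" by (simp add: Cq_def sum_distrib_right sum_distrib_left mult_ac)
    finally show "cmod (Q v z) \<le> Cq * (norm v)\<^sup>2" .
  qed
qed

lemma kernel_ext_bound:
  assumes B: "0 < B" "B \<le> R0" "sqrt 2 * B * M01 < C0\<^sup>2"
  obtains Ck where "Ck \<ge> 0" "\<And>v z. z \<in> strip B \<times> strip B \<Longrightarrow> \<bar>fst v\<bar> \<le> pi \<Longrightarrow> \<bar>snd v\<bar> \<le> pi \<Longrightarrow> cmod (kernel_ext v z) \<le> Ck / norm v"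
proof -
  obtain Cq where Cq: "Cq \<ge> 0" "\<And>v z. z \<in> W \<Longrightarrow> cmod (Q v z) \<le> Cq * (norm v)\<^sup>2" using Q_upper by blast
  define c where "c = C0\<^sup>2 - sqrt 2 * B * M01"
  have c: "c > 0" using B by (simp add: c_def)
  show ?thesis
  proof
    show "Cq / (2 * pi * c * sqrt c) \<ge> 0" using Cq c by simp
    fix v z assume z: "z \<in> strip B \<times> strip B" and v: "\<bar>fst v\<bar> \<le> pi" "\<bar>snd v\<bar> \<le> pi"
    have zW: "z \<in> W" using z B by (auto simp: strip_def)
    show "cmod (kernel_ext v z) \<le> Cq / (2 * pi * c * sqrt c) / norm v"
    proof (cases "v = 0")
      \<comment> \<open>At \<open>v = 0\<close> the numerator \<open>Q\<close> vanishes and the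
        right side is a division by zero, so both sides are 0.\<close>
      case True
      then show ?thesis by (simp add: kernel_ext_def Q_def Delta_def flip: zero_prod_def)
    next
      case False
      then have nv: "norm v > 0" by simp
      have S: "cmod (S v z) \<ge> c * (norm v)\<^sup>2"
        using S_lower[OF z B(1,2) v] complex_Re_le_cmod[of "S v z"] by (simp add: c_def)
      have "sqrt (c * (norm v)\<^sup>2) \<le> sqrt (cmod (S v z))" using S by simp
      then have S2: "cmod (csqrt (S v z)) \<ge> sqrt c * norm v" by (simp add: real_sqrt_mult)
      have "c * (norm v)\<^sup>2 * (sqrt c * norm v) \<le> cmod (S v z) * cmod (csqrt (S v z))"
        using c by (intro mult_mono S S2) auto
      then have "cmod (Q v z) / (cmod (S v z) * cmod (csqrt (S v z))) \<le> Cq * (norm v)\<^sup>2 / (c * (norm v)\<^sup>2 * (sqrt c * norm v))"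
        using c nv Cq(1) Cq(2)[OF zW, of v] by (intro frac_le) auto
      moreover have "cmod (kernel_ext v z) = 1 / (2 * pi) * (cmod (Q v z) / (cmod (S v z) * cmod (csqrt (S v z))))"
        by (simp only: kernel_ext_def norm_mult norm_divide norm_minus_cancel) simp
      ultimately have "cmod (kernel_ext v z) \<le> 1 / (2 * pi) * (Cq * (norm v)\<^sup>2 / (c * (norm v)\<^sup>2 * (sqrt c * norm v)))"
        by (simp only:) (intro mult_left_mono, auto)
      also have "\<dots> = Cq / (2 * pi * c * sqrt c) / norm v" using nv c by (simp add: field_simps)
      finally show ?thesis .
    qed
  qed
qed

text \<open>For \<open>v \<noteq> 0\<close> the real part of \<open>S\<close> is positive, which
  excludes zeros of the denominator and crossings of the branch cut.\<close>

lemma kernel_ext_holo: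
  assumes B: "0 < B" "B \<le> R0" "sqrt 2 * B * M01 < C0\<^sup>2" and v: "\<bar>fst v\<bar> \<le> pi" "\<bar>snd v\<bar> \<le> pi" "v \<noteq> 0"
  shows "holo2_on (strip B \<times> strip B) (kernel_ext v)"
proof -
  have o: "open (strip B \<times> strip B)" by (intro open_Times open_strip)
  have sub: "strip B \<times> strip B \<subseteq> W" using B by (auto simp: strip_def)
  have sh: "z - cplx v \<in> W" if "z \<in> strip B \<times> strip B" for z using that sub by (auto simp: strip_def)
  have hF: "holo2_on (strip B \<times> strip B) (F j)" for j by (rule holo2_on_subset[OF sf.holoW o sub])
  have hD: "holo2_on (strip B \<times> strip B) (\<lambda>z. Delta v z j)" for j
    unfolding Delta_def by (intro holo2_diff hF holo2_translate[OF sf.holoW o sh])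
  have hS: "holo2_on (strip B \<times> strip B) (S v)"
    unfolding S_def power2_eq_square by (intro holo2_sum o holo2_mult hD)
  have hN: "holo2_on (strip B \<times> strip B) (\<lambda>z. normal_ext (z - cplx v) j)" for j
  proof (rule holo2_translate[OF _ o sh])
    have h01: "holo2_on W (pd0 (F j))" "holo2_on W (pd1 (F j))" for j
      using holo2_pd0[OF sf.holoW] holo2_pd1[OF sf.holoW] by auto
    show "holo2_on W (\<lambda>w. normal_ext w j)"
      by (cases "j = 1"; cases "j = 2"; simp add: normal_ext_def; intro holo2_diff holo2_mult h01)
  qed
  have hQ: "holo2_on (strip B \<times> strip B) (Q v)"
    unfolding Q_def by (intro holo2_sum o holo2_mult hD hN)
  have pos: "Re (S v z) > 0" if "z \<in> strip B \<times> strip B" for z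
  proof -
    have "(C0\<^sup>2 - sqrt 2 * B * M01) * (norm v)\<^sup>2 > 0" using B v by simp
    then show ?thesis using S_lower[OF that B(1,2) v(1,2)] by linarith
  qed
  have hC: "holo2_on (strip B \<times> strip B) (\<lambda>z. csqrt (S v z))" by (rule holo2_csqrt[OF hS pos])
  show ?thesis
    unfolding kernel_ext_def
  proof (intro holo2_mult holo2_const o holo2_divide hQ hS hC)
    show "S v z * csqrt (S v z) \<noteq> 0" if "z \<in> strip B \<times> strip B" for z
      using pos[OF that] by auto
  qed
qed

lemma kernel_ext_periodic:
  assumes "z \<in> W" "T = (of_real (2*pi), 0) \<or> T = (0, of_real (2*pi))"
  shows "kernel_ext v (z + T) = kernel_ext v z"
proof -
  have w: "z - cplx v \<in> W" using assms(1) by (auto simp: strip_def)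
  have eq: "z + T - cplx v = (z - cplx v) + T" by simp
  have p: "h (p + T) = h p" if "sf.strip_per h" "p \<in> W" for h p
    using that assms(2) by (auto simp: sf.strip_per_def)
  have F: "F j (z + T) = F j z" "F j (z + T - cplx v) = F j (z - cplx v)" for j
    unfolding eq using p[OF sf.strip_per_f] assms(1) w by auto
  have P: "pd0 (F j) (z + T - cplx v) = pd0 (F j) (z - cplx v)" "pd1 (F j) (z + T - cplx v) = pd1 (F j) (z - cplx v)" for j
    unfolding eq using p[OF sf.strip_per_pds(1)] p[OF sf.strip_per_pds(2)] w by auto
  show ?thesis by (simp only: kernel_ext_def Q_def S_def Delta_def normal_ext_def F P)
qed

text \<open>The \<open>m\<close>-th Fourier coefficient, without normalisation, of the kernel as a
  function of \<open>t\<close> at fixed displacement \<open>v\<close>.\<close>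

definition dsymbol :: "int \<times> int \<Rightarrow> real \<times> real \<Rightarrow> complex" where
  "dsymbol m v = (\<integral>t. of_real (kernK Gamma t (t - v)) * exp (- \<i> * of_real (of_int (fst m) * fst t + of_int (snd m) * snd t)) \<partial>SqM)"

lemma dsymbol_bound:
  assumes B: "0 < B" "B \<le> R0" "sqrt 2 * B * M01 < C0\<^sup>2" and \<beta>: "0 < \<beta>" "\<beta> < B"
  obtains Ca where "Ca \<ge> 0" "\<And>v m. \<bar>fst v\<bar> \<le> pi \<Longrightarrow> \<bar>snd v\<bar> \<le> pi \<Longrightarrow> cmod (dsymbol m v) \<le> Ca / norm v * exp (- \<beta> * rnorm1 m)"
proof -
  obtain Ck where Ck: "Ck \<ge> 0" "\<And>v z. z \<in> strip B \<times> strip B \<Longrightarrow> \<bar>fst v\<bar> \<le> pi \<Longrightarrow> \<bar>snd v\<bar> \<le> pi \<Longrightarrow> cmod (kernel_ext v z) \<le> Ck / norm v"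
    using kernel_ext_bound[OF B] by blast
  show ?thesis
  proof
    show "Ck * measure SqM Sq \<ge> 0" using Ck by simp
    fix v m assume v: "\<bar>fst v\<bar> \<le> pi" "\<bar>snd v\<bar> \<le> pi"
    show "cmod (dsymbol m v) \<le> Ck * measure SqM Sq / norm v * exp (- \<beta> * rnorm1 m)"
    proof (cases "v = 0")
      case True
      then show ?thesis by (simp add: dsymbol_def kernK_def)
    next
      case False
      define h where "h z = kernel_ext v z * exp ((- \<i> * of_int (fst m)) * fst z + (- \<i> * of_int (snd m)) * snd z)" for z
      have o: "open (strip B \<times> strip B)" by (intro open_Times open_strip)
      have sub: "strip B \<times> strip B \<subseteq> W" using B by (auto simp: strip_def)
      have hh: "holo2_on (strip B \<times> strip B) h"
        unfolding h_def by (intro holo2_mult kernel_ext_holo[OF B v False] holo2_exp_linear o)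
      have ex: "exp (- \<i> * of_int k * (z + of_real (2*pi)) + w) = exp (- \<i> * of_int k * z + w)" for k z w
      proof -
        have "exp (- \<i> * of_int k * (z + of_real (2*pi)) + w) = exp (- \<i> * of_int k * z + w) * exp (complex_of_real (2 * of_int (- k) * pi) * \<i>)"
          by (simp add: mult_exp_exp algebra_simps)
        also have "exp (complex_of_real (2 * of_int (- k) * pi) * \<i>) = 1" by (rule exp_integer_2pi) simp
        finally show ?thesis by simp
      qed
      have per: "h (z + (of_real (2*pi), 0)) = h z" "h (z + (0, of_real (2*pi))) = h z" if "z \<in> strip B \<times> strip B" for z
      proof -
        have zW: "z \<in> W" using that sub by blast
        show "h (z + (of_real (2*pi), 0)) = h z"
          using ex[of "fst m" "fst z" "- \<i> * of_int (snd m) * snd z"]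
          unfolding h_def kernel_ext_periodic[OF zW disjI1[OF refl]] by simp
        show "h (z + (0, of_real (2*pi))) = h z"
          using ex[of "snd m" "snd z" "- \<i> * of_int (fst m) * fst z"]
          unfolding h_def kernel_ext_periodic[OF zW disjI2[OF refl]] by (simp add: add.commute)
      qed
      \<comment> \<open>Shifting each variable by \<open>\<beta>\<close> against the sign of its
        frequency makes the exponential contribute exactly
        \<open>exp (- \<beta> * rnorm1 m)\<close>.\<close>
      define y0 y1 where "y0 = - \<beta> * sgn (real_of_int (fst m))" and "y1 = - \<beta> * sgn (real_of_int (snd m))"
      have y: "\<bar>y0\<bar> < B" "\<bar>y1\<bar> < B" using \<beta> by (auto simp: y0_def y1_def abs_mult sgn_if)
      have "dsymbol m v = (\<integral>t. h (of_real (fst t), of_real (snd t)) \<partial>SqM)"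
        unfolding dsymbol_def h_def kernel_ext_real
        by (intro Bochner_Integration.integral_cong) (auto simp: algebra_simps)
      also have "\<dots> = (\<integral>t. h (of_real (fst t) + \<i> * of_real y0, of_real (snd t) + \<i> * of_real y1) \<partial>SqM)"
        by (rule integral_shift_strip2[OF hh per y, symmetric])
      also have "cmod \<dots> \<le> (\<integral>t. cmod (h (of_real (fst t) + \<i> * of_real y0, of_real (snd t) + \<i> * of_real y1)) \<partial>SqM)"
        by simp
      also have "\<dots> \<le> (\<integral>t. Ck / norm v * exp (- \<beta> * rnorm1 m) \<partial>SqM)"
      proof (rule integral_mono_AE')
        have "cmod (h (of_real (fst t) + \<i> * of_real y0, of_real (snd t) + \<i> * of_real y1)) \<le> Ck / norm v * exp (- \<beta> * rnorm1 m)" for t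
        proof -
          have 1: "cmod (kernel_ext v (of_real (fst t) + \<i> * of_real y0, of_real (snd t) + \<i> * of_real y1)) \<le> Ck / norm v"
            using y by (intro Ck v) (auto simp: strip_def)
          have "x * sgn x = \<bar>x\<bar>" for x :: real by (simp add: sgn_if)
          then have "of_int (fst m) * y0 + of_int (snd m) * y1 = - \<beta> * rnorm1 m"
            by (simp add: y0_def y1_def norm1_def algebra_simps)
          then have 2: "cmod (exp ((- \<i> * of_int (fst m)) * (of_real (fst t) + \<i> * of_real y0) + (- \<i> * of_int (snd m)) * (of_real (snd t) + \<i> * of_real y1))) = exp (- \<beta> * rnorm1 m)"
            by (simp add: algebra_simps)
          show ?thesis unfolding h_def norm_mult fst_conv snd_conv 2 using 1 by (intro mult_right_mono) auto
        qed
        then show "AE t in SqM. cmod (h (of_real (fst t) + \<i> * of_real y0, of_real (snd t) + \<i> * of_real y1)) \<le> Ck / norm v * exp (- \<beta> * rnorm1 m)" by simp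
      qed (use Ck in auto)
      also have "\<dots> = Ck * measure SqM Sq / norm v * exp (- \<beta> * rnorm1 m)" by simp
      finally show ?thesis .
    qed
  qed
qed

end

section \<open>Translations on the torus\<close>

lemma periodic_int:
  fixes g :: "real \<Rightarrow> 'a"
  assumes "\<And>x. g (x + 2*pi) = g x" shows "g (x + 2*pi* of_int k) = g x"
proof -
  have n: "g (x + 2*pi*real n) = g x" for x n
  proof (induction n)
    case (Suc n)
    then show ?case using assms[of "x + 2*pi*real n"] by (simp add: algebra_simps)
  qed simp
  show ?thesis
  proof (cases "k \<ge> 0")
    case True
    then show ?thesis using n[of x "nat k"] by simp
  next
    case False
    then show ?thesis using n[of "x + 2*pi* of_int k" "nat (- k)"] by simp
  qed
qed

text \<open>With the shift reduced to \<open>d\<close> in one period, the window from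
  \<open>d\<close> to \<open>d + 2 * pi\<close> is cut at \<open>2 * pi\<close> and the right piece
  is moved back by one period.\<close>

lemma nn_integral_translate_period:
  fixes g :: "real \<Rightarrow> ennreal"
  assumes [measurable]: "g \<in> borel_measurable borel" and per: "\<And>x. g (x + 2*pi) = g x"
  shows "(\<integral>\<^sup>+x. g (x + c) * indicator {0..<2*pi} x \<partial>lborel) = (\<integral>\<^sup>+x. g x * indicator {0..<2*pi} x \<partial>lborel)"
proof -
  define k where "k = \<lfloor>c / (2*pi)\<rfloor>"
  define d where "d = c - 2*pi* of_int k"
  have "of_int k \<le> c / (2*pi)" "c / (2*pi) < of_int k + 1" unfolding k_def by linarith+
  then have "of_int k * (2*pi) \<le> c" "c < (of_int k + 1) * (2*pi)"
    by (simp_all add: pos_le_divide_eq pos_divide_less_eq)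
  then have d: "0 \<le> d" "d < 2*pi" by (simp_all add: d_def algebra_simps)
  have gd: "g (x + c) = g (d + x)" for x
    using periodic_int[of g "d + x" k, OF per] by (simp add: d_def algebra_simps)
  have "(\<integral>\<^sup>+x. g (x + c) * indicator {0..<2*pi} x \<partial>lborel) = (\<integral>\<^sup>+x. g (d + 1 * x) * indicator {d..<d+2*pi} (d + 1 * x) \<partial>lborel)"
    by (intro nn_integral_cong) (auto simp: gd indicator_def)
  also have "\<dots> = (\<integral>\<^sup>+y. g y * indicator {d..<d+2*pi} y \<partial>lborel)"
    using nn_integral_real_affine[of "\<lambda>y. g y * indicator {d..<d+2*pi} y" 1 d] by simp
  also have "\<dots> = (\<integral>\<^sup>+y. g y * indicator {d..<2*pi} y + g y * indicator {2*pi..<2*pi+d} y \<partial>lborel)"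
    using d by (intro nn_integral_cong) (auto simp: indicator_def)
  also have "\<dots> = (\<integral>\<^sup>+y. g y * indicator {d..<2*pi} y \<partial>lborel) + (\<integral>\<^sup>+y. g y * indicator {2*pi..<2*pi+d} y \<partial>lborel)"
    by (intro nn_integral_add) auto
  also have "(\<integral>\<^sup>+y. g y * indicator {2*pi..<2*pi+d} y \<partial>lborel) = (\<integral>\<^sup>+x. g (2*pi + 1 * x) * indicator {2*pi..<2*pi+d} (2*pi + 1 * x) \<partial>lborel)"
    using nn_integral_real_affine[of "\<lambda>y. g y * indicator {2*pi..<2*pi+d} y" 1 "2*pi"] by simp
  also have "\<dots> = (\<integral>\<^sup>+x. g x * indicator {0..<d} x \<partial>lborel)"
    using per by (intro nn_integral_cong) (auto simp: indicator_def add.commute)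
  also have "(\<integral>\<^sup>+y. g y * indicator {d..<2*pi} y \<partial>lborel) + (\<integral>\<^sup>+x. g x * indicator {0..<d} x \<partial>lborel)
     = (\<integral>\<^sup>+x. g x * indicator {d..<2*pi} x + g x * indicator {0..<d} x \<partial>lborel)"
    by (intro nn_integral_add[symmetric]) auto
  also have "\<dots> = (\<integral>\<^sup>+x. g x * indicator {0..<2*pi} x \<partial>lborel)"
    using d by (intro nn_integral_cong) (auto simp: indicator_def)
  finally show ?thesis .
qed

lemma nn_integral_SqM:
  fixes f :: "real \<times> real \<Rightarrow> ennreal"
  assumes [measurable]: "f \<in> borel_measurable borel"
  shows "(\<integral>\<^sup>+s. f s \<partial>SqM) = (\<integral>\<^sup>+x. (\<integral>\<^sup>+y. f (x, y) * indicator {0..<2*pi} y \<partial>lborel) * indicator {0..<2*pi} x \<partial>lborel)"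
proof -
  note [measurable] = assms[folded borel_prod]
  have "(\<integral>\<^sup>+s. f s \<partial>SqM) = (\<integral>\<^sup>+s. f s * indicator Sq s \<partial>(lborel \<Otimes>\<^sub>M lborel))"
    unfolding lborel_prod by (rule nn_integral_restrict_space) simp
  also have "\<dots> = (\<integral>\<^sup>+x. (\<integral>\<^sup>+y. f (x, y) * indicator Sq (x, y) \<partial>lborel) \<partial>lborel)"
    by (intro lborel.nn_integral_fst[symmetric]) (simp add: lborel_prod)
  also have "\<dots> = (\<integral>\<^sup>+x. (\<integral>\<^sup>+y. (f (x, y) * indicator {0..<2*pi} y) * indicator {0..<2*pi} x \<partial>lborel) \<partial>lborel)"
    by (intro nn_integral_cong) (auto simp: indicator_def Sq_def)
  also have "\<dots> = (\<integral>\<^sup>+x. (\<integral>\<^sup>+y. f (x, y) * indicator {0..<2*pi} y \<partial>lborel) * indicator {0..<2*pi} x \<partial>lborel)"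
    by (intro nn_integral_cong nn_integral_multc) measurable
  finally show ?thesis .
qed

definition biperiodic :: "(real \<times> real \<Rightarrow> 'a) \<Rightarrow> bool" where
  "biperiodic f \<longleftrightarrow> (\<forall>p. f (p + (2*pi, 0)) = f p \<and> f (p + (0, 2*pi)) = f p)"

lemma biperiodic_int: assumes "biperiodic f" shows "f (p + (2*pi* of_int m, 2*pi* of_int n)) = f p"
proof -
  obtain x y where p: "p = (x, y)" by (cases p)
  have "f (x + 2*pi* of_int m, z) = f (x, z)" for z
    by (rule periodic_int) (use assms in \<open>force simp: biperiodic_def\<close>)
  moreover have "f (z, y + 2*pi* of_int n) = f (z, y)" for z
    by (rule periodic_int) (use assms in \<open>force simp: biperiodic_def\<close>)
  ultimately show ?thesis by (simp add: p)
qed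

lemma nn_integral_SqM_translate:
  fixes f :: "real \<times> real \<Rightarrow> ennreal"
  assumes [measurable]: "f \<in> borel_measurable borel" and per: "biperiodic f"
  shows "(\<integral>\<^sup>+s. f (s + c) \<partial>SqM) = (\<integral>\<^sup>+s. f s \<partial>SqM)"
proof -
  note m [measurable] = assms(1)[folded borel_prod]
  obtain c0 c1 where c: "c = (c0, c1)" by (cases c)
  have per': "f (x + 2*pi, y) = f (x, y)" "f (x, y + 2*pi) = f (x, y)" for x y
    using per by (force simp: biperiodic_def)+
  have m2: "(\<lambda>s. f (s + c)) \<in> borel_measurable borel"
    unfolding borel_prod[symmetric] c plus_prod_def by measurable
  have "(\<integral>\<^sup>+s. f (s + c) \<partial>SqM) = (\<integral>\<^sup>+x. (\<integral>\<^sup>+y. f (x + c0, y + c1) * indicator {0..<2*pi} y \<partial>lborel) * indicator {0..<2*pi} x \<partial>lborel)"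
    unfolding nn_integral_SqM[OF m2] by (simp add: c)
  also have "\<dots> = (\<integral>\<^sup>+x. (\<integral>\<^sup>+y. f (x + c0, y) * indicator {0..<2*pi} y \<partial>lborel) * indicator {0..<2*pi} x \<partial>lborel)"
    by (intro nn_integral_cong arg_cong2[where f = "(*)"] nn_integral_translate_period per' refl) measurable
  also have "\<dots> = (\<integral>\<^sup>+x. (\<integral>\<^sup>+y. f (x, y) * indicator {0..<2*pi} y \<partial>lborel) * indicator {0..<2*pi} x \<partial>lborel)"
    by (intro nn_integral_translate_period) (simp_all add: per')
  also have "\<dots> = (\<integral>\<^sup>+s. f s \<partial>SqM)" by (rule nn_integral_SqM[symmetric]) fact
  finally show ?thesis .
qed

text \<open>The representative in \<open>Sq\<close> modulo periods. Composition with it makes any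
  function biperiodic and leaves its values on \<open>Sq\<close> unchanged.\<close>

definition reduce_mod :: "real \<times> real \<Rightarrow> real \<times> real" where
  "reduce_mod p = (fst p - 2*pi* of_int \<lfloor>fst p / (2*pi)\<rfloor>, snd p - 2*pi* of_int \<lfloor>snd p / (2*pi)\<rfloor>)"

lemma reduce_mod_measurable [measurable]: "reduce_mod \<in> borel_measurable borel"
  unfolding reduce_mod_def[abs_def] borel_prod[symmetric] by measurable

lemma biperiodic_reduce_mod: "biperiodic (\<lambda>p. h (reduce_mod p))"
proof -
  have "\<lfloor>(x + 2*pi) / (2*pi)\<rfloor> = \<lfloor>x / (2*pi)\<rfloor> + 1" for x :: real
  proof -
    have "(x + 2*pi) / (2*pi) = x / (2*pi) + 1" by (simp add: field_simps)
    then show ?thesis by (simp only:) simp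
  qed
  then show ?thesis by (simp add: biperiodic_def reduce_mod_def algebra_simps)
qed

lemma reduce_mod_Sq: "p \<in> Sq \<Longrightarrow> reduce_mod p = p"
proof -
  have "\<lfloor>x / (2*pi)\<rfloor> = 0" if "0 \<le> x" "x < 2*pi" for x :: real
    using that by (intro floor_unique) auto
  then show "p \<in> Sq \<Longrightarrow> reduce_mod p = p" by (cases p) (auto simp: reduce_mod_def Sq_def)
qed

lemma biperiodic_reduce_mod_eq: "biperiodic f \<Longrightarrow> f (reduce_mod p) = f p"
  using biperiodic_int[of f p "- \<lfloor>fst p / (2*pi)\<rfloor>" "- \<lfloor>snd p / (2*pi)\<rfloor>"]
  by (cases p) (simp add: reduce_mod_def)

lemma add_measurable_SqM [measurable]: "(\<lambda>s. s + c) \<in> SqM \<rightarrow>\<^sub>M borel" for c :: "real \<times> real"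
  by (intro measurable_restrict_space1) simp

text \<open>Translation invariance for indicator functions says that
  \<open>reduce_mod (s + c)\<close> and \<open>s\<close> have the same distribution under
  \<open>SqM\<close>, and Bochner integrals depend only on the distribution.\<close>

lemma integral_SqM_translate:
  fixes f :: "real \<times> real \<Rightarrow> complex"
  assumes f: "f \<in> borel_measurable borel" and per: "biperiodic f"
  shows "(\<integral>s. f (s + c) \<partial>SqM) = (\<integral>s. f s \<partial>SqM)"
proof -
  have m: "(\<lambda>s. reduce_mod (s + c)) \<in> SqM \<rightarrow>\<^sub>M borel" by measurable
  have id: "(\<lambda>s. s) \<in> SqM \<rightarrow>\<^sub>M borel" by (intro measurable_restrict_space1) simp
  have "distr SqM borel (\<lambda>s. reduce_mod (s + c)) = distr SqM borel (\<lambda>s. s)"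
  proof (rule measure_eqI)
    fix E assume "E \<in> sets (distr SqM borel (\<lambda>s. reduce_mod (s + c)))"
    then have E: "E \<in> sets borel" by simp
    have "emeasure (distr SqM borel (\<lambda>s. reduce_mod (s + c))) E = (\<integral>\<^sup>+s. indicator E (reduce_mod (s + c)) \<partial>SqM)"
      using E m by (simp add: nn_integral_distr flip: nn_integral_indicator)
    also have "\<dots> = (\<integral>\<^sup>+s. indicator E (reduce_mod s) \<partial>SqM)"
      using E by (intro nn_integral_SqM_translate[where f = "\<lambda>s. indicator E (reduce_mod s)"] biperiodic_reduce_mod) simp
    also have "\<dots> = (\<integral>\<^sup>+s. indicator E s \<partial>SqM)"
      by (intro nn_integral_cong) (simp add: reduce_mod_Sq)
    also have "\<dots> = emeasure (distr SqM borel (\<lambda>s. s)) E"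
      using E id by (simp add: nn_integral_distr flip: nn_integral_indicator)
    finally show "emeasure (distr SqM borel (\<lambda>s. reduce_mod (s + c))) E = emeasure (distr SqM borel (\<lambda>s. s)) E" .
  qed simp
  then have "(\<integral>s. f (reduce_mod (s + c)) \<partial>SqM) = (\<integral>s. f s \<partial>SqM)"
    using integral_distr[OF m f] integral_distr[OF id f] by simp
  then show ?thesis by (simp add: biperiodic_reduce_mod_eq[OF per])
qed

text \<open>Displacements \<open>t - e\<close> on the torus are represented by \<open>disp s\<close> with \<open>s \<in> Sq\<close>. Both components are then at
  most \<open>pi\<close> in modulus, where \<open>zeta\<close> dominates the Euclidean norm.\<close>

definition disp :: "real \<times> real \<Rightarrow> real \<times> real" where
  "disp s = (pi - fst s, pi - snd s)"

lemma disp_bound: "s \<in> Sq \<Longrightarrow> \<bar>fst (disp s)\<bar> \<le> pi" "s \<in> Sq \<Longrightarrow> \<bar>snd (disp s)\<bar> \<le> pi"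
  by (auto simp: disp_def Sq_def abs_le_iff)

lemma disp_measurable [measurable]: "disp \<in> borel_measurable borel"
  unfolding disp_def[abs_def] borel_prod[symmetric] by measurable

text \<open>By the arithmetic-geometric mean inequality, \<open>1 / norm (x, y)\<close> is at most
  \<open>|x| powr (-1/2) * |y| powr (-1/2)\<close>, a product of functions integrable in one
  variable.\<close>

lemma inverse_norm_disp_integrable: "integrable SqM (\<lambda>s. 1 / norm (disp s))"
proof (rule integrableI_bounded)
  show "(\<lambda>s. 1 / norm (disp s)) \<in> borel_measurable SqM"
    by (intro measurable_restrict_space1) measurable
  \<comment> \<open>At 0 \<open>powr\<close> returns 0, which would spoil the bound on the axes; the
    value \<open>top\<close> there repairs it and costs nothing, as a point has measure 0.\<close>
  define h :: "real \<Rightarrow> ennreal" where "h x = ennreal (\<bar>x\<bar> powr (-1/2)) + top * indicator {0} x" for x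
  have hm [measurable]: "h \<in> borel_measurable borel" unfolding h_def by measurable
  have le: "ennreal (1 / norm (x, y)) \<le> h x * h y" for x y
  proof (cases "x = 0 \<or> y = 0")
    case True
    have "h 0 = top" by (simp add: h_def)
    moreover have "h z \<noteq> 0" for z
      by (cases "z = 0") (auto simp: h_def ennreal_eq_0_iff)
    ultimately have "h x * h y = top" using True by (auto simp: ennreal_mult_top ennreal_top_mult)
    then show ?thesis by simp
  next
    case False
    have "\<bar>x\<bar> * \<bar>y\<bar> \<le> (norm (x, y))\<^sup>2"
    proof -
      have "2 * (\<bar>x\<bar> * \<bar>y\<bar>) \<le> x\<^sup>2 + y\<^sup>2" using sum_squares_bound[of "\<bar>x\<bar>" "\<bar>y\<bar>"] by (simp add: mult.assoc)
      moreover have "0 \<le> \<bar>x\<bar> * \<bar>y\<bar>" by simp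
      moreover have "(norm (x, y))\<^sup>2 = x\<^sup>2 + y\<^sup>2" by (simp add: norm_Pair)
      ultimately show ?thesis by linarith
    qed
    then have "sqrt (\<bar>x\<bar> * \<bar>y\<bar>) \<le> norm (x, y)" 
      by (intro real_le_lsqrt) auto
    then have "1 / norm (x, y) \<le> 1 / sqrt (\<bar>x\<bar> * \<bar>y\<bar>)" using False by (intro frac_le) auto
    also have "\<dots> = \<bar>x\<bar> powr (-1/2) * \<bar>y\<bar> powr (-1/2)"
      using False by (simp add: powr_minus_divide powr_half_sqrt real_sqrt_mult)
    finally have "ennreal (1 / norm (x, y)) \<le> ennreal (\<bar>x\<bar> powr (-1/2) * \<bar>y\<bar> powr (-1/2))" by (rule ennreal_leI)
    also have "\<dots> \<le> h x * h y" using False by (simp add: h_def ennreal_mult)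
    finally show ?thesis .
  qed
  define I where "I = (\<integral>\<^sup>+x. h (pi - x) * indicator {0..<2*pi} x \<partial>lborel)"
  have I: "I < top"
  proof -
    have "I = (\<integral>\<^sup>+x. h (pi + (-1) * x) * indicator {-pi<..pi} (pi + (-1) * x) \<partial>lborel)"
      unfolding I_def by (intro nn_integral_cong) (auto simp: indicator_def)
    also have "\<dots> = (\<integral>\<^sup>+y. h y * indicator {-pi<..pi} y \<partial>lborel)"
      using nn_integral_real_affine[of "\<lambda>y. h y * indicator {-pi<..pi} y" "-1" pi] by simp
    also have "\<dots> \<le> (\<integral>\<^sup>+y. ((ennreal (y powr (-1/2)) * indicator {0..pi} y) + (ennreal ((-y) powr (-1/2)) * indicator {0..pi} (-y))) + top * indicator {0} y \<partial>lborel)"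
      by (intro nn_integral_mono) (auto simp: h_def indicator_def)
    also have "\<dots> = (\<integral>\<^sup>+y. ennreal (y powr (-1/2)) * indicator {0..pi} y \<partial>lborel) + (\<integral>\<^sup>+y. ennreal ((-y) powr (-1/2)) * indicator {0..pi} (-y) \<partial>lborel) + (\<integral>\<^sup>+y. top * indicator {0} (y::real) \<partial>lborel)"
      by (simp add: nn_integral_add)
    also have "(\<integral>\<^sup>+y. ennreal ((-y) powr (-1/2)) * indicator {0..pi} (-y) \<partial>lborel) = (\<integral>\<^sup>+y. ennreal (y powr (-1/2)) * indicator {0..pi} y \<partial>lborel)"
      using nn_integral_real_affine[of "\<lambda>y. ennreal (y powr (-1/2)) * indicator {0..pi} y" "-1" 0] by simp
    also have "(\<integral>\<^sup>+y. top * indicator {0} (y::real) \<partial>lborel) = 0"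
      by (simp add: nn_integral_cmult_indicator)
    also have "(\<integral>\<^sup>+y. ennreal (y powr (-1/2)) * indicator {0..pi} y \<partial>lborel) = ennreal (pi powr (-1/2 + 1) / (-1/2 + 1))"
      by (rule nn_integral_has_integral_lebesgue'[OF _ has_integral_powr_from_0]) auto
    finally show ?thesis by (auto intro: le_less_trans simp flip: ennreal_plus)
  qed
  have "(\<integral>\<^sup>+s. ennreal (norm (1 / norm (disp s))) \<partial>SqM) \<le> (\<integral>\<^sup>+s. h (pi - fst s) * h (pi - snd s) \<partial>SqM)"
    using le by (intro nn_integral_mono) (simp add: disp_def)
  also have "\<dots> = (\<integral>\<^sup>+x. (\<integral>\<^sup>+y. h (pi - x) * h (pi - y) * indicator {0..<2*pi} y \<partial>lborel) * indicator {0..<2*pi} x \<partial>lborel)"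
    by (subst nn_integral_SqM) (simp_all flip: borel_prod)
  also have "\<dots> = (\<integral>\<^sup>+x. (h (pi - x) * indicator {0..<2*pi} x) * I \<partial>lborel)"
    unfolding I_def mult.assoc by (intro nn_integral_cong) (simp add: nn_integral_cmult mult_ac)
  also have "\<dots> = I * I" unfolding I_def by (rule nn_integral_multc) measurable
  also have "\<dots> < \<infinity>" using I by (simp add: ennreal_mult_less_top)
  finally show "(\<integral>\<^sup>+s. ennreal (norm (1 / norm (disp s))) \<partial>SqM) < \<infinity>" .
qed

section \<open>Fourier coefficients of integrable functions\<close>

lemma sqint_CZ_finite_large:
  assumes y: "sqint countZ2 y" and e: "e > 0" shows "finite {l. cmod (y l) > e}"
proof (rule ccontr)
  assume inf: "infinite {l. cmod (y l) > e}"
  obtain n :: nat where n: "real n * e\<^sup>2 > sqnorm countZ2 y" using reals_Archimedean3[of "e\<^sup>2"] e by auto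
  obtain T where T: "T \<subseteq> {l. cmod (y l) > e}" "finite T" "card T = n"
    using infinite_arbitrarily_large[OF inf] by blast
  have "real n * e\<^sup>2 = (\<Sum>l\<in>T. e\<^sup>2)" using T by simp
  also have "\<dots> \<le> (\<Sum>l\<in>T. (cmod (y l))\<^sup>2)" using T(1) e by (intro sum_mono power_mono) auto
  also have "\<dots> \<le> sqnorm countZ2 y" by (rule sum_le_sqnorm_CZ[OF y T(2)])
  finally show False using n by simp
qed

text \<open>Truncation at height \<open>n\<close> gives a bounded function with square-summable
  coefficients, and the remainder moves every coefficient by at most \<open>e / 2\<close>.
  Integrable functions have to be covered, since the bound \<open>1 / norm (disp s)\<close>
  available for the kernel is not square integrable.\<close>

lemma Riemann_Lebesgue:
  assumes g: "integrable SqM g" and e: "e > 0" shows "finite {l. cmod (fcoef g l) > e}"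
proof -
  have gm [measurable]: "g \<in> borel_measurable SqM" using g by (rule borel_measurable_integrable)
  define G where "G n s = (if cmod (g s) \<le> real n then g s else 0)" for n s
  have Gm [measurable]: "G n \<in> borel_measurable SqM" for n unfolding G_def by measurable
  have "(\<lambda>n. \<integral>s. cmod (g s - G n s) \<partial>SqM) \<longlonglongrightarrow> (\<integral>s. 0 \<partial>SqM)"
  proof (rule integral_dominated_convergence[where w = "\<lambda>s. cmod (g s)"])
    show "AE s in SqM. (\<lambda>n. cmod (g s - G n s)) \<longlonglongrightarrow> 0"
    proof (rule AE_I2)
      fix s
      obtain N :: nat where "cmod (g s) \<le> real N" using real_arch_simple by blast
      then have "\<forall>n\<ge>N. cmod (g s - G n s) = 0" by (auto simp: G_def)
      then show "(\<lambda>n. cmod (g s - G n s)) \<longlonglongrightarrow> 0"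
        by (intro tendsto_eventually) (auto simp: eventually_sequentially)
    qed
  qed (use g in \<open>auto simp: G_def\<close>)
  then have "\<forall>\<^sub>F n in sequentially. (\<integral>s. cmod (g s - G n s) \<partial>SqM) < e/2"
    using e by (intro order_tendstoD(2)[where y = 0]) auto
  then obtain n where n: "(\<integral>s. cmod (g s - G n s) \<partial>SqM) < e/2" by (auto simp: eventually_sequentially)
  have Gs: "sqint SqM (G n)" by (rule sqint_bounded[where B = "real n"]) (auto simp: G_def)
  have Gi: "integrable SqM (G n)"
    by (rule Bochner_Integration.integrable_bound[OF g]) (auto simp: G_def)
  have le: "cmod (fcoef g l) \<le> cmod (fcoef (G n) l) + e/2" for l
  proof -
    have ib: "integrable SqM (\<lambda>s. u s * cnj (ebas l s))" if "integrable SqM u" for u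
    proof (rule Bochner_Integration.integrable_bound[OF that])
      have "cmod (u s * cnj (ebas l s)) \<le> cmod (u s)" for s
      proof -
        have "1 / (2 * pi) \<le> 1" using pi_ge_two by simp
        then show ?thesis unfolding norm_mult complex_mod_cnj cmod_ebas by (rule mult_left_le) simp
      qed
      then show "AE s in SqM. norm (u s * cnj (ebas l s)) \<le> norm (u s)" by simp
    qed (use borel_measurable_integrable[OF that] in measurable)
    have "fcoef g l - fcoef (G n) l = (\<integral>s. (g s - G n s) * cnj (ebas l s) \<partial>SqM)"
      unfolding fcoef_eq left_diff_distrib using ib[OF g] ib[OF Gi] by simp
    also have "cmod \<dots> \<le> (\<integral>s. cmod ((g s - G n s) * cnj (ebas l s)) \<partial>SqM)" by simp
    also have "\<dots> \<le> (\<integral>s. cmod (g s - G n s) \<partial>SqM)"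
    proof (rule integral_mono_AE')
      have "1 / (2 * pi) \<le> 1" using pi_ge_two by simp
      then have "cmod ((g s - G n s) * cnj (ebas l s)) \<le> cmod (g s - G n s)" for s
        unfolding norm_mult complex_mod_cnj cmod_ebas by (rule mult_left_le) simp
      then show "AE s in SqM. cmod ((g s - G n s) * cnj (ebas l s)) \<le> cmod (g s - G n s)" by simp
    qed (use g Gi in auto)
    finally show ?thesis using n norm_triangle_sub[of "fcoef g l" "fcoef (G n) l"] by linarith
  qed
  have "{l. cmod (fcoef g l) > e} \<subseteq> {l. cmod (fcoef (G n) l) > e/2}"
    using le by (auto simp: subset_iff) (smt (verit) field_sum_of_halves)
  then show ?thesis
    using sqint_CZ_finite_large[OF Parseval(1)[OF Gs], of "e/2"] e finite_subset by auto
qed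

section \<open>The matrix of the integral operator\<close>

context torus_bie
begin

lemma Gamma_continuous: "continuous_on UNIV Gamma"
  using diff by (simp add: continuous_at_imp_continuous_on differentiable_imp_continuous_within)

lemma dGamma_continuous: "continuous_on UNIV (dGamma0 Gamma)" "continuous_on UNIV (dGamma1 Gamma)"
proof -
  have c: "continuous_on W (pd0 (F j))" "continuous_on W (pd1 (F j))" for j
    using pd0_continuous[OF sf.holoW] pd1_continuous[OF sf.holoW] by auto
  have "continuous_on UNIV (\<lambda>e. \<chi> j. Re (pd0 (F j) (cplx e)))" "continuous_on UNIV (\<lambda>e. \<chi> j. Re (pd1 (F j) (cplx e)))"
    using cplx_W by (intro continuous_on_vec_lambda continuous_intros continuous_on_compose2[OF c(1)] continuous_on_compose2[OF c(2)]; auto)+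
  then show "continuous_on UNIV (dGamma0 Gamma)" "continuous_on UNIV (dGamma1 Gamma)"
    by (simp_all add: pd_real)
qed

text \<open>The kernel may be discontinuous on the diagonal, but it is a quotient of continuous
  functions, and total division preserves measurability.\<close>

lemma kernK_measurable2: "(\<lambda>p. kernK Gamma (fst p) (snd p)) \<in> borel_measurable borel"
proof -
  have G: "continuous_on UNIV (\<lambda>p. Gamma (fst p) - Gamma (snd p))"
    by (intro continuous_intros continuous_on_compose2[OF Gamma_continuous]) auto
  have "continuous_on UNIV (\<lambda>p :: (real \<times> real) \<times> (real \<times> real). cross3 (dGamma0 Gamma (snd p)) (dGamma1 Gamma (snd p)))"
    by (intro continuous_on_cross continuous_on_compose2[OF dGamma_continuous(1)] continuous_on_compose2[OF dGamma_continuous(2)] continuous_intros) auto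
  then have "(\<lambda>p. (Gamma (fst p) - Gamma (snd p)) \<bullet> cross3 (dGamma0 Gamma (snd p)) (dGamma1 Gamma (snd p))) \<in> borel_measurable borel"
    by (intro borel_measurable_continuous_onI continuous_on_inner G)
  moreover have "(\<lambda>p. norm (Gamma (fst p) - Gamma (snd p)) ^ 3) \<in> borel_measurable borel"
    by (intro borel_measurable_continuous_onI continuous_intros G)
  ultimately show ?thesis unfolding kernK_def by (intro borel_measurable_times borel_measurable_divide borel_measurable_const)
qed

lemma kernK_measurable [measurable (raw)]:
  assumes "f \<in> M \<rightarrow>\<^sub>M borel" "g \<in> M \<rightarrow>\<^sub>M borel"
  shows "(\<lambda>x. kernK Gamma (f x) (g x)) \<in> borel_measurable M"
proof -
  have "(\<lambda>x. (f x, g x)) \<in> M \<rightarrow>\<^sub>M borel" using measurable_Pair[OF assms] by (simp only: borel_prod)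
  from measurable_compose[OF this kernK_measurable2] show ?thesis by simp
qed

lemma Gamma_biperiodic: "biperiodic Gamma"
  unfolding biperiodic_def using Gamma_periodic[of _ 1 0] Gamma_periodic[of _ 0 1] by simp

lemma dGamma_periodic: "dGamma0 Gamma (e + (2*pi, 0)) = dGamma0 Gamma e" "dGamma0 Gamma (e + (0, 2*pi)) = dGamma0 Gamma e"
  "dGamma1 Gamma (e + (2*pi, 0)) = dGamma1 Gamma e" "dGamma1 Gamma (e + (0, 2*pi)) = dGamma1 Gamma e"
proof -
  have p: "complex_of_real (dGamma0 Gamma (e + T) $ j) = of_real (dGamma0 Gamma e $ j)"
    "complex_of_real (dGamma1 Gamma (e + T) $ j) = of_real (dGamma1 Gamma e $ j)"
    if "T = (2*pi, 0) \<or> T = (0, 2*pi)" for T j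
  proof -
    have "cplx (e + T) = cplx e + (of_real (2*pi), 0) \<or> cplx (e + T) = cplx e + (0, of_real (2*pi))" using that by auto
    then show "complex_of_real (dGamma0 Gamma (e + T) $ j) = of_real (dGamma0 Gamma e $ j)"
      "complex_of_real (dGamma1 Gamma (e + T) $ j) = of_real (dGamma1 Gamma e $ j)"
      unfolding pd_real[symmetric] using sf.strip_per_pds[of j] cplx_W[of e] by (auto simp only: sf.strip_per_def)
  qed
  show "dGamma0 Gamma (e + (2*pi, 0)) = dGamma0 Gamma e" "dGamma0 Gamma (e + (0, 2*pi)) = dGamma0 Gamma e"
  "dGamma1 Gamma (e + (2*pi, 0)) = dGamma1 Gamma e" "dGamma1 Gamma (e + (0, 2*pi)) = dGamma1 Gamma e"
    using p[of "(2*pi, 0)"] p[of "(0, 2*pi)"] by (simp_all add: vec_eq_iff)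
qed

lemma kernK_biperiodic: "biperiodic (\<lambda>e. kernK Gamma t e)" "biperiodic (\<lambda>t. kernK Gamma t e)"
  using Gamma_biperiodic unfolding biperiodic_def kernK_def by (simp_all add: dGamma_periodic)

lemma ebas_biperiodic: "biperiodic (ebas k)"
proof -
  have ex: "exp (\<i> * of_real (of_int n * (x + 2*pi) + w)) = exp (\<i> * of_real (of_int n * x + w))" for n x w
  proof -
    have "exp (\<i> * of_real (of_int n * (x + 2*pi) + w)) = exp (\<i> * of_real (of_int n * x + w)) * exp (complex_of_real (2 * of_int n * pi) * \<i>)"
      unfolding mult_exp_exp by (rule arg_cong[where f = exp]) (simp add: algebra_simps)
    also have "exp (complex_of_real (2 * of_int n * pi) * \<i>) = 1" by (rule exp_integer_2pi) simp
    finally show ?thesis by simp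
  qed
  have ex': "exp (\<i> * of_real (w + of_int n * (x + 2*pi))) = exp (\<i> * of_real (w + of_int n * x))" for n x w
    unfolding add.commute[of w] by (rule ex)
  show ?thesis unfolding biperiodic_def ebas_def by (simp only: fst_add snd_add fst_conv snd_conv add_0_right ex ex') simp
qed

lemma translate_disp: "s + (t - (pi, pi)) = t - disp s"
  by (auto simp: disp_def prod_eq_iff)

text \<open>The half-widths for which \<open>S_lower\<close> keeps \<open>S\<close> in the right
  half plane.\<close>

definition admissible :: "real \<Rightarrow> bool" where
  "admissible B \<longleftrightarrow> 0 < B \<and> B \<le> R0 \<and> sqrt 2 * B * M01 < C0\<^sup>2"

lemma kernK_bound:
  assumes "admissible B"
  obtains Ck where "Ck \<ge> 0" "\<And>t s. s \<in> Sq \<Longrightarrow> \<bar>kernK Gamma t (t - disp s)\<bar> \<le> Ck / norm (disp s)"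
    "\<And>e s. s \<in> Sq \<Longrightarrow> \<bar>kernK Gamma (e - disp s) e\<bar> \<le> Ck / norm (disp s)"
proof -
  obtain Ck where Ck: "Ck \<ge> 0" "\<And>v z. z \<in> strip B \<times> strip B \<Longrightarrow> \<bar>fst v\<bar> \<le> pi \<Longrightarrow> \<bar>snd v\<bar> \<le> pi \<Longrightarrow> cmod (kernel_ext v z) \<le> Ck / norm v"
    using kernel_ext_bound assms unfolding admissible_def by metis
  have real: "cplx t \<in> strip B \<times> strip B" for t using assms by (simp add: strip_def admissible_def)
  have 1: "\<bar>kernK Gamma t (t - v)\<bar> \<le> Ck / norm v" if "\<bar>fst v\<bar> \<le> pi" "\<bar>snd v\<bar> \<le> pi" for t v
    using Ck(2)[OF real that, of t] unfolding kernel_ext_real by simp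
  show ?thesis
  proof
    show "\<bar>kernK Gamma t (t - disp s)\<bar> \<le> Ck / norm (disp s)" if "s \<in> Sq" for t s
      using 1[of "disp s" t] disp_bound[OF that] by simp
    \<comment> \<open>The same bound with base point \<open>e - disp s\<close> and displacement
      \<open>- disp s\<close>.\<close>
    show "\<bar>kernK Gamma (e - disp s) e\<bar> \<le> Ck / norm (disp s)" if "s \<in> Sq" for e s
      using 1[of "- disp s" "e - disp s"] disp_bound[OF that] by simp
  qed fact
qed

lemma kernK_Schur_bounds:
  assumes "admissible B"
  obtains C where "C \<ge> 0" "\<And>t. (\<integral>\<^sup>+e. ennreal \<bar>kernK Gamma t e\<bar> \<partial>SqM) \<le> ennreal C"
    "\<And>e. (\<integral>\<^sup>+t. ennreal \<bar>kernK Gamma t e\<bar> \<partial>SqM) \<le> ennreal C"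
proof -
  obtain Ck where Ck: "Ck \<ge> 0" "\<And>t s. s \<in> Sq \<Longrightarrow> \<bar>kernK Gamma t (t - disp s)\<bar> \<le> Ck / norm (disp s)"
    "\<And>e s. s \<in> Sq \<Longrightarrow> \<bar>kernK Gamma (e - disp s) e\<bar> \<le> Ck / norm (disp s)"
    using kernK_bound[OF assms] by blast
  define C where "C = (\<integral>s. Ck / norm (disp s) \<partial>SqM)"
  have i: "integrable SqM (\<lambda>s. Ck / norm (disp s))"
    using integrable_mult_right[OF inverse_norm_disp_integrable, of Ck] by simp
  have C: "(\<integral>\<^sup>+s. ennreal (Ck / norm (disp s)) \<partial>SqM) = ennreal C"
    unfolding C_def using Ck(1) by (intro nn_integral_eq_integral[OF i]) auto
  show ?thesis
  proof
    show "C \<ge> 0" unfolding C_def using Ck(1) by (intro Bochner_Integration.integral_nonneg) auto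
    show "(\<integral>\<^sup>+e. ennreal \<bar>kernK Gamma t e\<bar> \<partial>SqM) \<le> ennreal C" for t
    proof -
      have "(\<integral>\<^sup>+e. ennreal \<bar>kernK Gamma t e\<bar> \<partial>SqM) = (\<integral>\<^sup>+s. ennreal \<bar>kernK Gamma t (s + (t - (pi, pi)))\<bar> \<partial>SqM)"
        by (rule nn_integral_SqM_translate[symmetric]) (use kernK_biperiodic(1)[of t] in \<open>auto simp: biperiodic_def\<close>)
      also have "\<dots> \<le> (\<integral>\<^sup>+s. ennreal (Ck / norm (disp s)) \<partial>SqM)"
        unfolding translate_disp by (intro nn_integral_mono ennreal_leI Ck) simp
      finally show ?thesis using C by simp
    qed
    show "(\<integral>\<^sup>+t. ennreal \<bar>kernK Gamma t e\<bar> \<partial>SqM) \<le> ennreal C" for e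
    proof -
      have "(\<integral>\<^sup>+t. ennreal \<bar>kernK Gamma t e\<bar> \<partial>SqM) = (\<integral>\<^sup>+s. ennreal \<bar>kernK Gamma (s + (e - (pi, pi))) e\<bar> \<partial>SqM)"
        by (rule nn_integral_SqM_translate[symmetric]) (use kernK_biperiodic(2)[of e] in \<open>auto simp: biperiodic_def\<close>)
      also have "\<dots> \<le> (\<integral>\<^sup>+s. ennreal (Ck / norm (disp s)) \<partial>SqM)"
        unfolding translate_disp by (intro nn_integral_mono ennreal_leI Ck) simp
      finally show ?thesis using C by simp
    qed
  qed
qed

lemma Kop_eq: "Kop Gamma \<phi> t = (\<integral>e. of_real (kernK Gamma t e) * \<phi> e \<partial>SqM)"
  by (simp add: Kop_def set_integral_Sq)

lemma id_SqM_measurable [measurable]: "(\<lambda>x. x) \<in> SqM \<rightarrow>\<^sub>M borel"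
  by (intro measurable_restrict_space1) simp

lemma id_pair_measurable [measurable]: "fst \<in> SqM \<Otimes>\<^sub>M SqM \<rightarrow>\<^sub>M borel" "snd \<in> SqM \<Otimes>\<^sub>M SqM \<rightarrow>\<^sub>M borel"
  using measurable_compose[OF measurable_fst id_SqM_measurable] measurable_compose[OF measurable_snd id_SqM_measurable] by auto

lemma kernel_pair_measurable: "(\<lambda>(t, e). complex_of_real (kernK Gamma t e)) \<in> borel_measurable (SqM \<Otimes>\<^sub>M SqM)"
  unfolding case_prod_beta by measurable

lemma Kop_sqint:
  assumes "admissible B" "sqint SqM \<phi>" shows "sqint SqM (Kop Gamma \<phi>)"
proof -
  obtain C where C: "C \<ge> 0" "\<And>t. (\<integral>\<^sup>+e. ennreal \<bar>kernK Gamma t e\<bar> \<partial>SqM) \<le> ennreal C"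
    "\<And>e. (\<integral>\<^sup>+t. ennreal \<bar>kernK Gamma t e\<bar> \<partial>SqM) \<le> ennreal C" using kernK_Schur_bounds[OF assms(1)] by blast
  show ?thesis
    unfolding Kop_eq[abs_def]
    by (rule Schur_test(1)[OF sigma_finite_SqM sigma_finite_SqM kernel_pair_measurable _ C(1) _ C(1) assms(2)])
      (use C in auto)
qed

text \<open>The \<open>k\<close>-th coefficient of \<open>Kop Gamma u\<close> is the integral of
  \<open>u\<close> against a bounded function \<open>psi\<close>. The coefficients of
  \<open>cnj psi\<close> are, up to conjugation, the \<open>k\<close>-th row of \<open>Kmat\<close>,
  so Parseval's identity for inner products yields the matrix product.\<close>

lemma fcoef_Kop:
  assumes adm: "admissible B" and \<phi>: "sqint SqM \<phi>"
  shows "fcoef (Kop Gamma \<phi>) k = mat_apply (Kmat Gamma) (fcoef \<phi>) k"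
proof -
  obtain C where C: "C \<ge> 0" "\<And>t. (\<integral>\<^sup>+e. ennreal \<bar>kernK Gamma t e\<bar> \<partial>SqM) \<le> ennreal C"
    "\<And>e. (\<integral>\<^sup>+t. ennreal \<bar>kernK Gamma t e\<bar> \<partial>SqM) \<le> ennreal C" using kernK_Schur_bounds[OF adm] by blast
  interpret P: pair_sigma_finite SqM SqM by (intro pair_sigma_finite.intro sigma_finite_SqM)
  define psi where "psi e = (\<integral>t. of_real (kernK Gamma t e) * cnj (ebas k t) \<partial>SqM)" for e
  have km [measurable]: "(\<lambda>p. complex_of_real (kernK Gamma (fst p) (snd p))) \<in> borel_measurable (SqM \<Otimes>\<^sub>M SqM)"
    using kernel_pair_measurable by (simp add: case_prod_beta)
  have km' [measurable]: "(\<lambda>p. complex_of_real (kernK Gamma (snd p) (fst p))) \<in> borel_measurable (SqM \<Otimes>\<^sub>M SqM)"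
    by measurable
  have psi_m: "psi \<in> borel_measurable SqM"
    unfolding psi_def by (rule SqM.borel_measurable_lebesgue_integral) (simp add: case_prod_beta)
  have psi_b: "cmod (psi e) \<le> C" for e
  proof -
    have "ennreal (cmod (psi e)) \<le> (\<integral>\<^sup>+t. ennreal (cmod (of_real (kernK Gamma t e) * cnj (ebas k t))) \<partial>SqM)"
      unfolding psi_def by (rule norm_integral_le_nn_integral)
    also have "\<dots> \<le> (\<integral>\<^sup>+t. ennreal \<bar>kernK Gamma t e\<bar> \<partial>SqM)"
    proof (intro nn_integral_mono ennreal_leI)
      fix t
      have "1 / (2 * pi) \<le> 1" using pi_ge_two by simp
      then show "cmod (of_real (kernK Gamma t e) * cnj (ebas k t)) \<le> \<bar>kernK Gamma t e\<bar>"
        unfolding norm_mult complex_mod_cnj cmod_ebas norm_of_real by (rule mult_left_le) simp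
    qed
    finally have "ennreal (cmod (psi e)) \<le> ennreal C" using C(3)[of e] by (rule order_trans)
    then show ?thesis using C(1) by simp
  qed
  have psi_s: "sqint SqM psi" by (rule sqint_bounded[OF psi_m psi_b])
  have rep: "fcoef (Kop Gamma u) k = (\<integral>e. u e * psi e \<partial>SqM)" if u: "sqint SqM u" for u
  proof -
    have um [measurable]: "u \<in> borel_measurable SqM" using u by (simp add: sqint_def)
    have ui: "integrable SqM u"
    proof -
      have "sqint SqM (\<lambda>_. 1)" by (rule sqint_bounded(1)[where B = 1]) auto
      from sqint_mult_integrable(1)[OF u this] show ?thesis by simp
    qed
    have int: "integrable (SqM \<Otimes>\<^sub>M SqM) (\<lambda>(e, t). of_real (kernK Gamma t e) * u e * cnj (ebas k t))"
    proof (rule integrableI_bounded)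
      show m: "(\<lambda>(e, t). of_real (kernK Gamma t e) * u e * cnj (ebas k t)) \<in> borel_measurable (SqM \<Otimes>\<^sub>M SqM)"
        unfolding case_prod_beta by measurable
      have "(\<integral>\<^sup>+p. ennreal (norm (case p of (e, t) \<Rightarrow> of_real (kernK Gamma t e) * u e * cnj (ebas k t))) \<partial>(SqM \<Otimes>\<^sub>M SqM))
        = (\<integral>\<^sup>+e. (\<integral>\<^sup>+t. ennreal (cmod (of_real (kernK Gamma t e) * u e * cnj (ebas k t))) \<partial>SqM) \<partial>SqM)"
        using m by (subst SqM.nn_integral_fst[symmetric]) (auto simp: case_prod_beta)
      also have "\<dots> \<le> (\<integral>\<^sup>+e. ennreal C * ennreal (cmod (u e)) \<partial>SqM)"
      proof (intro nn_integral_mono)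
        fix e
        have "(\<integral>\<^sup>+t. ennreal (cmod (of_real (kernK Gamma t e) * u e * cnj (ebas k t))) \<partial>SqM) \<le> (\<integral>\<^sup>+t. ennreal \<bar>kernK Gamma t e\<bar> * ennreal (cmod (u e)) \<partial>SqM)"
        proof (intro nn_integral_mono)
          fix t
          have "1 / (2 * pi) \<le> 1" using pi_ge_two by simp
          then have "cmod (of_real (kernK Gamma t e) * u e * cnj (ebas k t)) \<le> \<bar>kernK Gamma t e\<bar> * cmod (u e)"
            unfolding norm_mult complex_mod_cnj cmod_ebas norm_of_real by (rule mult_left_le) simp
          then show "ennreal (cmod (of_real (kernK Gamma t e) * u e * cnj (ebas k t))) \<le> ennreal \<bar>kernK Gamma t e\<bar> * ennreal (cmod (u e))"
            by (simp add: ennreal_mult[symmetric] ennreal_leI)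
        qed
        also have "\<dots> = (\<integral>\<^sup>+t. ennreal \<bar>kernK Gamma t e\<bar> \<partial>SqM) * ennreal (cmod (u e))"
          by (rule nn_integral_multc) measurable
        also have "\<dots> \<le> ennreal C * ennreal (cmod (u e))" by (intro mult_right_mono C) auto
        finally show "(\<integral>\<^sup>+t. ennreal (cmod (of_real (kernK Gamma t e) * u e * cnj (ebas k t))) \<partial>SqM) \<le> ennreal C * ennreal (cmod (u e))" .
      qed
      also have "\<dots> = ennreal C * (\<integral>\<^sup>+e. ennreal (cmod (u e)) \<partial>SqM)" by (rule nn_integral_cmult) measurable
      also have "\<dots> < \<infinity>" using ui by (simp add: integrable_iff_bounded ennreal_mult_less_top)
      finally show "(\<integral>\<^sup>+p. ennreal (norm (case p of (e, t) \<Rightarrow> of_real (kernK Gamma t e) * u e * cnj (ebas k t))) \<partial>(SqM \<Otimes>\<^sub>M SqM)) < \<infinity>" .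
    qed
    have "fcoef (Kop Gamma u) k = (\<integral>t. (\<integral>e. of_real (kernK Gamma t e) * u e * cnj (ebas k t) \<partial>SqM) \<partial>SqM)"
      unfolding fcoef_eq Kop_eq by simp
    also have "\<dots> = (\<integral>e. (\<integral>t. of_real (kernK Gamma t e) * u e * cnj (ebas k t) \<partial>SqM) \<partial>SqM)"
      by (rule P.Fubini_integral[OF int])
    also have "\<dots> = (\<integral>e. (\<integral>t. u e * (of_real (kernK Gamma t e) * cnj (ebas k t)) \<partial>SqM) \<partial>SqM)"
      by (simp add: mult_ac)
    also have "\<dots> = (\<integral>e. u e * psi e \<partial>SqM)" unfolding psi_def by simp
    finally show ?thesis .
  qed
  have Km: "Kmat Gamma k l = cnj (fcoef (\<lambda>e. cnj (psi e)) l)" for l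
  proof -
    have "Kmat Gamma k l = (\<integral>e. ebas l e * psi e \<partial>SqM)"
      using rep[OF sqint_ebas[of l]] by (simp add: Kmat_def fcoef_def)
    also have "\<dots> = (\<integral>e. cnj (cnj (psi e) * cnj (ebas l e)) \<partial>SqM)" by (simp add: mult.commute)
    also have "\<dots> = cnj (fcoef (\<lambda>e. cnj (psi e)) l)" unfolding fcoef_eq by (rule Bochner_Integration.integral_cnj)
    finally show ?thesis .
  qed
  have "fcoef (Kop Gamma \<phi>) k = (\<integral>e. \<phi> e * cnj (cnj (psi e)) \<partial>SqM)" using rep[OF \<phi>] by simp
  also have "\<dots> = (\<integral>l. fcoef \<phi> l * cnj (fcoef (\<lambda>e. cnj (psi e)) l) \<partial>countZ2)"
    by (rule Parseval_inner[OF \<phi> sqint_cnj[OF psi_s]])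
  also have "\<dots> = mat_apply (Kmat Gamma) (fcoef \<phi>) k" unfolding mat_apply_def Km by (simp add: mult.commute)
  finally show ?thesis .
qed

section \<open>Diagonals of the matrix as Fourier coefficients\<close>

definition phase :: "int \<times> int \<Rightarrow> real \<times> real \<Rightarrow> complex" where
  "phase l t = exp (- \<i> * of_real (of_int (fst l) * fst t + of_int (snd l) * snd t))"

lemma cmod_phase [simp]: "cmod (phase l t) = 1"
  by (simp add: phase_def)

lemma phase_measurable [measurable]: "phase l \<in> borel_measurable borel"
  unfolding phase_def by (intro borel_measurable_continuous_onI continuous_intros)

lemma dsymbol_phase: "dsymbol m v = (\<integral>t. of_real (kernK Gamma t (t - v)) * phase m t \<partial>SqM)"
  by (simp add: dsymbol_def phase_def)

text \<open>Substituting \<open>e = t - disp s\<close> and exchanging the integrals separates the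
  frequencies: \<open>t\<close> carries \<open>m\<close> and the displacement carries
  \<open>l\<close>. For fixed \<open>m\<close> the diagonal thus consists of Fourier coefficients of
  a single integrable function.\<close>

lemma Kmat_formula:
  assumes adm: "admissible B"
  shows "Kmat Gamma (l + m) l = 1 / (4 * pi\<^sup>2) * (\<integral>s. phase l (disp s) * dsymbol m (disp s) \<partial>SqM)"
    "integrable SqM (\<lambda>s. phase l (disp s) * dsymbol m (disp s))"
proof -
  obtain Ck where Ck: "Ck \<ge> 0" "\<And>t s. s \<in> Sq \<Longrightarrow> \<bar>kernK Gamma t (t - disp s)\<bar> \<le> Ck / norm (disp s)"
    "\<And>e s. s \<in> Sq \<Longrightarrow> \<bar>kernK Gamma (e - disp s) e\<bar> \<le> Ck / norm (disp s)"
    using kernK_bound[OF adm] by blast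
  interpret P: pair_sigma_finite SqM SqM by (intro pair_sigma_finite.intro sigma_finite_SqM)
  have e: "ebas l (t - v) * cnj (ebas (l + m) t) = 1 / (4 * pi\<^sup>2) * (phase l v * phase m t)" for t v
  proof -
    have "cnj (ebas (l + m) t) = 1 / (2 * complex_of_real pi) * exp (- (\<i> * complex_of_real (of_int (fst (l + m)) * fst t + of_int (snd (l + m)) * snd t)))"
      by (simp add: ebas_def exp_cnj)
    then show ?thesis
      by (simp add: ebas_def phase_def mult_exp_exp power2_eq_square algebra_simps)
  qed
  let ?H = "\<lambda>s t. phase l (disp s) * (of_real (kernK Gamma t (t - disp s)) * phase m t)"
  have m: "(\<lambda>(s, t). ?H s t) \<in> borel_measurable (SqM \<Otimes>\<^sub>M SqM)"
    unfolding case_prod_beta by measurable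
  have int: "integrable (SqM \<Otimes>\<^sub>M SqM) (\<lambda>(s, t). ?H s t)"
  proof (rule integrableI_bounded[OF m])
    have "(\<integral>\<^sup>+p. ennreal (norm (case p of (s, t) \<Rightarrow> ?H s t)) \<partial>(SqM \<Otimes>\<^sub>M SqM)) = (\<integral>\<^sup>+s. (\<integral>\<^sup>+t. ennreal (cmod (?H s t)) \<partial>SqM) \<partial>SqM)"
      using m by (subst SqM.nn_integral_fst[symmetric]) (auto simp: case_prod_beta)
    also have "\<dots> \<le> (\<integral>\<^sup>+s. (\<integral>\<^sup>+t. ennreal (Ck * (1 / norm (disp s))) \<partial>SqM) \<partial>SqM)"
      using Ck(2) by (intro nn_integral_mono ennreal_leI) (simp add: norm_mult)
    also have "\<dots> = (\<integral>\<^sup>+s. ennreal (Ck * (1 / norm (disp s))) * emeasure SqM (space SqM) \<partial>SqM)" by simp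
    also have "\<dots> = (\<integral>\<^sup>+s. ennreal (Ck * (1 / norm (disp s))) \<partial>SqM) * emeasure SqM (space SqM)"
      by (rule nn_integral_multc) measurable
    also have "\<dots> < \<infinity>"
    proof -
      have "integrable SqM (\<lambda>s. Ck * (1 / norm (disp s)))" by (intro integrable_mult_right inverse_norm_disp_integrable)
      then have "(\<integral>\<^sup>+s. ennreal (Ck * (1 / norm (disp s))) \<partial>SqM) < \<infinity>"
        using Ck(1) by (subst nn_integral_eq_integral) auto
      moreover have "emeasure SqM (space SqM) < \<infinity>" using SqM.emeasure_finite[of Sq] by (simp add: less_top[symmetric])
      ultimately show ?thesis by (simp add: ennreal_mult_less_top)
    qed
    finally show "(\<integral>\<^sup>+p. ennreal (norm (case p of (s, t) \<Rightarrow> ?H s t)) \<partial>(SqM \<Otimes>\<^sub>M SqM)) < \<infinity>" .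
  qed
  have "Kmat Gamma (l + m) l = (\<integral>t. (\<integral>e. of_real (kernK Gamma t e) * ebas l e \<partial>SqM) * cnj (ebas (l + m) t) \<partial>SqM)"
    unfolding Kmat_def fcoef_def[symmetric] fcoef_eq Kop_eq ..
  also have "\<dots> = (\<integral>t. (\<integral>s. 1 / (4 * pi\<^sup>2) * ?H s t \<partial>SqM) \<partial>SqM)"
  proof (intro Bochner_Integration.integral_cong refl)
    fix t
    have "(\<integral>e. of_real (kernK Gamma t e) * ebas l e \<partial>SqM) = (\<integral>s. of_real (kernK Gamma t (s + (t - (pi, pi)))) * ebas l (s + (t - (pi, pi))) \<partial>SqM)"
    proof (rule integral_SqM_translate[symmetric, where f = "\<lambda>e. of_real (kernK Gamma t e) * ebas l e"])
      show "(\<lambda>e. of_real (kernK Gamma t e) * ebas l e) \<in> borel_measurable borel" by measurable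
      show "biperiodic (\<lambda>e. of_real (kernK Gamma t e) * ebas l e)"
        using kernK_biperiodic(1)[of t] ebas_biperiodic[of l] by (auto simp: biperiodic_def)
    qed
    then have "(\<integral>e. of_real (kernK Gamma t e) * ebas l e \<partial>SqM) * cnj (ebas (l + m) t) = (\<integral>s. of_real (kernK Gamma t (t - disp s)) * ebas l (t - disp s) * cnj (ebas (l + m) t) \<partial>SqM)"
      unfolding translate_disp by simp
    also have "\<dots> = (\<integral>s. 1 / (4 * pi\<^sup>2) * ?H s t \<partial>SqM)"
      unfolding mult.assoc e by (simp add: mult_ac)
    finally show "(\<integral>e. of_real (kernK Gamma t e) * ebas l e \<partial>SqM) * cnj (ebas (l + m) t) = (\<integral>s. 1 / (4 * pi\<^sup>2) * ?H s t \<partial>SqM)" .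
  qed
  also have "\<dots> = 1 / (4 * pi\<^sup>2) * (\<integral>t. (\<integral>s. ?H s t \<partial>SqM) \<partial>SqM)"
    by (simp only: integral_mult_right_zero)
  also have "(\<integral>t. (\<integral>s. ?H s t \<partial>SqM) \<partial>SqM) = (\<integral>s. (\<integral>t. ?H s t \<partial>SqM) \<partial>SqM)"
    by (rule P.Fubini_integral[OF int])
  also have "\<dots> = (\<integral>s. phase l (disp s) * dsymbol m (disp s) \<partial>SqM)"
    unfolding dsymbol_phase by simp
  finally show "Kmat Gamma (l + m) l = 1 / (4 * pi\<^sup>2) * (\<integral>s. phase l (disp s) * dsymbol m (disp s) \<partial>SqM)" .
  have "integrable SqM (\<lambda>s. \<integral>t. ?H s t \<partial>SqM)"
    using P.integrable_fst'[OF int] by simp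
  then show "integrable SqM (\<lambda>s. phase l (disp s) * dsymbol m (disp s))" unfolding dsymbol_phase by simp
qed

lemma decay_matrix_Kmat:
  assumes adm: "admissible B" and \<beta>: "0 < \<beta>" "\<beta> < B"
  obtains C where "decay_matrix (Kmat Gamma) C \<beta>"
proof -
  obtain Ca where Ca: "Ca \<ge> 0" "\<And>v m. \<bar>fst v\<bar> \<le> pi \<Longrightarrow> \<bar>snd v\<bar> \<le> pi \<Longrightarrow> cmod (dsymbol m v) \<le> Ca / norm v * exp (- \<beta> * rnorm1 m)"
    using dsymbol_bound[OF _ _ _ \<beta>] adm unfolding admissible_def by metis
  define C where "C = (\<integral>s. Ca / norm (disp s) \<partial>SqM)"
  have iC: "integrable SqM (\<lambda>s. Ca / norm (disp s))"
    using integrable_mult_right[OF inverse_norm_disp_integrable, of Ca] by simp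
  have pi1: "1 / (4 * pi\<^sup>2) \<le> 1"
  proof -
    have "1 \<le> pi\<^sup>2" using power_mono[of 1 pi 2] pi_ge_two by simp
    then show ?thesis by simp
  qed
  have "decay_matrix (Kmat Gamma) C \<beta>"
  proof
    show "C \<ge> 0" unfolding C_def using Ca(1) by (intro Bochner_Integration.integral_nonneg) auto
    show "cmod (Kmat Gamma k l) \<le> C * exp (- \<beta> * rnorm1 (k - l))" for k l
    proof -
      define m where "m = k - l"
      have k: "k = l + m" by (simp add: m_def)
      have "cmod (\<integral>s. phase l (disp s) * dsymbol m (disp s) \<partial>SqM) \<le> (\<integral>s. cmod (phase l (disp s) * dsymbol m (disp s)) \<partial>SqM)" by simp
      also have "\<dots> \<le> (\<integral>s. Ca / norm (disp s) * exp (- \<beta> * rnorm1 m) \<partial>SqM)"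
      proof (rule integral_mono)
        show "integrable SqM (\<lambda>s. cmod (phase l (disp s) * dsymbol m (disp s)))"
          by (rule integrable_norm[OF Kmat_formula(2)[OF adm]])
        show "integrable SqM (\<lambda>s. Ca / norm (disp s) * exp (- \<beta> * rnorm1 m))" by (rule integrable_mult_left[OF iC])
        show "cmod (phase l (disp s) * dsymbol m (disp s)) \<le> Ca / norm (disp s) * exp (- \<beta> * rnorm1 m)" if "s \<in> space SqM" for s
          unfolding norm_mult cmod_phase mult_1_left using Ca(2)[OF disp_bound, of s m] that by simp
      qed
      also have "\<dots> = C * exp (- \<beta> * rnorm1 m)" unfolding C_def by (rule integral_mult_left_zero)
      finally have 1: "cmod (\<integral>s. phase l (disp s) * dsymbol m (disp s) \<partial>SqM) \<le> C * exp (- \<beta> * rnorm1 m)" .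
      have "cmod (Kmat Gamma k l) = 1 / (4 * pi\<^sup>2) * cmod (\<integral>s. phase l (disp s) * dsymbol m (disp s) \<partial>SqM)"
        unfolding k Kmat_formula(1)[OF adm] by (simp add: norm_mult norm_divide norm_power)
      also have "\<dots> \<le> 1 * cmod (\<integral>s. phase l (disp s) * dsymbol m (disp s) \<partial>SqM)"
        by (intro mult_right_mono pi1) simp
      finally show ?thesis using 1 by (simp add: m_def)
    qed
    show "finite {l. cmod (Kmat Gamma (l + m) l) > e}" if e: "e > 0" for m e
    proof -
      define g where "g s = dsymbol m (disp s)" for s
      have g: "integrable SqM g"
        using Kmat_formula(2)[OF adm, of 0 m] by (simp add: g_def[abs_def] phase_def)
      have le: "cmod (Kmat Gamma (l + m) l) \<le> cmod (fcoef g (- l))" for l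
      proof -
        \<comment> \<open>The centre \<open>(pi, pi)\<close> of \<open>disp\<close> contributes this
          unimodular factor; the frequency changes sign because \<open>disp\<close> reverses
          \<open>s\<close>.\<close>
        define c where "c = exp (- \<i> * of_real (of_int (fst l) * pi + of_int (snd l) * pi))"
        have "phase l (disp s) * dsymbol m (disp s) = (2 * pi * c) * (g s * cnj (ebas (- l) s))" for s
        proof -
          have "phase l (disp s) = c * exp (\<i> * of_real (of_int (fst l) * fst s + of_int (snd l) * snd s))"
            unfolding c_def phase_def by (simp add: mult_exp_exp disp_def algebra_simps)
          moreover have "cnj (ebas (- l) s) = 1 / (2 * complex_of_real pi) * exp (\<i> * of_real (of_int (fst l) * fst s + of_int (snd l) * snd s))"
            by (simp add: ebas_def exp_cnj algebra_simps)
          ultimately show ?thesis by (simp add: g_def)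
        qed
        then have "Kmat Gamma (l + m) l = 1 / (4 * pi\<^sup>2) * (2 * pi * c * fcoef g (- l))"
          unfolding Kmat_formula(1)[OF adm] fcoef_eq by (simp only: integral_mult_right_zero)
        moreover have "cmod c = 1" by (simp add: c_def)
        ultimately have "cmod (Kmat Gamma (l + m) l) = 1 / (2 * pi) * cmod (fcoef g (- l))"
          by (simp add: norm_mult norm_divide norm_power power2_eq_square)
        also have "\<dots> \<le> 1 * cmod (fcoef g (- l))"
          using pi_ge_two by (intro mult_right_mono) auto
        finally show ?thesis by simp
      qed
      have "{l. cmod (Kmat Gamma (l + m) l) > e} \<subseteq> uminus ` {l. cmod (fcoef g l) > e}"
      proof
        fix l assume "l \<in> {l. cmod (Kmat Gamma (l + m) l) > e}"
        then show "l \<in> uminus ` {l. cmod (fcoef g l) > e}"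
          using le[of l] by (intro image_eqI[where x = "- l"]) auto
      qed
      then show ?thesis using Riemann_Lebesgue[OF g e] finite_surj by blast
    qed
  qed (use \<beta> in auto)
  then show ?thesis using that by blast
qed

end

section \<open>The Galerkin error\<close>

text \<open>With \<open>u = weight 2 k\<close>, \<open>cmod (x k)\<close> is the product of
  \<open>u * cmod (x k)\<close> and \<open>1 / u\<close>, hence at most the sum of their squares.
  The first square is summable by assumption, the second because \<open>u^2\<close> dominates the
  product weight.\<close>

lemma sqint_weight_integrable:
  assumes x: "sqint countZ2 (\<lambda>k. of_real (weight 2 k) * x k)" shows "integrable countZ2 x"
proof (rule Bochner_Integration.integrable_bound)
  show "integrable countZ2 (\<lambda>k. (cmod (of_real (weight 2 k) * x k))\<^sup>2 + 1 / ((1 + (real_of_int (fst k))\<^sup>2) * (1 + (real_of_int (snd k))\<^sup>2)))"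
    using x integrable_inverse_weight by (simp add: sqint_def)
  have "cmod (x k) \<le> (cmod (of_real (weight 2 k) * x k))\<^sup>2 + 1 / ((1 + (real_of_int (fst k))\<^sup>2) * (1 + (real_of_int (snd k))\<^sup>2))" for k
  proof -
    let ?a = "(real_of_int (fst k))\<^sup>2" and ?b = "(real_of_int (snd k))\<^sup>2"
    define u where "u = 1 + ?a + ?b"
    have u: "u > 0" unfolding u_def by (simp add: add_pos_nonneg)
    have w: "weight 2 k = u" using u by (simp add: weight_def u_def real_sqrt_unique)
    have ab: "0 \<le> ?a" "0 \<le> ?b" by auto
    have le: "(1 + ?a) * (1 + ?b) \<le> u\<^sup>2"
    proof -
      have "0 \<le> ?a * ?b" "0 \<le> ?a * ?a" "0 \<le> ?b * ?b" by auto
      then show ?thesis using ab by (simp add: u_def power2_eq_square algebra_simps)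
    qed
    have pos: "0 < (1 + ?a) * (1 + ?b)" by (intro mult_pos_pos add_pos_nonneg) auto
    have "cmod (x k) = (u * cmod (x k)) * (1 / u)" using u by simp
    also have "\<dots> \<le> (u * cmod (x k))\<^sup>2 + (1 / u)\<^sup>2"
    proof -
      have "p * r \<le> p\<^sup>2 + r\<^sup>2" for p r :: real
        using sum_squares_bound[of p r] zero_le_power2[of p] zero_le_power2[of r] by linarith
      then show ?thesis .
    qed
    also have "(1 / u)\<^sup>2 \<le> 1 / ((1 + ?a) * (1 + ?b))"
      using le pos by (simp add: power_divide) (intro frac_le, auto)
    finally show ?thesis using u by (simp add: w norm_mult)
  qed
  then show "AE k in countZ2. norm (x k) \<le> norm ((cmod (of_real (weight 2 k) * x k))\<^sup>2 + 1 / ((1 + (real_of_int (fst k))\<^sup>2) * (1 + (real_of_int (snd k))\<^sup>2)))"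
    by (intro AE_I2) (metis abs_ge_self order_trans real_norm_def)
qed simp

lemma weight_sq: "(cmod (of_real (weight p k) * z))\<^sup>2 = (1 + (of_int (fst k))\<^sup>2 + (of_int (snd k))\<^sup>2) ^ p * (cmod z)\<^sup>2"
proof -
  have "(weight p k)\<^sup>2 = (1 + (of_int (fst k))\<^sup>2 + (of_int (snd k))\<^sup>2) ^ p"
    unfolding weight_def by (rule real_sqrt_pow2, rule zero_le_power) auto
  then show ?thesis by (simp add: norm_mult power_mult_distrib)
qed

lemma Hp_iff: "f \<in> Hp p \<longleftrightarrow> sqint SqM f \<and> sqint countZ2 (\<lambda>k. of_real (weight p k) * fcoef f k)"
  unfolding Hp_def sqint_CZ_iff weight_sq by (simp add: L2_iff)

lemma Hpnorm_eq: "f \<in> Hp p \<Longrightarrow> Hpnorm p f = sqrt (sqnorm countZ2 (\<lambda>k. of_real (weight p k) * fcoef f k))"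
  unfolding Hpnorm_def by (subst sqnorm_CZ) (simp_all only: Hp_iff weight_sq)

lemma fcoef_finite_sum: "fcoef (\<lambda>t. \<Sum>k\<in>idx n. c k * ebas k t) = restrict0 (idx n) c"
proof
  fix l
  have "fcoef (\<lambda>t. \<Sum>k\<in>idx n. c k * ebas k t) l = (\<Sum>k\<in>idx n. c k * (if k = l then 1 else 0))"
    by (subst fcoef_sum) (auto simp: fcoef_cmult ebas_orthonormal intro: sqint_cmult sqint_ebas)
  then show "fcoef (\<lambda>t. \<Sum>k\<in>idx n. c k * ebas k t) l = restrict0 (idx n) c l"
    by (simp add: restrict0_def if_distrib[of "\<lambda>u. _ * u"] cong: if_cong)
qed

lemma sqint_finite_sum: "sqint SqM (\<lambda>t. \<Sum>k\<in>idx n. c k * ebas k t)"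
  by (intro sqint_sum sqint_cmult sqint_ebas)

lemma fcoef_Pn: "fcoef (Pn n \<phi>) = restrict0 (idx n) (fcoef \<phi>)"
  unfolding Pn_def[abs_def] by (rule fcoef_finite_sum)

lemma integral_CZ_finite_support:
  assumes "\<And>l. l \<notin> idx n \<Longrightarrow> f l = 0" shows "(\<integral>l. f l \<partial>countZ2) = (\<Sum>l\<in>idx n. f l :: complex)"
proof -
  have "(\<integral>l. f l \<partial>countZ2) = (\<integral>l. (\<Sum>j\<in>idx n. indicator {j} l *\<^sub>R f j) \<partial>countZ2)"
  proof (rule Bochner_Integration.integral_cong[OF refl])
    fix l
    have "(\<Sum>j\<in>idx n. indicator {j} l *\<^sub>R f j) = (\<Sum>j\<in>idx n. if j = l then f j else 0)"
      by (intro sum.cong) (auto simp: indicator_def)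
    then show "f l = (\<Sum>j\<in>idx n. indicator {j} l *\<^sub>R f j)" using assms[of l] by simp
  qed
  also have "\<dots> = (\<Sum>j\<in>idx n. (\<integral>l. indicator {j} l *\<^sub>R f j \<partial>countZ2))"
    by (intro Bochner_Integration.integral_sum integrable_scaleR_left) (simp add: integrable_indicator_iff)
  also have "\<dots> = (\<Sum>j\<in>idx n. f j)"
    by (intro sum.cong refl, subst integral_scaleR_left) (auto simp: integrable_indicator_iff measure_count_space)
  finally show ?thesis .
qed

lemma (in decay_matrix) Ktop_eq:
  assumes A: "A = Kmat G" and \<phi>: "sqint SqM \<phi>"
  shows "Ktop G q n \<phi> = (\<lambda>t. \<Sum>k\<in>idx n. mat_apply (band_section n (q * ln (bigN n))) (fcoef \<phi>) k * ebas k t)"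
proof
  fix t
  let ?S = "band_section n (q * ln (bigN n))"
  have "Ktop G q n \<phi> t = (\<integral>e. (\<Sum>k\<in>idx n. \<Sum>l\<in>idx n. (Ktmat G q n k l * ebas k t) * (\<phi> e * cnj (ebas l e))) \<partial>SqM)"
    unfolding Ktop_def set_integral_Sq by (simp add: sum_distrib_left sum_distrib_right mult_ac)
  also have "\<dots> = (\<Sum>k\<in>idx n. \<Sum>l\<in>idx n. (Ktmat G q n k l * ebas k t) * fcoef \<phi> l)"
    using fcoef_integrable[OF \<phi>] by (simp add: fcoef_eq)
  also have "\<dots> = (\<Sum>k\<in>idx n. mat_apply ?S (fcoef \<phi>) k * ebas k t)"
  proof (rule sum.cong[OF refl])
    fix k assume k: "k \<in> idx n"
    have "mat_apply ?S (fcoef \<phi>) k = (\<Sum>l\<in>idx n. ?S k l * fcoef \<phi> l)"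
      unfolding mat_apply_def by (rule integral_CZ_finite_support) (simp add: band_section_def)
    also have "\<dots> = (\<Sum>l\<in>idx n. Ktmat G q n k l * fcoef \<phi> l)"
      using k by (intro sum.cong) (auto simp: band_section_def Ktmat_def A[symmetric])
    finally show "(\<Sum>l\<in>idx n. Ktmat G q n k l * ebas k t * fcoef \<phi> l) = mat_apply ?S (fcoef \<phi>) k * ebas k t"
      by (simp add: sum_distrib_left mult_ac)
  qed
  finally show "Ktop G q n \<phi> t = (\<Sum>k\<in>idx n. mat_apply ?S (fcoef \<phi>) k * ebas k t)" .
qed

lemma (in decay_matrix) mat_apply_band_section_outside: "restrict0 (idx n) (mat_apply (band_section n T) x) = mat_apply (band_section n T) x"
  by (auto simp: restrict0_def mat_apply_def band_section_def fun_eq_iff)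

lemma (in decay_matrix) fcoef_Ktop:
  assumes A: "A = Kmat G" and \<phi>: "sqint SqM \<phi>"
  shows "sqint SqM (Ktop G q n \<phi>)" "fcoef (Ktop G q n \<phi>) = mat_apply (band_section n (q * ln (bigN n))) (fcoef \<phi>)"
  unfolding Ktop_eq[OF assms] fcoef_finite_sum mat_apply_band_section_outside by (rule sqint_finite_sum, rule refl)

theorem theorem4:
  fixes Gamma :: "real \<times> real \<Rightarrow> real^3"
    and \<Omega> :: "(real^3) set"
    and C0 R0 b q :: real
    and F :: "3 \<Rightarrow> complex \<times> complex \<Rightarrow> complex"
    and p :: nat
    and g \<rho> :: "real \<times> real \<Rightarrow> complex"
  assumes periodic: "\<forall>t0 t1. Gamma (t0 + 2*pi, t1) = Gamma (t0, t1) \<and> Gamma (t0, t1 + 2*pi) = Gamma (t0, t1)"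
    and diff: "\<forall>t. Gamma differentiable (at t)"
    and region: "bounded \<Omega>" "open \<Omega>" "Cinf_diffeomorphic \<Omega> solid_torus"
    and param: "bij_betw Gamma Sq (frontier \<Omega>)"
    and A1: "C0 > 0" "\<forall>t\<in>Sq. \<forall>e\<in>Sq. norm (Gamma t - Gamma e) \<ge> C0 * zeta (t - e)"
    and A2: "R0 > 0" "\<forall>j. analytic_ext_closure R0 (\<lambda>t. Gamma t $ j) (F j)"
    and p_pos: "p \<ge> 1"
    and inj: "\<forall>\<phi>\<in>L2. (AE t in lborel. t \<in> Sq \<longrightarrow> \<phi> t - Kop Gamma \<phi> t = 0) \<longrightarrow>
                        (AE t in lborel. t \<in> Sq \<longrightarrow> \<phi> t = 0)"
    and g: "g \<in> Hp p"
    and b: "0 < b" "b < min (C0\<^sup>2 / (sqrt 2 * M0 R0 F * M1 R0 F)) (R0 / 2)"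
    and q: "q > 0" "q * b \<ge> real p / 2"
    and rho: "\<rho> \<in> L2" "AE t in lborel. t \<in> Sq \<longrightarrow> \<rho> t - Kop Gamma \<rho> t = g t"
  shows "\<rho> \<in> Hp p \<and>
    (\<exists>c>0. \<exists>n0::nat. \<forall>n\<ge>n0.
      (\<forall>\<phi>\<in>Hp p. L2norm (\<lambda>t. Pn n \<phi> t - Ktop Gamma q n (Pn n \<phi>) t) \<ge> c * L2norm (Pn n \<phi>)) \<and>
      (\<forall>\<rho>t\<in>Xn n. (\<forall>t. \<rho>t t - Ktop Gamma q n \<rho>t t = Pn n g t) \<longrightarrow>
          L2norm (\<lambda>t. \<rho> t - \<rho>t t) \<le> c * bigN n powr (- real p / 2) * ln (bigN n) * Hpnorm p \<rho>))"
proof -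
  interpret torus_bie Gamma C0 R0 F
    using periodic diff A1 A2 by unfold_locales
  define X where "X = C0\<^sup>2 / (sqrt 2 * M0 R0 F * M1 R0 F)"
  define m where "m = min X (R0 / 2)"
  \<comment> \<open>The points \<open>b < \<beta> < B < m\<close> are equally spaced:
    \<open>\<beta>\<close> is the decay rate of the matrix and \<open>B\<close> the half-width of
    the strips to which the kernel continues.\<close>
  define \<beta> where "\<beta> = (2 * b + m) / 3"
  define B where "B = (b + 2 * m) / 3"
  have bm: "0 < b" "b < m" using b by (simp_all add: m_def X_def)
  have \<beta>: "b < \<beta>" "\<beta> < B" "0 < \<beta>" "B < m" "0 < B" using bm by (simp_all add: \<beta>_def B_def)
  have adm: "admissible B"
  proof -
    have BX: "B < X" "B < R0 / 2" using \<beta>(4) by (simp_all add: m_def)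
    have D: "sqrt 2 * M0 R0 F * M1 R0 F = sqrt 2 * M01" by (simp add: M01_def)
    have "X > 0" using BX \<beta> by linarith
    \<comment> \<open>If \<open>M01\<close> were 0, \<open>X\<close> would be 0 by division by zero,
      contrary to \<open>X > 0\<close>.\<close>
    then have "sqrt 2 * M01 > 0" using M01_nonneg unfolding X_def D by (cases "M01 = 0") auto
    then have "B * (sqrt 2 * M01) < C0\<^sup>2" using BX(1) unfolding X_def D by (simp add: pos_less_divide_eq)
    then show ?thesis using \<beta> BX A2(1) by (simp add: admissible_def mult_ac)
  qed
  obtain C where "decay_matrix (Kmat Gamma) C \<beta>"
    using decay_matrix_Kmat[OF adm \<beta>(3) \<beta>(2)] by blast
  then interpret dm: decay_matrix "Kmat Gamma" C \<beta> .
  \<comment> \<open>Injectivity is given for functions and wanted for sequences. The residual of a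
    fixed vector is 0 and so lies in every weighted space; regularity then makes the vector
    absolutely summable, hence the coefficient sequence of a function.\<close>
  have injx: "\<forall>k. x k = 0" if x: "sqint countZ2 x" "\<forall>k. x k = mat_apply (Kmat Gamma) x k" for x
  proof -
    have "(\<lambda>k. of_real (weight 2 k) * (x k - mat_apply (Kmat Gamma) x k)) = (\<lambda>k. 0)" using x(2) by auto
    then have "sqint countZ2 (\<lambda>k. of_real (weight 2 k) * (x k - mat_apply (Kmat Gamma) x k))" by (simp only: sqint_zero)
    from sqint_weight_integrable[OF dm.regularity[OF x(1) this]]
    obtain \<phi> where \<phi>: "sqint SqM \<phi>" "\<And>k. fcoef \<phi> k = x k" using fcoef_synthesis by blast
    have "fcoef \<phi> = x" using \<phi>(2) by auto
    then have "fcoef (Kop Gamma \<phi>) k = fcoef \<phi> k" for k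
      using fcoef_Kop[OF adm \<phi>(1), of k] x(2)[rule_format, of k] by simp
    from fcoef_eq_imp_AE[OF Kop_sqint[OF adm \<phi>(1)] \<phi>(1) this]
    have "AE t in SqM. \<phi> t - Kop Gamma \<phi> t = 0" by eventually_elim simp
    then have "AE t in SqM. \<phi> t = 0"
      using inj[rule_format, of \<phi>] \<phi>(1) unfolding AE_Sq L2_iff by auto
    then have "sqnorm countZ2 x = 0" using sqnorm_eq_0_iff[OF \<phi>(1)] Parseval(2)[OF \<phi>(1)] \<open>fcoef \<phi> = x\<close> by simp
    then show ?thesis using cmod_le_sqnorm_CZ[OF x(1)] by simp
  qed
  have \<rho>s: "sqint SqM \<rho>" using rho(1) by (simp add: L2_iff)
  have gs: "sqint SqM g" "sqint countZ2 (\<lambda>k. of_real (weight p k) * fcoef g k)" using g by (simp_all add: Hp_iff)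
  let ?x = "fcoef \<rho>"
  have xs: "sqint countZ2 ?x" by (rule Parseval(1)[OF \<rho>s])
  have gx: "fcoef g = (\<lambda>k. ?x k - mat_apply (Kmat Gamma) ?x k)"
  proof
    fix k
    note K = Kop_sqint[OF adm \<rho>s]
    have "fcoef g k = fcoef (\<lambda>t. \<rho> t - Kop Gamma \<rho> t) k"
      unfolding fcoef_eq
    proof (rule integral_cong_AE)
      show "AE t in SqM. g t * cnj (ebas k t) = (\<rho> t - Kop Gamma \<rho> t) * cnj (ebas k t)"
        using rho(2) unfolding AE_Sq by eventually_elim simp
    qed (use borel_measurable_integrable[OF fcoef_integrable[OF gs(1)]]
          borel_measurable_integrable[OF fcoef_integrable[OF sqint_diff(1)[OF \<rho>s K]]] in auto)
    then show "fcoef g k = ?x k - mat_apply (Kmat Gamma) ?x k"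
      using fcoef_diff[OF \<rho>s K, of k] fcoef_Kop[OF adm \<rho>s, of k] by simp
  qed
  \<comment> \<open>By \<open>gx\<close> the residual of \<open>?x\<close> is the coefficient
    sequence of \<open>g\<close>, so regularity applies with order \<open>p\<close>.\<close>
  have xw: "sqint countZ2 (\<lambda>k. of_real (weight p k) * ?x k)"
    using dm.regularity[OF xs, of p] gs(2) unfolding gx by blast
  have \<rho>H: "\<rho> \<in> Hp p" using xw \<rho>s by (simp add: Hp_iff)
  define T where "T n = q * ln (bigN n)" for n
  have N_tends: "filterlim (\<lambda>n. ln (bigN n)) at_top sequentially"
  proof (rule filterlim_compose[OF ln_at_top])
    show "filterlim bigN at_top sequentially"
    proof (rule filterlim_at_top_mono[OF filterlim_real_sequentially])
      have "real n \<le> bigN n" for n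
      proof -
        have "real n \<le> 2 * real n + 1" by simp
        also have "\<dots> \<le> (2 * real n + 1) * (2 * real n + 1)"
          using mult_left_mono[of 1 "2 * real n + 1" "2 * real n + 1"] by simp
        finally show ?thesis by (simp add: bigN_def power2_eq_square)
      qed
      then show "\<forall>\<^sub>F n in sequentially. real n \<le> bigN n" by simp
    qed
  qed
  have "filterlim T at_top sequentially"
    unfolding T_def using q(1) by (intro filterlim_tendsto_pos_mult_at_top[OF tendsto_const _ N_tends])
  from dm.section_bounded_below[OF injx this] obtain c n0 where c: "c > 0"
    and low: "\<And>n x. n \<ge> n0 \<Longrightarrow> sqint countZ2 x \<Longrightarrow> restrict0 (idx n) x = x \<Longrightarrow>
         c * sqnorm countZ2 x \<le> sqnorm countZ2 (\<lambda>k. x k - mat_apply (dm.band_section n (T n)) x k)" by blast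
  have rr: "restrict0 (idx n) (restrict0 (idx n) y) = restrict0 (idx n) y" for n y by (auto simp: restrict0_def)
  have part1: "sqrt c * L2norm (Pn n \<phi>) \<le> L2norm (\<lambda>t. Pn n \<phi> t - Ktop Gamma q n (Pn n \<phi>) t)"
    if n: "n \<ge> n0" for n \<phi>
  proof -
    let ?P = "Pn n \<phi>"
    have P: "sqint SqM ?P" unfolding Pn_def[abs_def] by (rule sqint_finite_sum)
    note K = dm.fcoef_Ktop[OF refl P, of q n]
    have "fcoef (\<lambda>t. ?P t - Ktop Gamma q n ?P t) = (\<lambda>k. fcoef ?P k - mat_apply (dm.band_section n (T n)) (fcoef ?P) k)"
      using fcoef_diff[OF P K(1)] K(2) by (auto simp: T_def)
    then have 1: "sqnorm SqM (\<lambda>t. ?P t - Ktop Gamma q n ?P t) = sqnorm countZ2 (\<lambda>k. fcoef ?P k - mat_apply (dm.band_section n (T n)) (fcoef ?P) k)"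
      using Parseval(2)[OF sqint_diff(1)[OF P K(1)]] by simp
    have "c * sqnorm countZ2 (fcoef ?P) \<le> sqnorm countZ2 (\<lambda>k. fcoef ?P k - mat_apply (dm.band_section n (T n)) (fcoef ?P) k)"
      by (rule low[OF n Parseval(1)[OF P]]) (simp add: fcoef_Pn rr)
    then have "c * sqnorm SqM ?P \<le> sqnorm SqM (\<lambda>t. ?P t - Ktop Gamma q n ?P t)"
      using 1 Parseval(2)[OF P] by simp
    then have "sqrt (c * sqnorm SqM ?P) \<le> sqrt (sqnorm SqM (\<lambda>t. ?P t - Ktop Gamma q n ?P t))" by simp
    then show ?thesis by (simp add: L2norm_eq real_sqrt_mult)
  qed
  let ?w = "sqnorm countZ2 (\<lambda>k. of_real (weight p k) * ?x k)"
  define J where "J = (\<integral>m. C * exp (- (\<beta> - b) * rnorm1 m) \<partial>countZ2)"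
  \<comment> \<open>The factor \<open>4 ^ p\<close> comes from \<open>N <= 4 * (1 + n)^2\<close>,
    and \<open>J\<close> measures the discarded entries.\<close>
  define E where "E = (2 + 4 * dm.majorant_sum\<^sup>2 / c) * 4 ^ p + 4 * J\<^sup>2 / c"
  have J0: "J \<ge> 0" unfolding J_def using dm.C_nonneg by (intro Bochner_Integration.integral_nonneg) auto
  have E0: "E \<ge> 0" unfolding E_def using c by auto
  have part2: "L2norm (\<lambda>t. \<rho> t - \<rho>t t) \<le> sqrt E * bigN n powr (- real p / 2) * Hpnorm p \<rho>"
    if n: "n \<ge> n0" and \<rho>t: "\<rho>t \<in> Xn n" and eq: "\<forall>t. \<rho>t t - Ktop Gamma q n \<rho>t t = Pn n g t" for n \<rho>t
  proof -
    obtain d where "\<And>t. \<rho>t t = (\<Sum>k\<in>idx n. d k * ebas k t)" using \<rho>t by (auto simp: Xn_def)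
    then have \<rho>te: "\<rho>t = (\<lambda>t. \<Sum>k\<in>idx n. d k * ebas k t)" by auto
    have ts: "sqint SqM \<rho>t" unfolding \<rho>te by (rule sqint_finite_sum)
    let ?y = "fcoef \<rho>t"
    have y: "restrict0 (idx n) ?y = ?y" unfolding \<rho>te fcoef_finite_sum rr ..
    note K = dm.fcoef_Ktop[OF refl ts, of q n]
    have yeq: "?y k - mat_apply (dm.band_section n (T n)) ?y k = restrict0 (idx n) (\<lambda>k. ?x k - mat_apply (Kmat Gamma) ?x k) k" for k
    proof -
      have "(\<lambda>t. \<rho>t t - Ktop Gamma q n \<rho>t t) = Pn n g" using eq by auto
      then have "fcoef (\<lambda>t. \<rho>t t - Ktop Gamma q n \<rho>t t) k = fcoef (Pn n g) k" by simp
      then show ?thesis using fcoef_diff[OF ts K(1), of k] K(2) by (simp add: fcoef_Pn gx T_def)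
    qed
    define N where "N = bigN n"
    have N1: "N \<ge> 1" unfolding N_def bigN_def by (simp add: one_le_power)
    have N0: "N > 0" using N1 by linarith
    have err: "sqnorm countZ2 (\<lambda>k. ?x k - ?y k) \<le> ((2 + 4 * dm.majorant_sum\<^sup>2 / c) * (1 / (1 + real n) ^ p)\<^sup>2 + 4 * (\<integral>m. dm.far_majorant (T n) m \<partial>countZ2)\<^sup>2 / c) * ?w"
      by (rule dm.section_error[OF c low[OF n] xs xw Parseval(1)[OF ts] y yeq])
    have h1: "(1 / (1 + real n) ^ p)\<^sup>2 \<le> 4 ^ p * N powr (- real p)"
    proof -
      have "N \<le> 4 * (1 + real n)\<^sup>2" unfolding N_def bigN_def by (simp add: power2_eq_square algebra_simps)
      then have "N ^ p \<le> (4 * (1 + real n)\<^sup>2) ^ p" using N0 by (intro power_mono) auto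
      also have "\<dots> = 4 ^ p * ((1 + real n) ^ p)\<^sup>2"
        by (simp add: power_mult_distrib power_mult[symmetric] mult.commute)
      finally have "N ^ p / ((1 + real n) ^ p)\<^sup>2 \<le> 4 ^ p" by (simp add: divide_le_eq)
      then have "1 / ((1 + real n) ^ p)\<^sup>2 \<le> 4 ^ p / N ^ p" using N0 by (simp add: field_simps)
      then show ?thesis using N0 by (simp add: powr_minus powr_realpow power_divide divide_inverse power_inverse)
    qed
    have h2: "(\<integral>m. dm.far_majorant (T n) m \<partial>countZ2)\<^sup>2 \<le> J\<^sup>2 * N powr (- real p)"
    proof -
      have "(\<integral>m. dm.far_majorant (T n) m \<partial>countZ2) \<le> exp (- b * T n) * J"
        using dm.far_majorant_integral_le[OF bm(1) \<beta>(1), of "T n"] by (simp add: J_def)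
      also have "\<dots> \<le> N powr (- real p / 2) * J"
      proof (intro mult_right_mono J0)
        \<comment> \<open>The band width \<open>q * ln N\<close> turns exponential decay at rate
          \<open>b\<close> into the power \<open>- (q * b)\<close> of \<open>N\<close>, which is at
          most \<open>- p / 2\<close>.\<close>
        have "exp (- b * T n) = N powr (- (q * b))" using N0 by (simp add: T_def N_def powr_def mult_ac)
        also have "\<dots> \<le> N powr (- real p / 2)" using N1 q(2) by (intro powr_mono) auto
        finally show "exp (- b * T n) \<le> N powr (- real p / 2)" .
      qed
      finally have "(\<integral>m. dm.far_majorant (T n) m \<partial>countZ2)\<^sup>2 \<le> (N powr (- real p / 2) * J)\<^sup>2"
        using dm.far_majorant_nonneg by (intro power_mono Bochner_Integration.integral_nonneg) auto
      also have "\<dots> = J\<^sup>2 * N powr (- real p)"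
      proof -
        have "(N powr (- real p / 2))\<^sup>2 = N powr (- real p)"
          by (simp add: power2_eq_square flip: powr_add)
        then show ?thesis by (simp add: power_mult_distrib)
      qed
      finally show ?thesis .
    qed
    have w0: "?w \<ge> 0" by simp
    have "sqnorm countZ2 (\<lambda>k. ?x k - ?y k) \<le> (E * N powr (- real p)) * ?w"
    proof (rule order_trans[OF err], rule mult_right_mono[OF _ w0])
      have "(2 + 4 * dm.majorant_sum\<^sup>2 / c) * (1 / (1 + real n) ^ p)\<^sup>2 \<le> (2 + 4 * dm.majorant_sum\<^sup>2 / c) * (4 ^ p * N powr (- real p))"
        using c by (intro mult_left_mono h1) auto
      moreover have "4 * (\<integral>m. dm.far_majorant (T n) m \<partial>countZ2)\<^sup>2 / c \<le> 4 * (J\<^sup>2 * N powr (- real p)) / c"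
        using c h2 by (intro divide_right_mono mult_left_mono) auto
      ultimately show "(2 + 4 * dm.majorant_sum\<^sup>2 / c) * (1 / (1 + real n) ^ p)\<^sup>2 + 4 * (\<integral>m. dm.far_majorant (T n) m \<partial>countZ2)\<^sup>2 / c \<le> E * N powr (- real p)"
        unfolding E_def distrib_right by (simp add: mult_ac)
    qed
    moreover have "sqnorm SqM (\<lambda>t. \<rho> t - \<rho>t t) = sqnorm countZ2 (\<lambda>k. ?x k - ?y k)"
      using Parseval(2)[OF sqint_diff(1)[OF \<rho>s ts]] by (simp add: fcoef_diff[OF \<rho>s ts, abs_def])
    ultimately have "L2norm (\<lambda>t. \<rho> t - \<rho>t t) \<le> sqrt ((E * N powr (- real p)) * ?w)"
      unfolding L2norm_eq by simp
    also have "\<dots> = sqrt E * N powr (- real p / 2) * Hpnorm p \<rho>"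
    proof -
      have "sqrt (N powr (- real p)) = N powr (- real p / 2)"
        using N0 by (simp add: powr_half_sqrt[symmetric] powr_powr)
      then show ?thesis by (simp add: Hpnorm_eq[OF \<rho>H] real_sqrt_mult)
    qed
    finally show ?thesis by (simp add: N_def)
  qed
  have "\<forall>\<^sub>F n in sequentially. sqrt E / sqrt c \<le> ln (bigN n)"
    using N_tends by (simp add: filterlim_at_top)
  then obtain n1 where n1: "\<And>n. n \<ge> n1 \<Longrightarrow> sqrt E / sqrt c \<le> ln (bigN n)" by (auto simp: eventually_sequentially)
  have part2': "L2norm (\<lambda>t. \<rho> t - \<rho>t t) \<le> sqrt c * bigN n powr (- real p / 2) * ln (bigN n) * Hpnorm p \<rho>"
    if n: "n \<ge> max n0 n1" and \<rho>t: "\<rho>t \<in> Xn n" and eq: "\<forall>t. \<rho>t t - Ktop Gamma q n \<rho>t t = Pn n g t" for n \<rho>t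
  proof -
    have "sqrt E \<le> sqrt c * ln (bigN n)" using n1[of n] n c by (simp add: divide_le_eq mult.commute)
    then have "sqrt E * (bigN n powr (- real p / 2) * Hpnorm p \<rho>) \<le> (sqrt c * ln (bigN n)) * (bigN n powr (- real p / 2) * Hpnorm p \<rho>)"
      by (intro mult_right_mono mult_nonneg_nonneg) (auto simp: Hpnorm_eq[OF \<rho>H])
    then show ?thesis using part2[OF _ \<rho>t eq] n by (simp add: mult_ac)
  qed
  show ?thesis
  proof (intro conjI \<rho>H exI[of _ "sqrt c"] exI[of _ "max n0 n1"] allI impI ballI)
    show "sqrt c > 0" using c by simp
  qed (use part1 part2' in auto)
qed

end
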